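(* Let $w_0$ be the long element of the Weyl group $W$. As operators on $\mathcal{K}$, $$\mathcal{D}_{w_0}=\frac{1}{\Delta}\cdot\sum_{w\in W}\operatorname{sgn}(w)\cdot\prod_{\alpha\in\Phi(w^{-1})}x^{m(\alpha)\alpha}\cdot w,$$ where on the right each $w\in W$ stands for the operator $f\mapsto w(f)$ of the metaplectic action of $W$ on $\mathcal{K}$, and rational functions stand for multiplication operators.
   Context: Root data. $\Phi$ is an irreducible reduced root system of rank $r$ with Weyl group $W$, decomposed into positive and negative roots $\Phi=\Phi^+\cup\Phi^-$, with simple roots $\alpha_1,\dots,\alpha_r$; $\sigma_i\in W$ is the simple reflection of $\alpha_i$, and $\operatorname{sgn}$ is the sign character of $W$ ($\operatorname{sgn}(\sigma_i)=-1$). For $w\in W$ put $\Phi(w)=\{\alpha\in\Phi^+: w(\alpha)\in\Phi^-\}$. $\Lambda$ is a lattice containing $\Phi$ as a subset, on which $W$ acts, and $Q$ is a $W$-invariant $\mathbb{Z}$-valued quadratic form on $\Lambda$, with bilinear form $B(\alpha,\beta)=Q(\alpha+\beta)-Q(\alpha)-Q(\beta)$. Fix a positive integer $n$. Put $m(\alpha)=n/\gcd(n,Q(\alpha))$ for $\alpha\in\Phi$, and $\Lambda_0=\{\lambda\in\Lambda: B(\alpha,\lambda)\equiv0 \bmod n\text{ for all simple roots }\alpha\}$. Let $\lambda\mapsto\bar\lambda$ be the projection $\Lambda\to\Lambda/\Lambda_0$. $\mathcal{K}$ is the field of fractions of the ring $\mathbb{C}[\Lambda]$ of Laurent polynomials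 on $\Lambda$ (with basis $x^\lambda$, $\lambda\in\Lambda$). The permutation action $(w,f)\mapsto w.f$ of $W$ on $\mathcal{K}$ is given by $w.x^\lambda=x^{w\lambda}$, extended linearly and multiplicatively. Each character $\xi$ of $\Lambda/\Lambda_0$ acts on $\mathcal{K}$ by the field automorphism over $\mathbb{C}$ with $\xi(x^\lambda)=\xi(\bar\lambda)x^\lambda$; put $\mathcal{K}_{\bar\lambda}=\{f\in\mathcal{K}:\xi(f)=\xi(\bar\lambda)f\text{ for all }\xi\}$, so that $\mathcal{K}=\bigoplus_{\bar\lambda\in\Lambda/\Lambda_0}\mathcal{K}_{\bar\lambda}$. Parameters. $v,g_0,\dots,g_{n-1}$ are nonzero complex numbers with $g_0=-1$ and $g_ig_{n-i}=v^{-1}$ for $i=1,\dots,n-1$; for other integers $j$, $g_j:=g_{r_n(j)}$, where for a positive integer $m$, $r_m(j)\in\{0,\dots,m-1\}$ denotes the remainder of $j$ on division by $m$. Metaplectic action. For $f\in\mathcal{K}_{\bar\lambda}$, with $\lambda$ any lift of $\bar\lambda$ to $\Lambda$, $$\sigma_i(f)=\frac{\sigma_i.f}{1-vx^{m(\alpha_i)\alpha_i}}\cdot\Bigl[x^{-r_{m(\alpha_i)}\left(-\frac{B(\lambda,\alpha_i)}{Q(\alpha_i)}\right)\cdot\alpha_i}\cdot(1-v)-v\cdot g_{Q(\alpha_i)-B(\lambda,\alpha_i)}\cdot x^{(1-m(\alpha_i))\alpha_i}\cdot(1-x^{m(\alpha_i)\alpha_i})\Bigr],$$ extended to $\mathcal{K}$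 by additivity. These operators satisfy the defining relations of $W$ (Chinta–Gunnells), so this extends to an action $(w,f)\mapsto w(f)$ of $W$ on $\mathcal{K}$, which is $\mathbb{C}$-linear but in general not multiplicative. Demazure operators. For $1\le i\le r$ and $f\in\mathcal{K}$, $$\mathcal{D}_i(f)=\frac{f-x^{m(\alpha_i)\alpha_i}\cdot\sigma_i(f)}{1-x^{m(\alpha_i)\alpha_i}},$$ with $\sigma_i(f)$ the metaplectic action. For $w\in W$ with reduced expression $w=\sigma_{i_1}\cdots\sigma_{i_l}$, put $\mathcal{D}_w=\mathcal{D}_{i_1}\cdots\mathcal{D}_{i_l}$; this is independent of the reduced expression because the $\mathcal{D}_i$ satisfy the braid relations. Finally $\Delta=\prod_{\alpha\in\Phi^+}\bigl(1-x^{m(\alpha)\alpha}\bigr)$. *)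

theory Defs
  imports Complex_Main "HOL-Library.Poly_Mapping" "HOL-Computational_Algebra.Fraction_Field"
begin

section \<open>Lattices, Laurent polynomials and rational functions\<close>

text \<open>
  A lattice of finite rank is modelled as the free abelian group on a finite type \<open>'d\<close>, with
  scalar multiplication \<^const>\<open>frag_cmul\<close>. The linear order on \<open>'d\<close> plays no mathematical role:
  it makes the lattice an ordered group, from which the library derives that its group algebra,
  i.e. the ring of Laurent polynomials with convolution product, is an integral domain.
\<close>

type_synonym 'd lattice = "'d \<Rightarrow>\<^sub>0 int"
type_synonym 'd laurent = "'d lattice \<Rightarrow>\<^sub>0 complex"
type_synonym 'd ratfun = "'d laurent fract"

definition const :: "complex \<Rightarrow> 'd::{finite,linorder} ratfun" where
  "const c = Fract (Poly_Mapping.single 0 c) 1"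

definition xpow :: "'d::{finite,linorder} lattice \<Rightarrow> 'd ratfun" where
  "xpow l = Fract (Poly_Mapping.single l 1) 1"

definition laurent_subst ::
    "('d::{finite,linorder} lattice \<Rightarrow> 'd ratfun) \<Rightarrow> 'd laurent \<Rightarrow> 'd ratfun" where
  "laurent_subst t p = (\<Sum>l\<in>Poly_Mapping.keys p. const (Poly_Mapping.lookup p l) * t l)"

text \<open>
  The linear and multiplicative extension of the assignment \<open>x\<^sup>l \<mapsto> t l\<close> to the fraction field.
  The description is proper when \<open>t\<close> turns sums into products and \<^term>\<open>laurent_subst t\<close> is
  injective, which is the case in both uses below.
\<close>

definition ratfun_subst ::
    "('d::{finite,linorder} lattice \<Rightarrow> 'd ratfun) \<Rightarrow> 'd ratfun \<Rightarrow> 'd ratfun" where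
  "ratfun_subst t f = (THE h. \<exists>p q. q \<noteq> 0 \<and> f = Fract p q \<and>
      h = laurent_subst t p / laurent_subst t q)"

definition perm_act ::
    "('d::{finite,linorder} lattice \<Rightarrow> 'd lattice) \<Rightarrow> 'd ratfun \<Rightarrow> 'd ratfun" where
  "perm_act w = ratfun_subst (\<lambda>l. xpow (w l))"

definition char_act ::
    "('d::{finite,linorder} lattice \<Rightarrow> complex) \<Rightarrow> 'd ratfun \<Rightarrow> 'd ratfun" where
  "char_act \<xi> = ratfun_subst (\<lambda>l. const (\<xi> l) * xpow l)"


section \<open>Root data\<close>

text \<open>
  \<open>refl M \<alpha>\<close> is the automorphism by which the reflection in the root \<open>\<alpha>\<close> acts on the lattice;
  \<open>simple M i\<close> is the \<open>i\<close>-th simple root for \<open>1 \<le> i \<le> rank M\<close>; \<open>qform M\<close> is \<open>Q\<close>, \<open>cover M\<close> is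
  \<open>n\<close>, and \<open>gpar M i\<close> is \<open>g\<^sub>i\<close> for \<open>i < n\<close>.
\<close>

record 'd metaplectic_data =
  roots :: "'d lattice set"
  refl :: "'d lattice \<Rightarrow> 'd lattice \<Rightarrow> 'd lattice"
  rank :: nat
  simple :: "nat \<Rightarrow> 'd lattice"
  qform :: "'d lattice \<Rightarrow> int"
  cover :: nat
  vpar :: complex
  gpar :: "nat \<Rightarrow> complex"

text \<open>
  As \<open>s \<alpha>\<close> is additive, \<open>\<beta> - s \<alpha> \<beta> = k \<alpha>\<close> defines a linear functional \<open>k = \<langle>\<beta>, \<alpha>\<^sup>\<or>\<rangle>\<close> on the root
  lattice with value 2 at \<open>\<alpha>\<close>, the coroot of \<open>\<alpha>\<close>. These are thus the usual axioms of a
  (crystallographic) root system in the real span of \<open>\<Phi>\<close>.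
\<close>

definition root_system ::
    "'d lattice set \<Rightarrow> ('d lattice \<Rightarrow> 'd lattice \<Rightarrow> 'd lattice) \<Rightarrow> bool" where
  "root_system \<Phi> s \<longleftrightarrow> finite \<Phi> \<and> \<Phi> \<noteq> {} \<and> 0 \<notin> \<Phi> \<and>
     (\<forall>\<alpha>\<in>\<Phi>. additive (s \<alpha>) \<and> s \<alpha> \<alpha> = - \<alpha> \<and>
        (\<forall>\<beta>\<in>\<Phi>. s \<alpha> \<beta> \<in> \<Phi> \<and> (\<exists>k. s \<alpha> \<beta> = \<beta> - frag_cmul k \<alpha>)))"

definition reduced_roots :: "'d lattice set \<Rightarrow> bool" where
  "reduced_roots \<Phi> \<longleftrightarrow> (\<forall>\<alpha>\<in>\<Phi>. \<forall>\<beta>\<in>\<Phi>. \<forall>k l.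
     k \<noteq> 0 \<longrightarrow> frag_cmul k \<beta> = frag_cmul l \<alpha> \<longrightarrow> \<beta> = \<alpha> \<or> \<beta> = - \<alpha>)"

text \<open>The equation \<open>s \<alpha> \<beta> = \<beta>\<close> says that \<open>\<alpha>\<close> and \<open>\<beta>\<close> are orthogonal.\<close>

definition irreducible_roots ::
    "'d lattice set \<Rightarrow> ('d lattice \<Rightarrow> 'd lattice \<Rightarrow> 'd lattice) \<Rightarrow> bool" where
  "irreducible_roots \<Phi> s \<longleftrightarrow> \<not> (\<exists>A B. A \<noteq> {} \<and> B \<noteq> {} \<and> A \<union> B = \<Phi> \<and> A \<inter> B = {} \<and>
     (\<forall>\<alpha>\<in>A. \<forall>\<beta>\<in>B. s \<alpha> \<beta> = \<beta>))"

definition positive_roots :: "'d metaplectic_data \<Rightarrow> 'd lattice set" where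
  "positive_roots M = {\<beta>\<in>roots M. \<exists>k. (\<forall>i\<in>{1..rank M}. 0 \<le> k i) \<and>
     \<beta> = (\<Sum>i\<in>{1..rank M}. frag_cmul (k i) (simple M i))}"

definition negative_roots :: "'d metaplectic_data \<Rightarrow> 'd lattice set" where
  "negative_roots M = {\<beta>\<in>roots M. - \<beta> \<in> positive_roots M}"

definition simple_system :: "'d metaplectic_data \<Rightarrow> bool" where
  "simple_system M \<longleftrightarrow>
     (\<forall>i\<in>{1..rank M}. simple M i \<in> roots M) \<and>
     (\<forall>k. (\<Sum>i\<in>{1..rank M}. frag_cmul (k i) (simple M i)) = 0 \<longrightarrow> (\<forall>i\<in>{1..rank M}. k i = 0)) \<and>
     roots M = positive_roots M \<union> negative_roots M"

definition bform :: "'d metaplectic_data \<Rightarrow> 'd lattice \<Rightarrow> 'd lattice \<Rightarrow> int" where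
  "bform M l l' = qform M (l + l') - qform M l - qform M l'"

text \<open>
  The Weyl group is generated by the reflections subject to the relations
  \<open>s\<^sub>\<alpha>\<^sup>2 = 1\<close> and \<open>s\<^sub>\<alpha> s\<^sub>\<beta> s\<^sub>\<alpha> = s\<^sub>\<gamma>\<close> with \<open>\<gamma> = s\<^sub>\<alpha>(\<beta>)\<close>, so \<open>refl_square\<close> and \<open>refl_conj\<close> say that
  it acts on the lattice. The assumption \<open>integrality\<close> says that \<open>B(\<lambda>, \<alpha>\<^sub>i) / Q(\<alpha>\<^sub>i)\<close>, which
  is reduced modulo \<open>m(\<alpha>\<^sub>i)\<close> in the metaplectic action, is an integer.
\<close>

locale metaplectic_datum =
  fixes M :: "'d::{finite,linorder} metaplectic_data"
  assumes root_system: "root_system (roots M) (refl M)"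
    and reduced: "reduced_roots (roots M)"
    and irreducible: "irreducible_roots (roots M) (refl M)"
    and simple_system: "simple_system M"
    and refl_square: "\<alpha> \<in> roots M \<Longrightarrow> refl M \<alpha> \<circ> refl M \<alpha> = id"
    and refl_conj: "\<alpha> \<in> roots M \<Longrightarrow> \<beta> \<in> roots M \<Longrightarrow>
          refl M \<alpha> \<circ> refl M \<beta> \<circ> refl M \<alpha> = refl M (refl M \<alpha> \<beta>)"
    and qform_scale: "qform M (frag_cmul k l) = k\<^sup>2 * qform M l"
    and bform_additive: "additive (bform M l)"
    and qform_invariant: "\<alpha> \<in> roots M \<Longrightarrow> qform M (refl M \<alpha> l) = qform M l"
    and integrality: "i \<in> {1..rank M} \<Longrightarrow> qform M (simple M i) dvd bform M l (simple M i)"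
    and cover_pos: "0 < cover M"
    and vpar_nonzero: "vpar M \<noteq> 0"
    and gpar_nonzero: "j < cover M \<Longrightarrow> gpar M j \<noteq> 0"
    and gpar_0: "gpar M 0 = -1"
    and gpar_mult: "1 \<le> j \<Longrightarrow> j \<le> cover M - 1 \<Longrightarrow>
          gpar M j * gpar M (cover M - j) = inverse (vpar M)"


section \<open>The Weyl group\<close>

abbreviation simple_refl :: "'d metaplectic_data \<Rightarrow> nat \<Rightarrow> 'd lattice \<Rightarrow> 'd lattice" where
  "simple_refl M i \<equiv> refl M (simple M i)"

inductive_set weyl_group :: "'d metaplectic_data \<Rightarrow> ('d lattice \<Rightarrow> 'd lattice) set"
  for M :: "'d metaplectic_data" where
  id: "id \<in> weyl_group M"
| refl: "\<alpha> \<in> roots M \<Longrightarrow> w \<in> weyl_group M \<Longrightarrow> refl M \<alpha> \<circ> w \<in> weyl_group M"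

definition sign_character ::
    "'d metaplectic_data \<Rightarrow> (('d lattice \<Rightarrow> 'd lattice) \<Rightarrow> int) \<Rightarrow> bool" where
  "sign_character M \<epsilon> \<longleftrightarrow>
     (\<forall>w\<in>weyl_group M. \<forall>w'\<in>weyl_group M. \<epsilon> (w \<circ> w') = \<epsilon> w * \<epsilon> w') \<and>
     (\<forall>i\<in>{1..rank M}. \<epsilon> (simple_refl M i) = -1)"

definition inversions ::
    "'d metaplectic_data \<Rightarrow> ('d lattice \<Rightarrow> 'd lattice) \<Rightarrow> 'd lattice set" where
  "inversions M w = {\<alpha>\<in>positive_roots M. w \<alpha> \<in> negative_roots M}"

definition word_for ::
    "'d metaplectic_data \<Rightarrow> nat list \<Rightarrow> ('d lattice \<Rightarrow> 'd lattice) \<Rightarrow> bool" where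
  "word_for M is w \<longleftrightarrow> set is \<subseteq> {1..rank M} \<and> w = foldr (\<lambda>i u. simple_refl M i \<circ> u) is id"

definition weyl_length :: "'d metaplectic_data \<Rightarrow> ('d lattice \<Rightarrow> 'd lattice) \<Rightarrow> nat" where
  "weyl_length M w = (LEAST k. \<exists>is. word_for M is w \<and> length is = k)"

definition reduced_word ::
    "'d metaplectic_data \<Rightarrow> nat list \<Rightarrow> ('d lattice \<Rightarrow> 'd lattice) \<Rightarrow> bool" where
  "reduced_word M is w \<longleftrightarrow> word_for M is w \<and> length is = weyl_length M w"

definition long_element :: "'d metaplectic_data \<Rightarrow> ('d lattice \<Rightarrow> 'd lattice) \<Rightarrow> bool" where
  "long_element M w\<^sub>0 \<longleftrightarrow>
     w\<^sub>0 \<in> weyl_group M \<and> (\<forall>w\<in>weyl_group M. weyl_length M w \<le> weyl_length M w\<^sub>0)"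


section \<open>The metaplectic action\<close>

definition mroot :: "'d metaplectic_data \<Rightarrow> 'd lattice \<Rightarrow> int" where
  "mroot M \<alpha> = int (cover M) div gcd (int (cover M)) (qform M \<alpha>)"

definition gauss :: "'d metaplectic_data \<Rightarrow> int \<Rightarrow> complex" where
  "gauss M j = gpar M (nat (j mod int (cover M)))"

definition sublattice0 :: "'d metaplectic_data \<Rightarrow> 'd lattice set" where
  "sublattice0 M =
     {l. \<forall>i\<in>{1..rank M}. bform M (simple M i) l mod int (cover M) = 0}"

text \<open>The characters of \<open>\<Lambda>/\<Lambda>\<^sub>0\<close>, viewed as characters of \<open>\<Lambda>\<close> that are trivial on \<open>\<Lambda>\<^sub>0\<close>.\<close>

definition characters :: "'d metaplectic_data \<Rightarrow> ('d lattice \<Rightarrow> complex) set" where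
  "characters M = {\<xi>. (\<forall>l. \<xi> l \<noteq> 0) \<and> (\<forall>l l'. \<xi> (l + l') = \<xi> l * \<xi> l') \<and>
     (\<forall>l\<in>sublattice0 M. \<xi> l = 1)}"

text \<open>The component of the fraction field belonging to the class of \<open>l\<close> in \<open>\<Lambda>/\<Lambda>\<^sub>0\<close>.\<close>

definition component ::
    "'d::{finite,linorder} metaplectic_data \<Rightarrow> 'd lattice \<Rightarrow> 'd ratfun set" where
  "component M l = {f. \<forall>\<xi>\<in>characters M. char_act \<xi> f = const (\<xi> l) * f}"

definition refl_formula :: "'d::{finite,linorder} metaplectic_data \<Rightarrow> nat \<Rightarrow> 'd lattice \<Rightarrow>
    'd ratfun \<Rightarrow> 'd ratfun" where
  "refl_formula M i l f =
     (let \<alpha> = simple M i; m = mroot M \<alpha>; Q = qform M \<alpha>; b = bform M l \<alpha>; v = vpar M in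
      perm_act (refl M \<alpha>) f / (1 - const v * xpow (frag_cmul m \<alpha>)) *
      (xpow (frag_cmul (- ((- (b div Q)) mod m)) \<alpha>) * (1 - const v)
       - const v * const (gauss M (Q - b)) * xpow (frag_cmul (1 - m) \<alpha>)
           * (1 - xpow (frag_cmul m \<alpha>))))"

text \<open>
  The extension by additivity of the formula on the components: as the fraction field is their
  direct sum, there is exactly one such operator.
\<close>

definition meta_refl :: "'d::{finite,linorder} metaplectic_data \<Rightarrow> nat \<Rightarrow>
    'd ratfun \<Rightarrow> 'd ratfun" where
  "meta_refl M i = (THE T. additive T \<and>
     (\<forall>l. \<forall>f\<in>component M l. T f = refl_formula M i l f))"

text \<open>
  The action of the Weyl group on the fraction field that extends the operators
  \<^term>\<open>meta_refl M i\<close>. It is unique on the Weyl group, since the simple reflections generate; it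
  exists by a theorem of Chinta and Gunnells, according to which these operators satisfy the
  defining relations of the Weyl group.
\<close>

definition metaplectic_action :: "'d::{finite,linorder} metaplectic_data \<Rightarrow>
    (('d lattice \<Rightarrow> 'd lattice) \<Rightarrow> 'd ratfun \<Rightarrow> 'd ratfun) \<Rightarrow> bool" where
  "metaplectic_action M act \<longleftrightarrow>
     act id = id \<and>
     (\<forall>w\<in>weyl_group M. \<forall>w'\<in>weyl_group M. act (w \<circ> w') = act w \<circ> act w') \<and>
     (\<forall>i\<in>{1..rank M}. act (simple_refl M i) = meta_refl M i)"


section \<open>Demazure operators\<close>

definition demazure :: "'d::{finite,linorder} metaplectic_data \<Rightarrow> nat \<Rightarrow>
    'd ratfun \<Rightarrow> 'd ratfun" where
  "demazure M i f =
     (f - xpow (frag_cmul (mroot M (simple M i)) (simple M i)) * meta_refl M i f)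
       / (1 - xpow (frag_cmul (mroot M (simple M i)) (simple M i)))"

definition demazure_word :: "'d::{finite,linorder} metaplectic_data \<Rightarrow> nat list \<Rightarrow>
    'd ratfun \<Rightarrow> 'd ratfun" where
  "demazure_word M is = foldr (\<lambda>i T. demazure M i \<circ> T) is id"

definition weyl_denominator :: "'d::{finite,linorder} metaplectic_data \<Rightarrow> 'd ratfun" where
  "weyl_denominator M =
     (\<Prod>\<alpha>\<in>positive_roots M. 1 - xpow (frag_cmul (mroot M \<alpha>) \<alpha>))"

end

theory Submission
  imports Defs "HOL-Library.Function_Algebras" "HOL-Library.FuncSet"
begin

text \<open>
  Write \<open>y\<^sub>\<alpha> = x\<^bsup>m(\<alpha>)\<alpha>\<^esup>\<close>. The operator \<open>\<sigma>\<^sub>i\<close> is semilinear over the field generated by the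
  monomials of exponents in \<open>\<Lambda>\<^sub>0\<close>, which contains all \<open>y\<^sub>\<alpha>\<close>, so it suffices to prove the identity
  in the twisted group algebra of the permutation action, where
  \<open>\<D>\<^sub>i = (1 - y\<^sub>i)\<^sup>-\<^sup>1(1 - y\<^sub>i \<sigma>\<^sub>i) = (1 + \<sigma>\<^sub>i)(1 - y\<^sub>i)\<^sup>-\<^sup>1\<close>. In rank two, the alternating product of
  maximal length is found to be \<open>\<Sum>\<^sub>w w \<Delta>\<^sup>-\<^sup>1\<close>, which does not depend on the first letter. These
  braid relations give \<open>\<D>\<^sub>i \<D>\<^bsub>w\<^sub>0\<^esub> = \<D>\<^bsub>w\<^sub>0\<^esub>\<close>, hence \<open>\<sigma>\<^sub>i \<D>\<^bsub>w\<^sub>0\<^esub> = \<D>\<^bsub>w\<^sub>0\<^esub>\<close>, for all \<open>i\<close>. The coefficients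
  of \<open>\<D>\<^bsub>w\<^sub>0\<^esub>\<close> are therefore determined by the one at \<open>w\<^sub>0\<close>, which is \<open>\<Prod> -y\<^sub>\<alpha> / (1 - y\<^sub>\<alpha>)\<close>, and the
  coefficients of the right-hand side satisfy the same recursion.
\<close>

section \<open>Rational functions on the lattice\<close>

text \<open>Coefficient vectors on group elements separate two structures: their products involve
  the permutation action alone, which is multiplicative, and the metaplectic action returns when a
  vector is read as an operator. The price is that all coefficients must stay in a set of
  multipliers over which every \<open>meta_refl M i\<close> is semilinear and which the permutation
  action preserves. The invariance of the long product needs more than the rank two relations: it is
  visible only for a reduced word that begins with the letter in question, so independence of the
  reduced word has to be established for coefficient vectors, by exchange and descent arguments on
  roots. In rank two, two sets of Cartan integers occur. Equality of words in the Weyl group depends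
  on those of the roots, equality of coefficients on those of the scaled roots, and scaling may
  exchange long and short. Hence the formulas for two root lengths are needed in both
  orientations.\<close>

lemma const_0 [simp]: "const 0 = 0"
  by (simp add: const_def Zero_fract_def)

lemma const_1 [simp]: "const 1 = 1"
  by (simp add: const_def One_fract_def)

lemma const_add: "const (a + b) = const a + const b"
  by (simp add: const_def single_add)

lemma const_mult: "const (a * b) = const a * const b"
  by (simp add: const_def mult_single)

lemma const_eq_0_iff [simp]: "const a = 0 \<longleftrightarrow> a = 0"
  unfolding const_def Zero_fract_def
  by (simp add: eq_fract) (metis lookup_single_eq lookup_zero single_zero)

lemma const_sum: "const (sum f A) = (\<Sum>x\<in>A. const (f x))"
  by (induction A rule: infinite_finite_induct) (simp_all add: const_add)

lemma xpow_0 [simp]: "xpow 0 = 1"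
  by (simp add: xpow_def One_fract_def)

lemma xpow_add: "xpow (a + b) = xpow a * xpow b"
  by (simp add: xpow_def mult_single)

lemma xpow_power: "xpow (frag_cmul (int n) x) = xpow x ^ n"
  by (induction n) (simp_all add: frag_cmul_distrib xpow_add)

lemma xpow_nonzero [simp]: "xpow a \<noteq> 0"
  by (metis add.right_inverse mult_zero_left xpow_0 xpow_add zero_neq_one)

lemma xpow_minus: "xpow (- a) = inverse (xpow a)"
  by (metis add.right_inverse inverse_unique xpow_0 xpow_add)

lemma single_eq_1_iff: "Poly_Mapping.single a (1::complex) = 1 \<longleftrightarrow> a = 0"
  by (metis lookup_single_eq lookup_single_not_eq single_one zero_neq_one)

lemma xpow_eq_1_iff [simp]: "xpow a = 1 \<longleftrightarrow> a = 0"
  by (simp add: xpow_def One_fract_def eq_fract single_eq_1_iff)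

section \<open>Monomial substitutions in Laurent polynomials and fractions\<close>

lemma laurent_eq_sum_single:
  "(p :: 'd laurent) = (\<Sum>l\<in>Poly_Mapping.keys p. Poly_Mapping.single l (Poly_Mapping.lookup p l))"
  by (rule poly_mapping_eqI)
    (auto simp: lookup_sum lookup_single when_def in_keys_iff)

lemma laurent_subst_superset:
  assumes "finite A" "Poly_Mapping.keys p \<subseteq> A"
  shows "laurent_subst t p = (\<Sum>l\<in>A. const (Poly_Mapping.lookup p l) * t l)"
  unfolding laurent_subst_def using assms
  by (intro sum.mono_neutral_left) (auto simp: in_keys_iff)

lemma laurent_subst_add: "laurent_subst t (p + q) = laurent_subst t p + laurent_subst t q"
proof -
  let ?A = "Poly_Mapping.keys p \<union> Poly_Mapping.keys q"
  have "laurent_subst t (p + q) = (\<Sum>l\<in>?A. const (Poly_Mapping.lookup (p + q) l) * t l)"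
    by (intro laurent_subst_superset keys_add) auto
  then show ?thesis
    using laurent_subst_superset[of ?A p t] laurent_subst_superset[of ?A q t]
    by (simp add: lookup_add const_add ring_distribs sum.distrib)
qed

lemma laurent_subst_0 [simp]: "laurent_subst t 0 = 0"
  by (simp add: laurent_subst_def)

lemma laurent_subst_sum: "laurent_subst t (sum f A) = (\<Sum>x\<in>A. laurent_subst t (f x))"
  by (induction A rule: infinite_finite_induct) (simp_all add: laurent_subst_add)

lemma laurent_subst_single: "laurent_subst t (Poly_Mapping.single l c) = const c * t l"
  by (cases "c = 0") (simp_all add: laurent_subst_def)

lemma laurent_subst_mult:
  assumes "\<And>l l'. t (l + l') = t l * t l'"
  shows "laurent_subst t (p * q) = laurent_subst t p * laurent_subst t q"
proof -
  have "p * q = (\<Sum>l\<in>Poly_Mapping.keys p. \<Sum>l'\<in>Poly_Mapping.keys q.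
      Poly_Mapping.single (l + l') (Poly_Mapping.lookup p l * Poly_Mapping.lookup q l'))"
    by (subst laurent_eq_sum_single[of p], subst laurent_eq_sum_single[of q])
      (simp add: sum_product mult_single)
  then show ?thesis
    by (simp add: laurent_subst_sum laurent_subst_single assms const_mult)
      (simp add: laurent_subst_def sum_product ac_simps)
qed

text \<open>Both the permutation action and the action of the characters are of this form.\<close>

locale monomial_subst =
  fixes c :: "'d::{finite,linorder} lattice \<Rightarrow> complex" and w :: "'d lattice \<Rightarrow> 'd lattice"
    and t :: "'d lattice \<Rightarrow> 'd ratfun"
  assumes c_add: "c (l + l') = c l * c l'" and c_nonzero: "c l \<noteq> 0"
    and w_add: "w (l + l') = w l + w l'" and w_inj: "inj w"
  defines "t \<equiv> \<lambda>l. const (c l) * xpow (w l)"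
begin

lemma t_add: "t (l + l') = t l * t l'"
  by (simp add: t_def c_add w_add const_mult xpow_add)

lemma c_0: "c 0 = 1"
  using c_add[of 0 0] c_nonzero[of 0] by simp

lemma w_0: "w 0 = 0"
  using w_add[of 0 0] by simp

lemma t_0: "t 0 = 1"
  by (simp add: t_def c_0 w_0)

text \<open>The substitution carried out in the Laurent ring, before passing to fractions; there
  injectivity can be read off from coefficients.\<close>

definition laurent_image :: "'d laurent \<Rightarrow> 'd laurent" where
  "laurent_image p = (\<Sum>l\<in>Poly_Mapping.keys p.
     Poly_Mapping.single (w l) (Poly_Mapping.lookup p l * c l))"

lemma laurent_subst_eq: "laurent_subst t p = Fract (laurent_image p) 1"
proof -
  have sum: "Fract (sum f A) 1 = (\<Sum>x\<in>A. Fract (f x) 1)"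
    for f :: "'d lattice \<Rightarrow> 'd laurent" and A
  proof (induction A rule: infinite_finite_induct)
    case (insert x A)
    then show ?case
      by (simp flip: insert.IH)
  qed (simp_all add: Zero_fract_def)
  show ?thesis
    by (simp add: laurent_image_def sum laurent_subst_def t_def const_def xpow_def mult_single)
qed

lemma laurent_image_eq_0_iff: "laurent_image p = 0 \<longleftrightarrow> p = 0"
proof
  assume 0: "laurent_image p = 0"
  show "p = 0"
  proof (rule poly_mapping_eqI, rule ccontr)
    fix l assume "Poly_Mapping.lookup p l \<noteq> Poly_Mapping.lookup 0 l"
    then have l: "l \<in> Poly_Mapping.keys p"
      by (simp add: in_keys_iff)
    \<comment> \<open>As \<open>w\<close> is injective, distinct monomials of \<open>p\<close> keep
      distinct exponents, so a single term contributes here.\<close>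
    have "Poly_Mapping.lookup (laurent_image p) (w l) =
        (\<Sum>l'\<in>Poly_Mapping.keys p. if l' = l then Poly_Mapping.lookup p l * c l else 0)"
      unfolding laurent_image_def lookup_sum
      by (intro sum.cong) (auto simp: lookup_single when_def inj_eq[OF w_inj])
    then show False
      using 0 l c_nonzero[of l] by (simp add: in_keys_iff)
  qed
qed (simp add: laurent_image_def)

lemma laurent_subst_eq_0_iff: "laurent_subst t p = 0 \<longleftrightarrow> p = 0"
  by (simp add: laurent_subst_eq Zero_fract_def eq_fract laurent_image_eq_0_iff)

lemmas laurent_subst_times = laurent_subst_mult[of t, OF t_add]

text \<open>Makes the definite description proper: two fractions for the same element
  cross-multiply, and injectivity on Laurent polynomials keeps the new denominators nonzero.\<close>

lemma ratfun_subst_Fract: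
  assumes "q \<noteq> 0"
  shows "ratfun_subst t (Fract p q) = laurent_subst t p / laurent_subst t q"
  unfolding ratfun_subst_def
proof (rule the_equality)
  fix h assume "\<exists>p' q'. q' \<noteq> 0 \<and> Fract p q = Fract p' q' \<and>
      h = laurent_subst t p' / laurent_subst t q'"
  then obtain p' q' where *: "q' \<noteq> 0" "Fract p q = Fract p' q'"
    "h = laurent_subst t p' / laurent_subst t q'" by blast
  then have "p * q' = p' * q"
    using assms by (simp add: eq_fract)
  then have "laurent_subst t p * laurent_subst t q' = laurent_subst t p' * laurent_subst t q"
    by (simp flip: laurent_subst_times)
  then show "h = laurent_subst t p / laurent_subst t q"
    using * assms by (simp add: laurent_subst_eq_0_iff frac_eq_eq)
qed (use assms in blast)

lemma ratfun_subst_add: "ratfun_subst t (f + g) = ratfun_subst t f + ratfun_subst t g"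
proof (cases f, cases g)
  fix p q p' q' assume "f = Fract p q" "g = Fract p' q'" "q \<noteq> 0" "q' \<noteq> 0"
  then show ?thesis
    by (simp add: ratfun_subst_Fract laurent_subst_times laurent_subst_add
        laurent_subst_eq_0_iff add_frac_eq)
qed

lemma ratfun_subst_mult: "ratfun_subst t (f * g) = ratfun_subst t f * ratfun_subst t g"
proof (cases f, cases g)
  fix p q p' q' assume "f = Fract p q" "g = Fract p' q'" "q \<noteq> 0" "q' \<noteq> 0"
  then show ?thesis
    by (simp add: ratfun_subst_Fract laurent_subst_times)
qed

lemma laurent_subst_1: "laurent_subst t 1 = 1"
  using laurent_subst_single[of t 0 1] by (simp add: t_0)

lemma ratfun_subst_single: "ratfun_subst t (Fract (Poly_Mapping.single l a) 1) = const a * t l"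
  by (simp add: ratfun_subst_Fract laurent_subst_single laurent_subst_1)

lemma ratfun_subst_const: "ratfun_subst t (const a) = const a"
  using ratfun_subst_single[of 0 a] by (simp add: const_def t_0)

lemma ratfun_subst_xpow: "ratfun_subst t (xpow l) = t l"
  using ratfun_subst_single[of l 1] by (simp add: xpow_def)

end

locale field_endo =
  fixes h :: "'a::field \<Rightarrow> 'a"
  assumes add: "h (x + y) = h x + h y" and mult: "h (x * y) = h x * h y" and one [simp]: "h 1 = 1"
begin

lemma zero [simp]: "h 0 = 0"
  by (metis add add_0 add_cancel_right_right)

lemma minus: "h (- x) = - h x"
  using add[of x "- x"] by (simp add: eq_neg_iff_add_eq_0 add.commute)

lemma diff: "h (x - y) = h x - h y"
  using add[of x "- y"] by (simp add: minus)

lemma inverse: "h (inverse x) = inverse (h x)"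
proof (cases "x = 0")
  case False
  then show ?thesis
    using mult[of x "inverse x"] by (simp add: inverse_unique)
qed simp

lemma divide: "h (x / y) = h x / h y"
  by (simp add: divide_inverse mult inverse)

lemma eq_0_iff [simp]: "h x = 0 \<longleftrightarrow> x = 0"
  by (metis mult mult_zero_left one right_inverse zero zero_neq_one)

lemma sum: "h (sum f A) = (\<Sum>x\<in>A. h (f x))"
  by (induction A rule: infinite_finite_induct) (simp_all add: add)

lemma prod: "h (prod f A) = (\<Prod>x\<in>A. h (f x))"
  by (induction A rule: infinite_finite_induct) (simp_all add: mult)

lemma of_int: "h (of_int k) = of_int k"
proof -
  have "h (of_nat n) = of_nat n" for n
    by (induction n) (simp_all add: add)
  then show ?thesis
    by (cases k rule: int_diff_cases) (simp add: diff)
qed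

end

lemma (in monomial_subst) field_endo: "field_endo (ratfun_subst t)"
  using ratfun_subst_add ratfun_subst_mult ratfun_subst_xpow[of 0] by unfold_locales (simp_all add: t_0)

lemma
  assumes "additive w" "inj w"
  shows field_endo_perm_act: "field_endo (perm_act w)"
    and perm_act_const: "perm_act w (const a) = const a"
    and perm_act_xpow: "perm_act w (xpow l) = xpow (w l)"
proof -
  interpret monomial_subst "\<lambda>_. 1" w "\<lambda>l. const 1 * xpow (w l)"
    using assms by unfold_locales (simp_all add: additive_def)
  show "field_endo (perm_act w)" "perm_act w (const a) = const a"
    "perm_act w (xpow l) = xpow (w l)"
    using field_endo ratfun_subst_const[of a] ratfun_subst_xpow[of l] by (simp_all add: perm_act_def)
qed

text \<open>The last conclusion keeps conjugates of a Laurent polynomial inside the Laurent ring;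
  this lets a denominator be replaced by its norm when components are extracted.\<close>

lemma
  assumes "\<And>l. \<xi> l \<noteq> 0" "\<And>l l'. \<xi> (l + l') = \<xi> l * \<xi> l'"
  shows field_endo_char_act: "field_endo (char_act \<xi>)"
    and char_act_const: "char_act \<xi> (const a) = const a"
    and char_act_xpow: "char_act \<xi> (xpow l) = const (\<xi> l) * xpow l"
    and char_act_Laurent: "q \<noteq> 0 \<Longrightarrow> \<exists>r. r \<noteq> 0 \<and> char_act \<xi> (Fract q 1) = Fract r 1"
proof -
  interpret monomial_subst \<xi> "\<lambda>l. l" "\<lambda>l. const (\<xi> l) * xpow l"
    using assms by unfold_locales simp_all
  show "field_endo (char_act \<xi>)" "char_act \<xi> (const a) = const a"
    "char_act \<xi> (xpow l) = const (\<xi> l) * xpow l"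
    using field_endo ratfun_subst_const[of a] ratfun_subst_xpow[of l] by (simp_all add: char_act_def)
  show "\<exists>r. r \<noteq> 0 \<and> char_act \<xi> (Fract q 1) = Fract r 1" if "q \<noteq> 0"
  proof -
    have "char_act \<xi> (Fract q 1) = laurent_subst (\<lambda>l. const (\<xi> l) * xpow l) q"
      by (simp add: char_act_def ratfun_subst_Fract laurent_subst_1)
    then show ?thesis
      using that laurent_image_eq_0_iff[of q] by (auto simp: laurent_subst_eq)
  qed
qed

lemma Fract_eq_sum: "Fract p 1 = (\<Sum>l\<in>Poly_Mapping.keys p. const (Poly_Mapping.lookup p l) * xpow l)"
  for p :: "'d::{finite,linorder} laurent"
proof -
  interpret monomial_subst "\<lambda>_. 1" "\<lambda>l. l" "\<lambda>l. const 1 * xpow l"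
    by unfold_locales simp_all
  show ?thesis
    using laurent_subst_eq[of p] laurent_eq_sum_single[of p]
    by (simp add: laurent_subst_def laurent_image_def)
qed

text \<open>Constants and monomials generate the field. The composition laws of both actions are
  reduced to generators in this way.\<close>

lemma ratfun_endo_eqI:
  fixes h h' :: "'d::{finite,linorder} ratfun \<Rightarrow> 'd ratfun"
  assumes "field_endo h" "field_endo h'"
    and "\<And>a. h (const a) = h' (const a)" "\<And>l. h (xpow l) = h' (xpow l)"
  shows "h f = h' f"
proof -
  interpret h: field_endo h by fact
  interpret h': field_endo h' by fact
  have eq: "h (Fract p 1) = h' (Fract p 1)" for p
    unfolding Fract_eq_sum by (simp add: h.sum h'.sum h.mult h'.mult assms)
  obtain p q where f: "f = Fract p q"
    by (cases f) auto
  have "h (Fract p 1 / Fract q 1) = h' (Fract p 1 / Fract q 1)"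
    by (simp only: h.divide h'.divide eq)
  then show ?thesis
    by (simp add: f)
qed

lemma perm_act_comp:
  assumes "additive w" "inj w" "additive w'" "inj w'"
  shows "perm_act w (perm_act w' f) = perm_act (w \<circ> w') f"
proof -
  interpret h: field_endo "perm_act w" using assms by (intro field_endo_perm_act)
  interpret h': field_endo "perm_act w'" using assms by (intro field_endo_perm_act)
  have ww: "additive (w \<circ> w')" "inj (w \<circ> w')"
    using assms by (auto simp: additive_def intro: inj_compose)
  have "field_endo (\<lambda>f. perm_act w (perm_act w' f))"
    by unfold_locales (simp_all add: h.add h'.add h.mult h'.mult)
  from ratfun_endo_eqI[OF this field_endo_perm_act[OF ww]] show ?thesis
    using assms ww by (simp add: perm_act_const perm_act_xpow)
qed

lemma perm_act_id [simp]: "perm_act id f = f"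
proof -
  have "additive id" "inj id"
    by (auto simp: additive_def)
  then show ?thesis
    using ratfun_endo_eqI[OF field_endo_perm_act, of id "\<lambda>f. f" f]
    by (simp add: perm_act_const perm_act_xpow field_endo_def)
qed

section \<open>Demazure operators in rank two\<close>

text \<open>One simple reflection in abstract form: \<open>s\<close> acts on scalars,
  \<open>S\<close> on vectors, and \<open>a\<close> stands for \<open>y\<close> of the simple root,
  so that \<open>s\<close> inverts it. The vectors are later the coefficient functions on group
  elements, with \<open>T i\<close> for \<open>S\<close>.\<close>

locale demazure_operator = s: field_endo s + module scale
  for s :: "'a::field \<Rightarrow> 'a" and scale :: "'a \<Rightarrow> 'v::ab_group_add \<Rightarrow> 'v" (infixr \<open>*s\<close> 75) +
  fixes S :: "'v \<Rightarrow> 'v" and a :: 'a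
  assumes s_s [simp]: "s (s c) = c" and S_S [simp]: "S (S x) = x"
    and S_add: "S (x + y) = S x + S y" and S_scale: "S (c *s x) = s c *s S x"
    and s_root: "s a = 1 / a" and root_nonzero: "a \<noteq> 0" and root_neq_1: "a \<noteq> 1"
begin

definition D :: "'v \<Rightarrow> 'v" where
  "D x = (1 / (1 - a)) *s (x - a *s S x)"

definition p :: 'a where
  "p = 1 / (1 - a)"

lemma s_p: "s p = - a / (1 - a)"
  unfolding p_def by (simp add: s.divide s.diff s_root) (use root_nonzero root_neq_1 in \<open>simp add: field_simps\<close>)

text \<open>The operator is multiplication by \<open>p\<close> followed by \<open>1 + S\<close>,
  because \<open>s p = - a / (1 - a)\<close>. In this form its values are visibly fixed by
  \<open>S\<close>.\<close>

lemma D_eq: "D x = p *s x + s p *s S x"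
  unfolding s_p unfolding p_def D_def
  by (simp add: scale_right_diff_distrib)

lemma S_D: "S (D x) = D x"
  by (simp add: D_eq S_add S_scale add.commute)

lemma p_add_s_p: "p + s p = 1"
  unfolding s_p unfolding p_def using root_neq_1
  by (simp add: field_simps)

lemma D_add: "D (x + y) = D x + D y"
  by (simp add: D_eq S_add scale_right_distrib)

text \<open>The result again has the shape \<open>e *s x + s e *s S x\<close>, so on a pair of terms
  exchanged by \<open>S\<close> only one coefficient has to be computed.\<close>

lemma D_scale_pair:
  "D (c *s x + d *s S x) = (p * c + s p * s d) *s x + s (p * c + s p * s d) *s S x"
  by (simp add: D_eq S_add S_scale s.add s.mult scale_right_distrib scale_left_distrib)

lemma D_scale_single: "D (c *s x) = (p * c) *s x + s (p * c) *s S x"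
  by (simp add: D_eq S_scale s.mult)

lemma D_scale_invariant:
  assumes "S x = x"
  shows "D (c *s x) = (p * c + s p * s c) *s x"
  by (simp add: D_eq S_scale assms scale_left_distrib)

end

text \<open>
  The products \<open>D\<^sub>s D\<^sub>t D\<^sub>s \<dots> D\<^sub>t\<close> in rank two are evaluated on a vector \<open>f\<close> with \<open>T f = f\<close>, which
  suffices since the rightmost factor takes values in such vectors. This halves the number of
  coefficients. The aim is the Weyl character formula \<open>\<Sum>\<^sub>w w(x / \<Delta>)\<close>, which is symmetric in \<open>s\<close>
  and \<open>t\<close>; below, \<open>K\<close> stands for \<open>(1 - b) / \<Delta>\<close>.
\<close>

locale demazure_pair =
  S: demazure_operator s scale S a + T: demazure_operator t scale T b
  for s t :: "'a::field \<Rightarrow> 'a" and scale :: "'a \<Rightarrow> 'v::ab_group_add \<Rightarrow> 'v" (infixr \<open>*s\<close> 75)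
    and S T :: "'v \<Rightarrow> 'v" and a b :: 'a
begin

lemma swap: "demazure_pair t s (*s) T S b a" ..

lemma scale_K_T_D:
  assumes "t K = K"
  shows "K *s T.D x = (K * T.p) *s x + T ((K * T.p) *s x)"
  by (simp add: T.D_eq T.S_scale T.s.mult S.scale_right_distrib assms)

lemma D2_eq_weyl_sum:
  assumes "s T.p = T.p" "t S.p = S.p" "\<And>x. S (T x) = T (S x)"
  shows "S.D (T.D x) = (let z = (S.p * T.p) *s x in z + T z + S z + S (T z))"
proof -
  have "s S.p = 1 - S.p" "t T.p = 1 - T.p"
    using S.p_add_s_p T.p_add_s_p by (simp_all add: algebra_simps)
  then have "t (s S.p) = s S.p" "s (t T.p) = t T.p"
    by (simp_all add: S.s.diff T.s.diff assms)
  then show ?thesis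
    by (simp add: S.D_eq T.D_eq T.S_scale S.S_scale T.S_add S.S_add S.s.mult T.s.mult assms Let_def
        S.scale_right_distrib ac_simps)
qed

text \<open>On a vector \<open>f\<close> fixed by \<open>T\<close>, the product has one term per
  coset: \<open>f\<close>, \<open>S f\<close>, \<open>T (S f)\<close>. The assumptions turn the
  first two coefficients into \<open>K\<close> and \<open>s K\<close>; the third is the image of the
  second under \<open>t\<close>.\<close>

lemma D3_eq_weyl_sum:
  assumes K: "T.p * S.p + t T.p * t S.p = K" "T.p * s S.p = s K" "t K = K"
    and braid: "\<And>x. S (T (S x)) = T (S (T x))"
  shows "T.D (S.D (T.D x)) = (let z = (K * T.p) *s x in z + T z + S z + S (T z) + T (S z) + T (S (T z)))"
proof -
  define f where "f = T.D x"
  have f: "T f = f"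
    by (simp add: f_def T.S_D)
  have "S.D f = S.p *s f + s S.p *s S f"
    by (rule S.D_eq)
  also have "T.D \<dots> = K *s f + (s K *s S f + t (s K) *s T (S f))"
    unfolding T.D_add T.D_scale_invariant[OF f] unfolding T.D_scale_single K ..
  also have "\<dots> = K *s f + S (K *s f) + T (S (K *s f))"
    by (simp add: S.S_scale T.S_scale)
  also have "K *s f = (K * T.p) *s x + T ((K * T.p) *s x)"
    by (simp add: f_def scale_K_T_D K)
  finally show ?thesis
    by (simp add: f_def Let_def S.S_add T.S_add)
qed

text \<open>There are four cosets, in two pairs exchanged by \<open>S\<close>, and one coefficient
  of each pair has to be checked. In the applications \<open>t K = K\<close> holds because
  \<open>K\<close> collects the positive roots other than \<open>b\<close>, which \<open>t\<close>
  permutes.\<close>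

lemma D4_eq_weyl_sum:
  assumes K: "S.p * (T.p * S.p + t T.p * t S.p) + s S.p * s (T.p * s S.p) = K"
      "S.p * t (T.p * s S.p) = t (s K)" "t K = K"
    and braid: "\<And>x. S (T (S (T x))) = T (S (T (S x)))"
  shows "S.D (T.D (S.D (T.D x))) = (let z = (K * T.p) *s x in
      z + T z + S z + S (T z) + T (S z) + T (S (T z)) + S (T (S z)) + S (T (S (T z))))"
proof -
  define f where "f = T.D x"
  have f: "T f = f"
    by (simp add: f_def T.S_D)
  have "S.D f = S.p *s f + s S.p *s S f"
    by (rule S.D_eq)
  also have "T.D \<dots> = ((T.p * S.p + t T.p * t S.p) *s f + (T.p * s S.p) *s S f) +
      t (T.p * s S.p) *s T (S f)"
    unfolding T.D_add T.D_scale_invariant[OF f] unfolding T.D_scale_single by (simp only: ac_simps)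
  also have "S.D \<dots> = (K *s f + s K *s S f) + (t (s K) *s T (S f) + s (t (s K)) *s S (T (S f)))"
    by (subst S.D_add, subst S.D_scale_pair, subst S.D_scale_single) (simp only: K)
  also have "\<dots> = K *s f + S (K *s f) + T (S (K *s f)) + S (T (S (K *s f)))"
    by (simp add: S.S_scale T.S_scale)
  also have "K *s f = (K * T.p) *s x + T ((K * T.p) *s x)"
    by (simp add: f_def scale_K_T_D K)
  finally show ?thesis
    by (simp add: f_def Let_def S.S_add T.S_add)
qed

text \<open>
  Here \<open>d\<close>, \<open>e\<close>, \<open>h\<close> are the coefficients after two, three and four of the factors applied to \<open>f\<close>;
  the missing ones are their images under \<open>s\<close> or \<open>t\<close>.
\<close>

lemma D6_eq_weyl_sum:
  fixes d0 d1 e0 e2 h0 h1 h3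
  assumes d: "d0 = T.p * S.p + t T.p * t S.p" "d1 = T.p * s S.p"
    and e: "e0 = S.p * d0 + s S.p * s d1" "e2 = S.p * t d1"
    and h: "h0 = T.p * e0 + t T.p * t e0" "h1 = T.p * s e0 + t T.p * t e2" "h3 = T.p * s e2"
    and K: "S.p * h0 + s S.p * s h1 = K" "S.p * t h1 + s S.p * s h3 = t (s K)"
      "S.p * t h3 = t (s (t (s K)))" "t K = K"
    and braid: "\<And>x. S (T (S (T (S (T x))))) = T (S (T (S (T (S x)))))"
  shows "S.D (T.D (S.D (T.D (S.D (T.D x))))) = (let z = (K * T.p) *s x in
      z + T z + S z + S (T z) + T (S z) + T (S (T z)) + S (T (S z)) + S (T (S (T z))) +
      T (S (T (S z))) + T (S (T (S (T z)))) + S (T (S (T (S z)))) + S (T (S (T (S (T z))))))"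
proof -
  define f where "f = T.D x"
  have f: "T f = f"
    by (simp add: f_def T.S_D)
  have "S.D f = S.p *s f + s S.p *s S f"
    by (rule S.D_eq)
  also have "T.D \<dots> = (d0 *s f + d1 *s S f) + t d1 *s T (S f)"
    unfolding T.D_add T.D_scale_invariant[OF f] unfolding T.D_scale_single d by (simp only: ac_simps)
  also have "S.D \<dots> = e0 *s f + (s e0 *s S f + e2 *s T (S f)) + s e2 *s S (T (S f))"
    by (subst S.D_add, subst S.D_scale_pair, subst S.D_scale_single) (simp only: e ac_simps)
  also have "T.D \<dots> =
      (h0 *s f + h1 *s S f) + (t h1 *s T (S f) + h3 *s S (T (S f))) + t h3 *s T (S (T (S f)))"
    by (subst T.D_add, subst T.D_add, subst T.D_scale_pair, subst T.D_scale_invariant[OF f],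
        subst T.D_scale_single) (simp only: h ac_simps)
  also have "S.D \<dots> = (K *s f + s K *s S f) + (t (s K) *s T (S f) + s (t (s K)) *s S (T (S f))) +
      (t (s (t (s K))) *s T (S (T (S f))) + s (t (s (t (s K)))) *s S (T (S (T (S f)))))"
    by (subst S.D_add, subst S.D_add, subst S.D_scale_pair, subst S.D_scale_pair,
        subst S.D_scale_single) (simp only: K)
  also have "\<dots> = K *s f + S (K *s f) + T (S (K *s f)) + S (T (S (K *s f))) +
      T (S (T (S (K *s f)))) + S (T (S (T (S (K *s f)))))"
    by (simp add: S.S_scale T.S_scale)
  also have "K *s f = (K * T.p) *s x + T ((K * T.p) *s x)"
    by (simp add: f_def scale_K_T_D K)
  finally show ?thesis
    by (simp add: f_def Let_def S.S_add T.S_add)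
qed

section \<open>Braid relations of types A1 x A1, A2, B2 and G2\<close>

lemma braid2:
  assumes "s b = b" "t a = a" "\<And>x. S (T x) = T (S x)"
  shows "S.D (T.D x) = T.D (S.D x)"
proof -
  interpret sw: demazure_pair t s scale T S b a by (rule swap)
  have "s T.p = T.p" "t S.p = S.p"
    by (simp_all add: S.p_def T.p_def S.s.divide S.s.diff T.s.divide T.s.diff assms)
  then show ?thesis
    using assms(3) by (simp add: D2_eq_weyl_sum sw.D2_eq_weyl_sum Let_def ac_simps)
qed

lemmas endo_simps = S.s.divide S.s.diff S.s.mult S.s.add S.s_root
  T.s.divide T.s.diff T.s.mult T.s.add T.s_root

text \<open>Type A2: \<open>a\<close>, \<open>b\<close> and \<open>a * b\<close> are the
  exponentials of the positive roots, and the scalar in \<open>z\<close> is the inverse of the rank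
  two Weyl denominator.\<close>

lemma D3_eq:
  assumes "s b = a * b" "t a = a * b" "a * b \<noteq> 1" "\<And>x. S (T (S x)) = T (S (T x))"
  shows "T.D (S.D (T.D x)) = (let z = (1 / ((1 - a) * (1 - b) * (1 - a * b))) *s x in
      z + T z + S z + S (T z) + T (S z) + T (S (T z)))"
proof -
  define K where "K = 1 / ((1 - a) * (1 - a * b))"
  note nz = S.root_nonzero S.root_neq_1 T.root_nonzero T.root_neq_1 assms(3)
  have z: "1 / ((1 - a) * (1 - b) * (1 - a * b)) = K * T.p"
    by (simp add: K_def T.p_def)
  have 1: "T.p * S.p + t T.p * t S.p = K"
    unfolding K_def S.p_def T.p_def using nz
    by (simp add: endo_simps assms divide_simps) (simp add: algebra_simps)
  have 2: "T.p * s S.p = s K"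
    unfolding K_def S.p_def T.p_def using nz
    by (simp add: endo_simps assms)
  have 3: "t K = K"
    unfolding K_def using nz
    by (simp add: endo_simps assms)
  show ?thesis
    unfolding z by (rule D3_eq_weyl_sum[OF 1 2 3 assms(4)])
qed

lemma braid3:
  assumes "s b = a * b" "t a = a * b" "a * b \<noteq> 1" "\<And>x. S (T (S x)) = T (S (T x))"
  shows "S.D (T.D (S.D x)) = T.D (S.D (T.D x))"
proof -
  interpret sw: demazure_pair t s scale T S b a by (rule swap)
  have "S.D (T.D (S.D x)) = (let z = (1 / ((1 - b) * (1 - a) * (1 - b * a))) *s x in
      z + S z + T z + T (S z) + S (T z) + S (T (S z)))"
    using assms by (intro sw.D3_eq) (simp_all add: mult.commute)
  then show ?thesis
    using assms by (simp add: D3_eq Let_def ac_simps)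
qed

text \<open>Type B2 with \<open>b\<close> short: the positive roots are \<open>a\<close>,
  \<open>b\<close>, \<open>a * b\<close> and \<open>a * b\<^sup>2\<close>.\<close>

lemma D4_eq:
  assumes "s b = a * b" "t a = a * b\<^sup>2" "a * b \<noteq> 1" "a * b\<^sup>2 \<noteq> 1"
    and "\<And>x. S (T (S (T x))) = T (S (T (S x)))"
  shows "S.D (T.D (S.D (T.D x))) =
      (let z = (1 / ((1 - a) * (1 - b) * (1 - a * b) * (1 - a * b\<^sup>2))) *s x in
      z + T z + S z + S (T z) + T (S z) + T (S (T z)) + S (T (S z)) + S (T (S (T z))))"
proof -
  define K where "K = 1 / ((1 - a) * (1 - a * b) * (1 - a * b\<^sup>2))"
  note nz = S.root_nonzero S.root_neq_1 T.root_nonzero T.root_neq_1 assms(3-4)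
  have z: "1 / ((1 - a) * (1 - b) * (1 - a * b) * (1 - a * b\<^sup>2)) = K * T.p"
    by (simp add: K_def T.p_def)
  have 1: "S.p * (T.p * S.p + t T.p * t S.p) + s S.p * s (T.p * s S.p) = K"
    unfolding K_def S.p_def T.p_def using nz
    by (simp add: endo_simps assms divide_simps) (simp add: algebra_simps power2_eq_square)
  have 2: "S.p * t (T.p * s S.p) = t (s K)"
    unfolding K_def S.p_def T.p_def using nz
    by (simp add: endo_simps assms power2_eq_square)
  have 3: "t K = K"
    unfolding K_def using nz
    by (simp add: endo_simps assms power2_eq_square)
  show ?thesis
    unfolding z by (rule D4_eq_weyl_sum[OF 1 2 3 assms(5)])
qed

text \<open>The lengths are exchanged, so \<open>a\<close> is short. The braid relation compares
  products that begin with \<open>S\<close> and with \<open>T\<close>; after renaming, the second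
  one falls under this case.\<close>

lemma D4_eq':
  assumes "s b = a\<^sup>2 * b" "t a = a * b" "a * b \<noteq> 1" "a\<^sup>2 * b \<noteq> 1"
    and "\<And>x. S (T (S (T x))) = T (S (T (S x)))"
  shows "S.D (T.D (S.D (T.D x))) =
      (let z = (1 / ((1 - a) * (1 - b) * (1 - a * b) * (1 - a\<^sup>2 * b))) *s x in
      z + T z + S z + S (T z) + T (S z) + T (S (T z)) + S (T (S z)) + S (T (S (T z))))"
proof -
  define K where "K = 1 / ((1 - a) * (1 - a * b) * (1 - a\<^sup>2 * b))"
  note nz = S.root_nonzero S.root_neq_1 T.root_nonzero T.root_neq_1 assms(3-4)
  have z: "1 / ((1 - a) * (1 - b) * (1 - a * b) * (1 - a\<^sup>2 * b)) = K * T.p"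
    by (simp add: K_def T.p_def)
  have 1: "S.p * (T.p * S.p + t T.p * t S.p) + s S.p * s (T.p * s S.p) = K"
    unfolding K_def S.p_def T.p_def using nz
    by (simp add: endo_simps assms divide_simps) (simp add: algebra_simps power2_eq_square)
  have 2: "S.p * t (T.p * s S.p) = t (s K)"
    unfolding K_def S.p_def T.p_def using nz
    by (simp add: endo_simps assms power2_eq_square)
  have 3: "t K = K"
    unfolding K_def using nz
    by (simp add: endo_simps assms power2_eq_square)
  show ?thesis
    unfolding z by (rule D4_eq_weyl_sum[OF 1 2 3 assms(5)])
qed

lemma braid4:
  assumes "s b = a * b" "t a = a * b\<^sup>2" "a * b \<noteq> 1" "a * b\<^sup>2 \<noteq> 1"
    and "\<And>x. S (T (S (T x))) = T (S (T (S x)))"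
  shows "S.D (T.D (S.D (T.D x))) = T.D (S.D (T.D (S.D x)))"
proof -
  interpret sw: demazure_pair t s scale T S b a by (rule swap)
  have "T.D (S.D (T.D (S.D x))) =
      (let z = (1 / ((1 - b) * (1 - a) * (1 - b * a) * (1 - b\<^sup>2 * a))) *s x in
      z + S z + T z + T (S z) + S (T z) + S (T (S z)) + T (S (T z)) + T (S (T (S z))))"
    using assms by (intro sw.D4_eq') (simp_all add: mult.commute)
  then show ?thesis
    using assms by (simp add: D4_eq Let_def ac_simps)
qed

lemma D6_eq:
  assumes "s b = a * b" "t a = a * b ^ 3" "a * b \<noteq> 1" "a * b\<^sup>2 \<noteq> 1" "a * b ^ 3 \<noteq> 1" "a\<^sup>2 * b ^ 3 \<noteq> 1"
    and "\<And>x. S (T (S (T (S (T x))))) = T (S (T (S (T (S x)))))"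
  shows "S.D (T.D (S.D (T.D (S.D (T.D x))))) =
      (let z = (1 / ((1 - a) * (1 - b) * (1 - a * b) * (1 - a * b\<^sup>2) * (1 - a * b ^ 3) * (1 - a\<^sup>2 * b ^ 3))) *s x in
      z + T z + S z + S (T z) + T (S z) + T (S (T z)) + S (T (S z)) + S (T (S (T z))) +
      T (S (T (S z))) + T (S (T (S (T z)))) + S (T (S (T (S z)))) + S (T (S (T (S (T z))))))"
proof -
  \<comment> \<open>The remaining positive roots of G2 (here with \<open>b\<close> short) become
    atoms, so that \<open>s\<close> and \<open>t\<close> act by the permutations in
    \<open>images\<close> instead of by monomial arithmetic.\<close>
  define r3 where "r3 = a * b"
  define r4 where "r4 = a * b\<^sup>2"
  define r5 where "r5 = a * b ^ 3"
  define r6 where "r6 = a\<^sup>2 * b ^ 3"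
  note r_defs = r3_def r4_def r5_def r6_def
  have nz: "a \<noteq> 0" "b \<noteq> 0" "a \<noteq> 1" "b \<noteq> 1" "r3 \<noteq> 1" "r4 \<noteq> 1" "r5 \<noteq> 1" "r6 \<noteq> 1"
    using S.root_nonzero S.root_neq_1 T.root_nonzero T.root_neq_1 assms(3-6) by (simp_all add: r_defs)
  have images: "s b = r3" "s r3 = b" "s r4 = r4" "s r5 = r6" "s r6 = r5" "t a = r5" "t r5 = a" "t r3 = r4" "t r4 = r3" "t r6 = r6"
    using nz by (simp_all add: r_defs endo_simps assms(1-2) field_simps eval_nat_numeral)
  define K where "K = 1 / ((1 - a) * (1 - r3) * (1 - r4) * (1 - r5) * (1 - r6))"
  have z: "1 / ((1 - a) * (1 - b) * (1 - a * b) * (1 - a * b\<^sup>2) * (1 - a * b ^ 3) * (1 - a\<^sup>2 * b ^ 3)) = K * T.p"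
    by (simp add: K_def T.p_def r_defs)
  \<comment> \<open>The closed forms \<open>d0\<close> to \<open>h3\<close> are the successive
    coefficients after cancellation; in \<open>d0\<close>, for instance, a factor
    \<open>1 - b\<close> is gone. Each identity below then concerns a single application of an
    operator.\<close>
  define d0 where "d0 = (1 + r3 + r4) / ((1 - a) * (1 - r5))"
  define d1 where "d1 = - a / ((1 - b) * (1 - a))"
  define e0 where "e0 = (1 + r4) / ((1 - a) * (1 - r3) * (1 - r5))"
  define e2 where "e2 = r5 * b / ((1 - a) * (1 - b) * (1 - r5))"
  define h0 where "h0 = (1 + r6) / ((1 - a) * (1 - r3) * (1 - r4) * (1 - r5))"
  define h1 where "h1 = - a * (1 + r4 + r4 * r4) / ((1 - a) * (1 - b) * (1 - r5) * (1 - r6))"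
  define h3 where "h3 = - (a * r3 * r6) / ((1 - a) * (1 - b) * (1 - r3) * (1 - r6))"
  note [simp] = endo_simps S.s.minus T.s.minus images nz
  have d_eq0: "d0 = T.p * S.p + t T.p * t S.p"
    unfolding S.p_def T.p_def d0_def
    by (simp add: divide_simps) (simp add: r_defs algebra_simps eval_nat_numeral)?
  have d_eq1: "d1 = T.p * s S.p"
    unfolding S.p_def T.p_def d1_def
    by (simp add: divide_simps) (simp add: r_defs algebra_simps eval_nat_numeral)?
  have e_eq0: "e0 = S.p * d0 + s S.p * s d1"
    unfolding S.p_def T.p_def d0_def d1_def e0_def
    by (simp add: divide_simps) (simp add: r_defs algebra_simps eval_nat_numeral)?
  have e_eq1: "e2 = S.p * t d1"
    unfolding S.p_def T.p_def d1_def e2_def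
    by (simp add: divide_simps) (simp add: r_defs algebra_simps eval_nat_numeral)?
  have h_eq0: "h0 = T.p * e0 + t T.p * t e0"
    unfolding S.p_def T.p_def e0_def h0_def
    by (simp add: divide_simps) (simp add: r_defs algebra_simps eval_nat_numeral)?
  have h_eq1: "h1 = T.p * s e0 + t T.p * t e2"
    unfolding S.p_def T.p_def e0_def e2_def h1_def
    by (simp add: divide_simps) (simp add: r_defs algebra_simps eval_nat_numeral)?
  have h_eq2: "h3 = T.p * s e2"
    unfolding S.p_def T.p_def e2_def h3_def
    by (simp add: divide_simps) (simp add: r_defs algebra_simps eval_nat_numeral)?
  have K_eq0: "S.p * h0 + s S.p * s h1 = K"
    unfolding S.p_def T.p_def K_def h0_def h1_def
    by (simp add: divide_simps) (simp add: r_defs algebra_simps eval_nat_numeral)?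
  have K_eq1: "S.p * t h1 + s S.p * s h3 = t (s K)"
    unfolding S.p_def T.p_def K_def h1_def h3_def
    by (simp add: divide_simps) (simp add: r_defs algebra_simps eval_nat_numeral)?
  have K_eq2: "S.p * t h3 = t (s (t (s K)))"
    unfolding S.p_def T.p_def K_def h3_def
    by (simp add: divide_simps) (simp add: r_defs algebra_simps eval_nat_numeral)?
  have K_eq3: "t K = K"
    unfolding S.p_def T.p_def K_def
    by (simp add: divide_simps) (simp add: r_defs algebra_simps eval_nat_numeral)?
  show ?thesis
    unfolding z
    by (rule D6_eq_weyl_sum[OF d_eq0 d_eq1 e_eq0 e_eq1 h_eq0 h_eq1 h_eq2 K_eq0 K_eq1 K_eq2 K_eq3
        assms(7)])
qed

text \<open>Type G2 with \<open>a\<close> short. The intermediate coefficients differ from those of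
  \<open>D6_eq\<close>, while the final sum has the same shape; their comparison is the braid
  relation.\<close>

lemma D6_eq':
  assumes "s b = a ^ 3 * b" "t a = a * b" "a * b \<noteq> 1" "a\<^sup>2 * b \<noteq> 1" "a ^ 3 * b \<noteq> 1" "a ^ 3 * b\<^sup>2 \<noteq> 1"
    and "\<And>x. S (T (S (T (S (T x))))) = T (S (T (S (T (S x)))))"
  shows "S.D (T.D (S.D (T.D (S.D (T.D x))))) =
      (let z = (1 / ((1 - a) * (1 - b) * (1 - a * b) * (1 - a\<^sup>2 * b) * (1 - a ^ 3 * b) * (1 - a ^ 3 * b\<^sup>2))) *s x in
      z + T z + S z + S (T z) + T (S z) + T (S (T z)) + S (T (S z)) + S (T (S (T z))) +
      T (S (T (S z))) + T (S (T (S (T z)))) + S (T (S (T (S z)))) + S (T (S (T (S (T z))))))"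
proof -
  define r3 where "r3 = a * b"
  define r4 where "r4 = a\<^sup>2 * b"
  define r5 where "r5 = a ^ 3 * b"
  define r6 where "r6 = a ^ 3 * b\<^sup>2"
  note r_defs = r3_def r4_def r5_def r6_def
  have nz: "a \<noteq> 0" "b \<noteq> 0" "a \<noteq> 1" "b \<noteq> 1" "r3 \<noteq> 1" "r4 \<noteq> 1" "r5 \<noteq> 1" "r6 \<noteq> 1"
    using S.root_nonzero S.root_neq_1 T.root_nonzero T.root_neq_1 assms(3-6) by (simp_all add: r_defs)
  have images: "s b = r5" "s r5 = b" "s r3 = r4" "s r4 = r3" "s r6 = r6" "t a = r3" "t r3 = a" "t r4 = r4" "t r5 = r6" "t r6 = r5"
    using nz by (simp_all add: r_defs endo_simps assms(1-2) field_simps eval_nat_numeral)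
  define K where "K = 1 / ((1 - a) * (1 - r3) * (1 - r4) * (1 - r5) * (1 - r6))"
  have z: "1 / ((1 - a) * (1 - b) * (1 - a * b) * (1 - a\<^sup>2 * b) * (1 - a ^ 3 * b) * (1 - a ^ 3 * b\<^sup>2)) = K * T.p"
    by (simp add: K_def T.p_def r_defs)
  define d0 where "d0 = 1 / ((1 - a) * (1 - r3))"
  define d1 where "d1 = - a / ((1 - b) * (1 - a))"
  define e0 where "e0 = (1 + r4) / ((1 - a) * (1 - r3) * (1 - r5))"
  define e2 where "e2 = r3 * b / ((1 - a) * (1 - b) * (1 - r3))"
  define h0 where "h0 = (1 + r4) / ((1 - a) * (1 - r3) * (1 - r5) * (1 - r6))"
  define h1 where "h1 = - a / ((1 - a) * (1 - b) * (1 - r3) * (1 - r4))"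
  define h3 where "h3 = - (a * r4 * r5) / ((1 - a) * (1 - b) * (1 - r4) * (1 - r5))"
  note [simp] = endo_simps S.s.minus T.s.minus images nz
  have d_eq0: "d0 = T.p * S.p + t T.p * t S.p"
    unfolding S.p_def T.p_def d0_def
    by (simp add: divide_simps) (simp add: r_defs algebra_simps eval_nat_numeral)?
  have d_eq1: "d1 = T.p * s S.p"
    unfolding S.p_def T.p_def d1_def
    by (simp add: divide_simps) (simp add: r_defs algebra_simps eval_nat_numeral)?
  have e_eq0: "e0 = S.p * d0 + s S.p * s d1"
    unfolding S.p_def T.p_def d0_def d1_def e0_def
    by (simp add: divide_simps) (simp add: r_defs algebra_simps eval_nat_numeral)?
  have e_eq1: "e2 = S.p * t d1"
    unfolding S.p_def T.p_def d1_def e2_def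
    by (simp add: divide_simps) (simp add: r_defs algebra_simps eval_nat_numeral)?
  have h_eq0: "h0 = T.p * e0 + t T.p * t e0"
    unfolding S.p_def T.p_def e0_def h0_def
    by (simp add: divide_simps) (simp add: r_defs algebra_simps eval_nat_numeral)?
  have h_eq1: "h1 = T.p * s e0 + t T.p * t e2"
    unfolding S.p_def T.p_def e0_def e2_def h1_def
    by (simp add: divide_simps) (simp add: r_defs algebra_simps eval_nat_numeral)?
  have h_eq2: "h3 = T.p * s e2"
    unfolding S.p_def T.p_def e2_def h3_def
    by (simp add: divide_simps) (simp add: r_defs algebra_simps eval_nat_numeral)?
  have K_eq0: "S.p * h0 + s S.p * s h1 = K"
    unfolding S.p_def T.p_def K_def h0_def h1_def
    by (simp add: divide_simps) (simp add: r_defs algebra_simps eval_nat_numeral)?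
  have K_eq1: "S.p * t h1 + s S.p * s h3 = t (s K)"
    unfolding S.p_def T.p_def K_def h1_def h3_def
    by (simp add: divide_simps) (simp add: r_defs algebra_simps eval_nat_numeral)?
  have K_eq2: "S.p * t h3 = t (s (t (s K)))"
    unfolding S.p_def T.p_def K_def h3_def
    by (simp add: divide_simps) (simp add: r_defs algebra_simps eval_nat_numeral)?
  have K_eq3: "t K = K"
    unfolding S.p_def T.p_def K_def
    by (simp add: divide_simps) (simp add: r_defs algebra_simps eval_nat_numeral)?
  show ?thesis
    unfolding z
    by (rule D6_eq_weyl_sum[OF d_eq0 d_eq1 e_eq0 e_eq1 h_eq0 h_eq1 h_eq2 K_eq0 K_eq1 K_eq2 K_eq3
        assms(7)])
qed

lemma braid6:
  assumes "s b = a * b" "t a = a * b ^ 3"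
    and "a * b \<noteq> 1" "a * b\<^sup>2 \<noteq> 1" "a * b ^ 3 \<noteq> 1" "a\<^sup>2 * b ^ 3 \<noteq> 1"
    and "\<And>x. S (T (S (T (S (T x))))) = T (S (T (S (T (S x)))))"
  shows "S.D (T.D (S.D (T.D (S.D (T.D x))))) = T.D (S.D (T.D (S.D (T.D (S.D x)))))"
proof -
  interpret sw: demazure_pair t s scale T S b a by (rule swap)
  have "T.D (S.D (T.D (S.D (T.D (S.D x))))) =
      (let z = (1 / ((1 - b) * (1 - a) * (1 - b * a) * (1 - b\<^sup>2 * a) * (1 - b ^ 3 * a) *
        (1 - b ^ 3 * a\<^sup>2))) *s x in
      z + S z + T z + T (S z) + S (T z) + S (T (S z)) + T (S (T z)) + T (S (T (S z))) +
      S (T (S (T z))) + S (T (S (T (S z)))) + T (S (T (S (T z)))) + T (S (T (S (T (S z))))))"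
    using assms by (intro sw.D6_eq') (simp_all add: mult.commute)
  then show ?thesis
    using assms by (simp add: D6_eq Let_def ac_simps)
qed

end

section \<open>Root systems and Weyl groups\<close>

lemma additive_frag_cmul:
  assumes "additive f"
  shows "f (frag_cmul k x) = frag_cmul k (f x)"
proof -
  interpret additive f by fact
  have nat: "f (frag_cmul (int n) x) = frag_cmul (int n) (f x)" for n
    by (induction n) (simp_all add: zero add frag_cmul_distrib)
  show ?thesis
    by (cases k rule: int_diff_cases) (simp add: frag_cmul_diff_distrib diff nat)
qed

lemma additive_comp:
  assumes "additive f" "additive g"
  shows "additive (f \<circ> g)"
  using assms by (simp add: additive_def)

lemma frag_cmul_cancel_right:
  assumes "frag_cmul c x = frag_cmul d x" "x \<noteq> 0"
  shows "c = d"
  using assms by (metis cancel_comm_monoid_add_class.diff_cancel eq_iff_diff_eq_0 frag_cmul_diff_distrib frag_cmul_eq_0_iff)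

context metaplectic_datum
begin

abbreviation \<alpha> :: "nat \<Rightarrow> 'd lattice" where "\<alpha> \<equiv> simple M"
abbreviation s :: "nat \<Rightarrow> 'd lattice \<Rightarrow> 'd lattice" where "s \<equiv> simple_refl M"
definition I :: "nat set" where "I = {1..rank M}"

lemma finite_I [simp]: "finite I"
  by (simp add: I_def)

definition lincomb :: "(nat \<Rightarrow> int) \<Rightarrow> 'd lattice" where
  "lincomb k = (\<Sum>i\<in>I. frag_cmul (k i) (\<alpha> i))"

lemma
  shows finite_roots: "finite (roots M)" and roots_nonempty: "roots M \<noteq> {}"
    and root_nonzero: "\<beta> \<in> roots M \<Longrightarrow> \<beta> \<noteq> 0"
    and additive_refl: "\<beta> \<in> roots M \<Longrightarrow> additive (refl M \<beta>)"
    and refl_self: "\<beta> \<in> roots M \<Longrightarrow> refl M \<beta> \<beta> = - \<beta>"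
    and refl_root: "\<beta> \<in> roots M \<Longrightarrow> \<gamma> \<in> roots M \<Longrightarrow> refl M \<beta> \<gamma> \<in> roots M"
    and refl_root_ex: "\<beta> \<in> roots M \<Longrightarrow> \<gamma> \<in> roots M \<Longrightarrow> \<exists>k. refl M \<beta> \<gamma> = \<gamma> - frag_cmul k \<beta>"
  using root_system unfolding root_system_def by blast+

lemma refl_refl [simp]: "\<beta> \<in> roots M \<Longrightarrow> refl M \<beta> (refl M \<beta> x) = x"
  using refl_square[of \<beta>] by (simp add: fun_eq_iff)

lemma uminus_root: "\<beta> \<in> roots M \<Longrightarrow> - \<beta> \<in> roots M"
  using refl_root[of \<beta> \<beta>] by (simp add: refl_self)

lemma simple_root [simp]: "i \<in> I \<Longrightarrow> \<alpha> i \<in> roots M"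
  using simple_system unfolding simple_system_def I_def by blast

lemma lincomb_eq_0: "lincomb k = 0 \<Longrightarrow> i \<in> I \<Longrightarrow> k i = 0"
  using simple_system unfolding simple_system_def lincomb_def I_def by blast

lemma lincomb_diff: "lincomb k - lincomb l = lincomb (\<lambda>i. k i - l i)"
  by (simp add: lincomb_def frag_cmul_diff_distrib sum_subtractf)

lemma lincomb_add: "lincomb k + lincomb l = lincomb (\<lambda>i. k i + l i)"
  by (simp add: lincomb_def frag_cmul_distrib sum.distrib)

lemma lincomb_cmul: "frag_cmul c (lincomb k) = lincomb (\<lambda>i. c * k i)"
  by (simp add: lincomb_def frag_cmul_sum)

lemma lincomb_uminus: "- lincomb k = lincomb (\<lambda>i. - k i)"
  using lincomb_cmul[of "-1" k] by simp

lemma lincomb_eqD: "lincomb k = lincomb l \<Longrightarrow> i \<in> I \<Longrightarrow> k i = l i"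
  using lincomb_eq_0[of "\<lambda>i. k i - l i" i] by (simp flip: lincomb_diff)

lemma simple_eq_lincomb: "i \<in> I \<Longrightarrow> \<alpha> i = lincomb (\<lambda>j. if j = i then 1 else 0)"
  by (simp add: lincomb_def if_distrib[of "\<lambda>c. frag_cmul c _"] cong: if_cong)

lemma cmul_simple: "i \<in> I \<Longrightarrow> frag_cmul c (\<alpha> i) = lincomb (\<lambda>j. c * (if j = i then 1 else 0))"
  by (simp add: simple_eq_lincomb lincomb_cmul)

lemma lincomb_pair:
  assumes "i \<in> I" "j \<in> I" "i \<noteq> j"
  shows "frag_cmul c (\<alpha> i) + frag_cmul d (\<alpha> j) =
    lincomb (\<lambda>h. if h = i then c else if h = j then d else 0)"
  using assms
  by (auto simp: simple_eq_lincomb lincomb_cmul lincomb_add intro!: arg_cong[of _ _ lincomb])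

lemma simple_pair_eqD:
  assumes "i \<in> I" "j \<in> I" "i \<noteq> j"
    and "frag_cmul c (\<alpha> i) + frag_cmul d (\<alpha> j) = frag_cmul c' (\<alpha> i) + frag_cmul d' (\<alpha> j)"
  shows "c = c'" "d = d'"
  using lincomb_eqD[of _ _ i, OF assms(4)[unfolded lincomb_pair[OF assms(1-3)]]]
    lincomb_eqD[of _ _ j, OF assms(4)[unfolded lincomb_pair[OF assms(1-3)]]] assms(1-3) by simp_all

lemma simple_inj: "i \<in> I \<Longrightarrow> j \<in> I \<Longrightarrow> \<alpha> i = \<alpha> j \<Longrightarrow> i = j"
  using simple_pair_eqD[of i j 1 0 0 1] by auto

lemma positive_roots_iff:
  "\<beta> \<in> positive_roots M \<longleftrightarrow> \<beta> \<in> roots M \<and> (\<exists>k. (\<forall>i\<in>I. 0 \<le> k i) \<and> \<beta> = lincomb k)"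
  by (simp add: positive_roots_def lincomb_def I_def)

lemma positive_root: "\<beta> \<in> positive_roots M \<Longrightarrow> \<beta> \<in> roots M"
  by (simp add: positive_roots_iff)

lemma finite_positive_roots [simp]: "finite (positive_roots M)"
  by (rule finite_subset[OF _ finite_roots]) (auto simp: positive_root)

lemma negative_roots_iff: "\<beta> \<in> negative_roots M \<longleftrightarrow> - \<beta> \<in> positive_roots M"
  using uminus_root[of "- \<beta>"] by (auto simp: negative_roots_def positive_root)

lemma positive_or_negative: "\<beta> \<in> roots M \<Longrightarrow> \<beta> \<in> positive_roots M \<or> \<beta> \<in> negative_roots M"
  using simple_system by (auto simp: simple_system_def)

lemma root_lincomb: "\<beta> \<in> roots M \<Longrightarrow> \<exists>k. \<beta> = lincomb k"
  using positive_or_negative[of \<beta>]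
  by (auto simp: negative_roots_iff positive_roots_iff) (metis add.inverse_inverse lincomb_uminus)

lemma positive_lincomb:
  assumes "lincomb k \<in> roots M"
  shows "lincomb k \<in> positive_roots M \<longleftrightarrow> (\<forall>i\<in>I. 0 \<le> k i)"
  using assms lincomb_eqD[of k] unfolding positive_roots_iff by (metis (no_types, lifting))

lemma negative_lincomb:
  assumes "lincomb k \<in> roots M"
  shows "lincomb k \<in> negative_roots M \<longleftrightarrow> (\<forall>i\<in>I. k i \<le> 0)"
  using assms positive_lincomb[of "\<lambda>i. - k i"] uminus_root[OF assms]
  by (simp add: negative_roots_iff lincomb_uminus)

lemma positive_not_negative:
  assumes "\<beta> \<in> positive_roots M"
  shows "\<beta> \<notin> negative_roots M"
proof
  assume neg: "\<beta> \<in> negative_roots M"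
  obtain k where k: "\<beta> = lincomb k" "lincomb k \<in> roots M"
    using assms by (auto simp: positive_roots_iff)
  have "\<forall>i\<in>I. k i = 0"
    using assms neg positive_lincomb[OF k(2)] negative_lincomb[OF k(2)] k(1) by force
  then have "\<beta> = 0"
    by (simp add: k lincomb_def)
  then show False
    using k root_nonzero by metis
qed

lemma negative_iff_not_positive:
  "\<beta> \<in> roots M \<Longrightarrow> \<beta> \<in> negative_roots M \<longleftrightarrow> \<beta> \<notin> positive_roots M"
  using positive_not_negative positive_or_negative by blast

lemma simple_positive [simp]: "i \<in> I \<Longrightarrow> \<alpha> i \<in> positive_roots M"
  using positive_lincomb[of "\<lambda>j. if j = i then 1 else 0"] simple_root[of i]
  by (simp add: simple_eq_lincomb)

lemma positive_combination:
  assumes "\<beta> \<in> positive_roots M" "\<gamma> \<in> positive_roots M" "0 \<le> c" "0 \<le> d"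
    and "frag_cmul c \<beta> + frag_cmul d \<gamma> \<in> roots M"
  shows "frag_cmul c \<beta> + frag_cmul d \<gamma> \<in> positive_roots M"
proof -
  obtain k l where "\<beta> = lincomb k" "\<forall>i\<in>I. 0 \<le> k i" "\<gamma> = lincomb l" "\<forall>i\<in>I. 0 \<le> l i"
    using assms by (auto simp: positive_roots_iff)
  then show ?thesis
    using assms(3-) positive_lincomb[of "\<lambda>i. c * k i + d * l i"]
    by (simp add: lincomb_cmul lincomb_add)
qed

lemma negative_combination:
  assumes "\<beta> \<in> negative_roots M" "\<gamma> \<in> negative_roots M" "0 \<le> c" "0 \<le> d"
    and "frag_cmul c \<beta> + frag_cmul d \<gamma> \<in> roots M"
  shows "frag_cmul c \<beta> + frag_cmul d \<gamma> \<in> negative_roots M"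
proof -
  have eq: "- (frag_cmul c \<beta> + frag_cmul d \<gamma>) = frag_cmul c (- \<beta>) + frag_cmul d (- \<gamma>)"
    by (rule poly_mapping_eqI) (simp add: lookup_add)
  show ?thesis
    using assms uminus_root[OF assms(5)] positive_combination[of "- \<beta>" "- \<gamma>" c d]
    unfolding negative_roots_iff eq by simp
qed

lemma simple_refl_positive:
  assumes "i \<in> I" "\<beta> \<in> positive_roots M" "\<beta> \<noteq> \<alpha> i"
  shows "s i \<beta> \<in> positive_roots M"
proof -
  obtain k where k: "\<beta> = lincomb k" "\<forall>j\<in>I. 0 \<le> k j" and \<beta>: "\<beta> \<in> roots M"
    using assms by (auto simp: positive_roots_iff)
  \<comment> \<open>As the system is reduced, a positive root other than \<open>\<alpha> i\<close>
    involves a second simple root. That coefficient is untouched by \<open>s i\<close> and decides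
    the sign of the image.\<close>
  have "\<exists>j\<in>I. j \<noteq> i \<and> k j > 0"
  proof (rule ccontr)
    assume "\<not> ?thesis"
    then have "k j = (if j = i then k i else 0)" if "j \<in> I" for j
      using k(2) that by force
    then have "\<beta> = lincomb (\<lambda>j. k i * (if j = i then 1 else 0))"
      unfolding k(1) lincomb_def by (intro sum.cong) auto
    then have "frag_cmul 1 \<beta> = frag_cmul (k i) (\<alpha> i)"
      unfolding lincomb_cmul[symmetric] simple_eq_lincomb[OF assms(1)] by simp
    then have "\<beta> = \<alpha> i \<or> \<beta> = - \<alpha> i"
      using reduced \<beta> assms(1) unfolding reduced_roots_def
      by (metis simple_root zero_neq_one)
    then show False
      using assms positive_not_negative[of \<beta>] by (auto simp: negative_roots_iff)
  qed
  then obtain j where j: "j \<in> I" "j \<noteq> i" "k j > 0" by blast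
  obtain c where c: "s i \<beta> = \<beta> - frag_cmul c (\<alpha> i)"
    using refl_root_ex \<beta> assms(1) simple_root by blast
  have eq: "s i \<beta> = lincomb (\<lambda>j. k j - c * (if j = i then 1 else 0))"
    using c unfolding k(1) cmul_simple[OF assms(1)] lincomb_diff .
  have "s i \<beta> \<in> roots M"
    using \<beta> assms(1) by (simp add: refl_root)
  moreover have "s i \<beta> \<notin> negative_roots M"
    using calculation j negative_lincomb unfolding eq by force
  ultimately show ?thesis
    using negative_iff_not_positive by blast
qed

text \<open>\<open>coroot \<gamma> \<beta>\<close> is \<open>\<langle>\<beta>, \<gamma>\<^sup>\<or>\<rangle>\<close>.\<close>

definition coroot :: "'d lattice \<Rightarrow> 'd lattice \<Rightarrow> int" where
  "coroot \<gamma> \<beta> = (THE k. refl M \<gamma> \<beta> = \<beta> - frag_cmul k \<gamma>)"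

lemma coroot_eqI:
  assumes "\<gamma> \<in> roots M" "refl M \<gamma> \<beta> = \<beta> - frag_cmul k \<gamma>"
  shows "coroot \<gamma> \<beta> = k"
  unfolding coroot_def assms(2)
  by (rule the_equality) (use root_nonzero[OF assms(1)] in \<open>auto dest: frag_cmul_cancel_right\<close>)

lemma refl_eq: "\<gamma> \<in> roots M \<Longrightarrow> \<beta> \<in> roots M \<Longrightarrow> refl M \<gamma> \<beta> = \<beta> - frag_cmul (coroot \<gamma> \<beta>) \<gamma>"
  using refl_root_ex[of \<gamma> \<beta>] coroot_eqI by metis

lemma coroot_self: "\<gamma> \<in> roots M \<Longrightarrow> coroot \<gamma> \<gamma> = 2"
  by (rule coroot_eqI) (simp_all add: refl_self poly_mapping_eq_iff fun_eq_iff lookup_minus)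

text \<open>Conjugating the reflection in \<open>\<gamma>\<close> by the one in
  \<open>\<delta>\<close> gives the reflection in the image of \<open>\<gamma>\<close>. This
  equivariance is the source of the invariance of \<open>form\<close>.\<close>

lemma coroot_refl:
  assumes "\<gamma> \<in> roots M" "\<beta> \<in> roots M" "\<delta> \<in> roots M"
  shows "coroot (refl M \<delta> \<gamma>) (refl M \<delta> \<beta>) = coroot \<gamma> \<beta>"
proof (rule coroot_eqI)
  interpret additive "refl M \<delta>" using assms by (intro additive_refl)
  have "refl M (refl M \<delta> \<gamma>) (refl M \<delta> \<beta>) = refl M \<delta> (refl M \<gamma> \<beta>)"
    using refl_conj[OF assms(3,1)] assms by (metis comp_apply refl_refl)
  then show "refl M (refl M \<delta> \<gamma>) (refl M \<delta> \<beta>) =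
      refl M \<delta> \<beta> - frag_cmul (coroot \<gamma> \<beta>) (refl M \<delta> \<gamma>)"
    using assms by (simp add: refl_eq[of \<gamma>] diff additive_frag_cmul[OF additive_refl])
qed (use assms in \<open>simp add: refl_root\<close>)

lemma coroot_lincomb:
  assumes "\<gamma> \<in> roots M"
  shows "coroot \<gamma> (lincomb k) = (\<Sum>i\<in>I. k i * coroot \<gamma> (\<alpha> i))"
proof (rule coroot_eqI)
  interpret additive "refl M \<gamma>" using assms by (intro additive_refl)
  have csum: "frag_cmul (sum f A) x = (\<Sum>i\<in>A. frag_cmul (f i) x)" for f A and x :: "'d lattice"
    by (induction A rule: infinite_finite_induct) (simp_all add: frag_cmul_distrib)
  have cdiff: "frag_cmul c (a - b) = frag_cmul c a - frag_cmul c b" for c and a b :: "'d lattice"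
    by (rule poly_mapping_eqI) (simp add: lookup_minus algebra_simps)
  show "refl M \<gamma> (lincomb k) = lincomb k - frag_cmul (\<Sum>i\<in>I. k i * coroot \<gamma> (\<alpha> i)) \<gamma>"
    using assms
    by (simp add: lincomb_def sum additive_frag_cmul[OF additive_refl] refl_eq csum cdiff sum_subtractf)
qed (fact assms)

text \<open>
  An invariant positive definite form on the root lattice; \<open>Q\<close> cannot serve as it may be zero.
\<close>

definition form :: "'d lattice \<Rightarrow> 'd lattice \<Rightarrow> int" where
  "form \<beta> \<beta>' = (\<Sum>\<gamma>\<in>roots M. coroot \<gamma> \<beta> * coroot \<gamma> \<beta>')"

lemma form_commute: "form \<beta> \<beta>' = form \<beta>' \<beta>"
  by (simp add: form_def mult.commute)

lemma form_lincomb: "form (lincomb k) \<beta> = (\<Sum>i\<in>I. k i * form (\<alpha> i) \<beta>)"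
proof -
  have "form (lincomb k) \<beta> = (\<Sum>\<gamma>\<in>roots M. \<Sum>i\<in>I. k i * (coroot \<gamma> (\<alpha> i) * coroot \<gamma> \<beta>))"
    by (simp add: form_def coroot_lincomb sum_distrib_right mult.assoc)
  also have "\<dots> = (\<Sum>i\<in>I. \<Sum>\<gamma>\<in>roots M. k i * (coroot \<gamma> (\<alpha> i) * coroot \<gamma> \<beta>))"
    by (rule sum.swap)
  finally show ?thesis
    by (simp add: form_def sum_distrib_left)
qed

lemma form_cmul_diff:
  assumes "\<beta> \<in> roots M" "\<gamma> \<in> roots M"
  shows "form (\<beta> - frag_cmul c \<gamma>) \<delta> = form \<beta> \<delta> - c * form \<gamma> \<delta>"
proof -
  obtain k l where "\<beta> = lincomb k" "\<gamma> = lincomb l"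
    using root_lincomb assms by metis
  then show ?thesis
    by (simp add: form_lincomb lincomb_cmul lincomb_diff algebra_simps sum_subtractf sum_distrib_left)
qed

lemma form_refl:
  assumes "\<beta> \<in> roots M" "\<beta>' \<in> roots M" "\<delta> \<in> roots M"
  shows "form (refl M \<delta> \<beta>) (refl M \<delta> \<beta>') = form \<beta> \<beta>'"
proof -
  have "bij_betw (refl M \<delta>) (roots M) (roots M)"
    using assms(3) by (intro bij_betw_byWitness[where f' = "refl M \<delta>"]) (auto simp: refl_root)
  then have "form (refl M \<delta> \<beta>) (refl M \<delta> \<beta>') =
      (\<Sum>\<gamma>\<in>roots M. coroot (refl M \<delta> \<gamma>) (refl M \<delta> \<beta>) * coroot (refl M \<delta> \<gamma>) (refl M \<delta> \<beta>'))"
    unfolding form_def by (rule sum.reindex_bij_betw[symmetric])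
  then show ?thesis
    using assms by (simp add: coroot_refl form_def)
qed

lemma form_pos:
  assumes "\<beta> \<in> roots M"
  shows "form \<beta> \<beta> > 0"
proof -
  have "coroot \<beta> \<beta> * coroot \<beta> \<beta> \<le> form \<beta> \<beta>"
    unfolding form_def using assms by (intro member_le_sum) (auto simp: finite_roots)
  then show ?thesis
    using assms by (simp add: coroot_self)
qed

text \<open>Moving the reflection in \<open>\<gamma>\<close> from one argument to the other changes
  the sign of \<open>form \<beta> \<gamma>\<close>; expanding the reflected vector subtracts
  \<open>coroot \<gamma> \<beta> * form \<gamma> \<gamma>\<close>.\<close>

lemma form_coroot:
  assumes "\<beta> \<in> roots M" "\<gamma> \<in> roots M"
  shows "2 * form \<beta> \<gamma> = coroot \<gamma> \<beta> * form \<gamma> \<gamma>"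
proof -
  have neg: "- \<gamma> = \<gamma> - frag_cmul 2 \<gamma>"
    by (rule poly_mapping_eqI) (simp add: lookup_minus)
  have "form \<beta> \<gamma> - coroot \<gamma> \<beta> * form \<gamma> \<gamma> = form (refl M \<gamma> \<beta>) \<gamma>"
    using assms by (simp add: refl_eq form_cmul_diff)
  also have "\<dots> = form \<beta> (refl M \<gamma> \<gamma>)"
    using form_refl[of "refl M \<gamma> \<beta>" \<gamma> \<gamma>] assms by (simp add: refl_root)
  also have "\<dots> = - form \<beta> \<gamma>"
    using assms form_cmul_diff[of \<gamma> \<gamma> 2 \<beta>] by (simp add: refl_self form_commute flip: neg)
  finally show ?thesis
    by simp
qed

section \<open>Words in simple reflections and the exchange condition\<close>

abbreviation W :: "('d lattice \<Rightarrow> 'd lattice) set" where "W \<equiv> weyl_group M"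

definition word_elt :: "nat list \<Rightarrow> 'd lattice \<Rightarrow> 'd lattice" where
  "word_elt is = foldr (\<lambda>i u. s i \<circ> u) is id"

lemma word_elt_Nil [simp]: "word_elt [] = id"
  by (simp add: word_elt_def)

lemma word_elt_Cons: "word_elt (i # is) = s i \<circ> word_elt is"
  by (simp add: word_elt_def)

lemma word_elt_append: "word_elt (is @ js) = word_elt is \<circ> word_elt js"
  by (induction "is") (simp_all add: word_elt_Cons o_assoc)

lemma word_for_iff: "word_for M is w \<longleftrightarrow> set is \<subseteq> I \<and> w = word_elt is"
  by (simp add: word_for_def word_elt_def I_def)

lemma s_s: "i \<in> I \<Longrightarrow> s i \<circ> s i = id"
  by (simp add: refl_square)

lemma word_elt_rev: "set is \<subseteq> I \<Longrightarrow> word_elt is \<circ> word_elt (rev is) = id"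
proof (induction "is")
  case (Cons i "is")
  have i: "i \<in> I" and IH: "word_elt is \<circ> word_elt (rev is) = id"
    using Cons.prems by (auto intro: Cons.IH)
  have "word_elt (i # is) \<circ> word_elt (rev (i # is)) = s i \<circ> (word_elt is \<circ> word_elt (rev is)) \<circ> s i"
    by (simp add: word_elt_Cons word_elt_append comp_assoc)
  also have "\<dots> = id"
    by (simp only: IH o_id s_s[OF i])
  finally show ?case .
qed simp

lemma word_elt_rev': "set is \<subseteq> I \<Longrightarrow> word_elt (rev is) \<circ> word_elt is = id"
  using word_elt_rev[of "rev is"] by simp

lemma weyl_group_comp:
  assumes "w \<in> W" "w' \<in> W"
  shows "w \<circ> w' \<in> W"
  using assms(1)
proof induction
  case (refl \<beta> w)
  then show ?case
    using weyl_group.refl[of \<beta> M "w \<circ> w'"] by (simp only: comp_assoc)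
qed (simp add: assms)

lemma refl_weyl_group: "\<beta> \<in> roots M \<Longrightarrow> refl M \<beta> \<in> W"
  using weyl_group.refl[OF _ weyl_group.id] by simp

lemma word_elt_weyl_group: "set is \<subseteq> I \<Longrightarrow> word_elt is \<in> W"
  by (induction "is") (auto simp: word_elt_Cons intro: weyl_group.intros)

lemma weyl_group_additive: "w \<in> W \<Longrightarrow> additive w"
proof (induction rule: weyl_group.induct)
  case id
  then show ?case by (simp add: additive_def)
qed (intro additive_comp additive_refl)

lemma weyl_group_root: "w \<in> W \<Longrightarrow> \<beta> \<in> roots M \<Longrightarrow> w \<beta> \<in> roots M"
  by (induction rule: weyl_group.induct) (auto simp: refl_root)

text \<open>Induction on height: by positivity of the form, a positive root pairs positively with
  some simple root, and unless it is itself simple, reflecting in that one lowers its height and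
  keeps it positive.\<close>

lemma root_conjugate_simple:
  assumes "\<beta> \<in> roots M"
  shows "\<exists>is i. set is \<subseteq> I \<and> i \<in> I \<and> \<beta> = word_elt is (\<alpha> i)"
proof -
  have pos: "\<exists>is i. set is \<subseteq> I \<and> i \<in> I \<and> lincomb k = word_elt is (\<alpha> i)"
    if "lincomb k \<in> positive_roots M" for k
    using that
  proof (induction "nat (\<Sum>i\<in>I. k i)" arbitrary: k rule: less_induct)
    case less
    let ?\<beta> = "lincomb k"
    have root: "?\<beta> \<in> roots M" and k: "\<forall>i\<in>I. 0 \<le> k i"
      using less.prems positive_root positive_lincomb by blast+
    show ?case
    proof (cases "\<exists>i\<in>I. ?\<beta> = \<alpha> i")
      case True
      then show ?thesis
        by (metis empty_subsetI id_apply list.set(1) word_elt_Nil)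
    next
      case False
      have "\<exists>i\<in>I. form (\<alpha> i) ?\<beta> > 0"
      proof (rule ccontr)
        assume "\<not> ?thesis"
        then have "form ?\<beta> ?\<beta> \<le> 0"
          unfolding form_lincomb using k
          by (intro sum_nonpos) (simp add: mult_nonneg_nonpos not_less)
        then show False
          using form_pos[OF root] by simp
      qed
      then obtain i where i: "i \<in> I" "form (\<alpha> i) ?\<beta> > 0" by blast
      define c where "c = coroot (\<alpha> i) ?\<beta>"
      have "c * form (\<alpha> i) (\<alpha> i) > 0"
        using form_coroot[OF root, of "\<alpha> i"] i by (simp add: c_def form_commute)
      then have c: "c > 0"
        using form_pos[of "\<alpha> i"] i by (simp add: zero_less_mult_iff)
      define k' where "k' = (\<lambda>j. k j - c * (if j = i then 1 else 0))"
      have s: "s i ?\<beta> = lincomb k'"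
        unfolding k'_def lincomb_diff[symmetric] cmul_simple[OF i(1), symmetric] c_def
        by (rule refl_eq) (use i root in simp_all)
      have pos: "lincomb k' \<in> positive_roots M"
        unfolding s[symmetric] using i(1) less.prems False by (intro simple_refl_positive) auto
      have nonneg: "\<forall>j\<in>I. 0 \<le> k' j"
        using pos positive_root positive_lincomb by blast
      have "(\<Sum>j\<in>I. k' j) = (\<Sum>j\<in>I. k j) - c"
        using i by (simp add: k'_def sum_subtractf flip: sum_distrib_left)
      then have "nat (\<Sum>j\<in>I. k' j) < nat (\<Sum>j\<in>I. k j)"
        using c sum_nonneg[of I k'] nonneg by simp
      then obtain "is" j where "set is \<subseteq> I" "j \<in> I" "lincomb k' = word_elt is (\<alpha> j)"
        using less.hyps pos by blast
      then have "set (i # is) \<subseteq> I \<and> j \<in> I \<and> ?\<beta> = word_elt (i # is) (\<alpha> j)"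
        using i s by (metis comp_apply insert_subset list.set(2) refl_refl simple_root word_elt_Cons)
      then show ?thesis by blast
    qed
  qed
  show ?thesis
  proof (cases "\<beta> \<in> positive_roots M")
    case True
    then show ?thesis
      using pos root_lincomb[OF assms] by blast
  next
    case False
    then have "- \<beta> \<in> positive_roots M"
      using assms by (simp flip: negative_roots_iff add: negative_iff_not_positive)
    then obtain "is" i where *: "set is \<subseteq> I" "i \<in> I" "- \<beta> = word_elt is (\<alpha> i)"
      using pos root_lincomb[OF uminus_root[OF assms]] by metis
    interpret additive "word_elt is" using * by (intro weyl_group_additive word_elt_weyl_group)
    \<comment> \<open>The extra innermost letter turns \<open>\<alpha> i\<close> into its negative,
      which settles the negative roots.\<close>
    have "word_elt (is @ [i]) (\<alpha> i) = \<beta>"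
      using * by (simp add: word_elt_append word_elt_Cons refl_self minus flip: *(3))
    then show ?thesis
      using * by (intro exI[of _ "is @ [i]"] exI[of _ i]) auto
  qed
qed

lemma refl_word_elt:
  assumes "set is \<subseteq> I" "\<beta> \<in> roots M"
  shows "refl M (word_elt is \<beta>) = word_elt is \<circ> refl M \<beta> \<circ> word_elt (rev is)"
  using assms(1)
proof (induction "is")
  case (Cons i "is")
  have root: "word_elt is \<beta> \<in> roots M"
    using Cons assms by (intro weyl_group_root[OF word_elt_weyl_group]) auto
  have i: "\<alpha> i \<in> roots M" and IH: "refl M (word_elt is \<beta>) = word_elt is \<circ> refl M \<beta> \<circ> word_elt (rev is)"
    using Cons by auto
  have "refl M (word_elt (i # is) \<beta>) = s i \<circ> refl M (word_elt is \<beta>) \<circ> s i"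
    by (simp only: refl_conj[OF i root] word_elt_Cons comp_apply)
  also have "\<dots> = word_elt (i # is) \<circ> refl M \<beta> \<circ> word_elt (rev (i # is))"
    by (simp only: IH word_elt_Cons word_elt_append word_elt_Nil comp_id comp_assoc rev.simps)
  finally show ?case .
qed simp

text \<open>The group is defined by all reflections; each of them is conjugate by a word to a simple
  one, hence a word itself.\<close>

lemma weyl_group_word: "w \<in> W \<Longrightarrow> \<exists>is. set is \<subseteq> I \<and> w = word_elt is"
proof (induction rule: weyl_group.induct)
  case id
  then show ?case by (intro exI[of _ "[]"]) simp
next
  case (refl \<beta> w)
  then obtain "is" i js where *: "set is \<subseteq> I" "i \<in> I" "\<beta> = word_elt is (\<alpha> i)" "set js \<subseteq> I" "w = word_elt js"
    using root_conjugate_simple by blast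
  then have "refl M \<beta> \<circ> w = word_elt (is @ [i] @ rev is @ js)"
    using refl_word_elt[of "is" "\<alpha> i"] by (simp add: word_elt_append word_elt_Cons comp_assoc)
  then show ?case
    using * by (intro exI[of _ "is @ [i] @ rev is @ js"]) auto
qed

lemma
  assumes "w \<in> W"
  shows weyl_group_bij: "bij w" and weyl_group_inv: "inv w \<in> W"
proof -
  obtain "is" where *: "set is \<subseteq> I" "w = word_elt is"
    using weyl_group_word assms by blast
  then have "inv w = word_elt (rev is)"
    by (intro inv_unique_comp) (simp_all add: word_elt_rev word_elt_rev')
  then show "inv w \<in> W"
    using * by (simp add: word_elt_weyl_group)
  show "bij w"
    using * word_elt_rev word_elt_rev' o_bij by blast
qed

lemma inv_comp:
  assumes "w \<in> W" "w' \<in> W"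
  shows "inv (w \<circ> w') = inv w' \<circ> inv w"
  using assms by (intro o_inv_distrib weyl_group_bij)

lemma inv_s: "i \<in> I \<Longrightarrow> inv (s i) = s i"
  by (intro inv_unique_comp s_s)

lemma s_weyl_group: "i \<in> I \<Longrightarrow> s i \<in> W"
  by (simp add: refl_weyl_group)

lemma inv_s_comp: "i \<in> I \<Longrightarrow> w \<in> W \<Longrightarrow> inv (s i \<circ> w) = inv w \<circ> s i"
  by (simp add: inv_comp s_weyl_group inv_s)

text \<open>Read from the right, the letters carry the positive root \<open>\<alpha> i\<close> to a
  negative one; a letter at which the sign turns is deleted.\<close>

lemma exchange:
  assumes "set is \<subseteq> I" "i \<in> I" "word_elt is (\<alpha> i) \<in> negative_roots M"
  shows "\<exists>js. set js \<subseteq> I \<and> length is = Suc (length js) \<and> word_elt is \<circ> s i = word_elt js"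
  using assms(1,3)
proof (induction "is")
  case Nil
  then show ?case
    using assms(2) positive_not_negative[OF simple_positive] by simp
next
  case (Cons j "is")
  let ?\<beta> = "word_elt is (\<alpha> i)"
  have is_I: "set is \<subseteq> I" and j: "j \<in> I"
    using Cons by auto
  then have root: "?\<beta> \<in> roots M"
    using assms(2) by (intro weyl_group_root[OF word_elt_weyl_group]) auto
  show ?case
  proof (cases "?\<beta> \<in> negative_roots M")
    case True
    then obtain js where "set js \<subseteq> I" "length is = Suc (length js)" "word_elt is \<circ> s i = word_elt js"
      using Cons.IH[OF is_I] by blast
    moreover from this have "word_elt (j # is) \<circ> s i = word_elt (j # js)"
      by (simp only: word_elt_Cons comp_assoc)
    ultimately show ?thesis
      using j by (intro exI[of _ "j # js"]) auto
  next
    case False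
    \<comment> \<open>Among positive roots, \<open>s j\<close> makes only \<open>\<alpha> j\<close>
      negative. So this is the root reached by the tail, and \<open>s j\<close> is the conjugate of
      \<open>s i\<close> by it.\<close>
    then have "?\<beta> = \<alpha> j"
      using Cons.prems root j simple_refl_positive[of j ?\<beta>] positive_not_negative
      by (force simp: word_elt_Cons negative_iff_not_positive)
    then have "s j = word_elt is \<circ> s i \<circ> word_elt (rev is)"
      using refl_word_elt[OF is_I, of "\<alpha> i"] assms(2) by simp
    then have "word_elt (j # is) = word_elt is \<circ> s i \<circ> (word_elt (rev is) \<circ> word_elt is)"
      by (simp only: word_elt_Cons comp_assoc)
    then have "word_elt (j # is) \<circ> s i = word_elt is"
      by (simp only: word_elt_rev'[OF is_I] comp_assoc s_s[OF assms(2)] comp_id)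
    then show ?thesis
      using is_I by auto
  qed
qed

text \<open>If the word ends in \<open>i\<close>, the rest sends \<open>\<alpha> i\<close> to a
  negative root, and exchange yields a word for the same element that is shorter by two
  letters.\<close>

lemma word_elt_eq_id:
  assumes "set is \<subseteq> I" "\<forall>i\<in>I. word_elt is (\<alpha> i) \<in> positive_roots M"
  shows "word_elt is = id"
  using assms
proof (induction "length is" arbitrary: "is" rule: less_induct)
  case less
  show ?case
  proof (cases "is" rule: rev_cases)
    case (snoc js i)
    then have i: "i \<in> I" and js: "set js \<subseteq> I"
      using less.prems by auto
    interpret additive "word_elt js" using js by (intro weyl_group_additive word_elt_weyl_group)
    have "- word_elt js (\<alpha> i) \<in> positive_roots M"
      using less.prems i by (auto simp: snoc word_elt_append word_elt_Cons refl_self minus)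
    then have "word_elt js (\<alpha> i) \<in> negative_roots M"
      by (simp add: negative_roots_iff)
    then obtain ks where "set ks \<subseteq> I" "length js = Suc (length ks)" "word_elt is = word_elt ks"
      using exchange[OF js i] by (auto simp: snoc word_elt_append word_elt_Cons)
    then show ?thesis
      using less snoc by auto
  qed simp
qed

lemma weyl_group_eq_id: "w \<in> W \<Longrightarrow> \<forall>i\<in>I. w (\<alpha> i) \<in> positive_roots M \<Longrightarrow> w = id"
  using weyl_group_word word_elt_eq_id by blast

text \<open>
  The Weyl group is given as a group of maps on the lattice, whose rank may exceed that of the root
  system, but it still acts faithfully on the roots.
\<close>

lemma weyl_group_eqI:
  assumes "w \<in> W" "w' \<in> W" "\<And>i. i \<in> I \<Longrightarrow> w (\<alpha> i) = w' (\<alpha> i)"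
  shows "w = w'"
proof -
  have inv: "w' \<circ> inv w' = id" "inv w' \<circ> w' = id"
    using weyl_group_bij[OF assms(2)] by (auto simp: fun_eq_iff bij_is_surj bij_is_inj surj_f_inv_f)
  have "inv w' \<circ> w = id"
    using assms inv(2)
    by (intro weyl_group_eq_id weyl_group_comp weyl_group_inv) (auto simp: fun_eq_iff)
  then have "w' \<circ> inv w' \<circ> w = w'"
    by (simp only: comp_assoc comp_id)
  then show ?thesis
    by (simp only: inv id_comp)
qed

text \<open>The inverse is used because words grow on the left: passing from \<open>w\<close> to
  \<open>s i \<circ> w\<close> then changes the count by one.\<close>

definition inv_count :: "('d lattice \<Rightarrow> 'd lattice) \<Rightarrow> nat" where
  "inv_count w = card (inversions M (inv w))"

lemma finite_inversions [simp]: "finite (inversions M w)"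
  by (simp add: inversions_def)

text \<open>\<open>s i\<close> permutes the positive roots other than \<open>\<alpha> i\<close>, so
  it carries the old inversions along and \<open>\<alpha> i\<close> is the only new one. Length and
  products over inversions both follow this recursion.\<close>

lemma inversions_s_comp:
  assumes "w \<in> W" "i \<in> I" "inv w (\<alpha> i) \<in> positive_roots M"
  shows "inversions M (inv (s i \<circ> w)) = insert (\<alpha> i) (s i ` inversions M (inv w))"
    and "\<alpha> i \<notin> s i ` inversions M (inv w)"
proof -
  interpret additive "inv w" using assms by (intro weyl_group_additive weyl_group_inv)
  note pn = positive_not_negative
  have neg: "inv w (- \<alpha> i) \<in> negative_roots M"
    using assms by (simp add: minus negative_roots_iff)
  show "\<alpha> i \<notin> s i ` inversions M (inv w)"
  proof
    assume "\<alpha> i \<in> s i ` inversions M (inv w)"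
    then obtain \<beta> where "\<beta> \<in> positive_roots M" "\<alpha> i = s i \<beta>"
      by (auto simp: inversions_def)
    then have "\<beta> = - \<alpha> i" "\<beta> \<in> positive_roots M"
      using assms by (metis refl_refl refl_self simple_root)+
    then show False
      using pn[OF simple_positive[OF assms(2)]] by (simp add: negative_roots_iff)
  qed
  show "inversions M (inv (s i \<circ> w)) = insert (\<alpha> i) (s i ` inversions M (inv w))"
  proof (intro set_eqI iffI)
    fix \<beta> assume "\<beta> \<in> inversions M (inv (s i \<circ> w))"
    then have \<beta>: "\<beta> \<in> positive_roots M" "inv w (s i \<beta>) \<in> negative_roots M"
      using assms by (auto simp: inversions_def inv_s_comp)
    show "\<beta> \<in> insert (\<alpha> i) (s i ` inversions M (inv w))"
    proof (cases "\<beta> = \<alpha> i")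
      case False
      then have "s i \<beta> \<in> inversions M (inv w)"
        using \<beta> assms simple_refl_positive by (simp add: inversions_def)
      then show ?thesis
        using assms by (metis image_eqI insertI2 refl_refl simple_root)
    qed simp
  next
    fix \<beta> assume "\<beta> \<in> insert (\<alpha> i) (s i ` inversions M (inv w))"
    then consider "\<beta> = \<alpha> i" | \<gamma> where "\<gamma> \<in> inversions M (inv w)" "\<beta> = s i \<gamma>"
      by blast
    then show "\<beta> \<in> inversions M (inv (s i \<circ> w))"
    proof cases
      case 1
      then show ?thesis
        using assms neg by (simp add: inversions_def inv_s_comp refl_self)
    next
      case 2
      then have "\<gamma> \<in> positive_roots M" "inv w \<gamma> \<in> negative_roots M"
        by (auto simp: inversions_def)
      moreover have "\<gamma> \<noteq> \<alpha> i"
        using calculation assms pn by blast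
      ultimately show ?thesis
        using 2 assms simple_refl_positive by (simp add: inversions_def inv_s_comp)
    qed
  qed
qed

lemma inj_s: "i \<in> I \<Longrightarrow> inj_on (s i) A"
  by (metis inj_onI refl_refl simple_root)

lemma inv_count_ascent:
  assumes "w \<in> W" "i \<in> I" "inv w (\<alpha> i) \<in> positive_roots M"
  shows "inv_count (s i \<circ> w) = Suc (inv_count w)"
  using inversions_s_comp[OF assms] by (simp add: inv_count_def card_image inj_s assms)

lemma inv_s_comp_simple:
  assumes "w \<in> W" "i \<in> I"
  shows "inv (s i \<circ> w) (\<alpha> i) = - inv w (\<alpha> i)"
proof -
  interpret additive "inv w" using assms by (intro weyl_group_additive weyl_group_inv)
  show ?thesis
    using assms by (simp add: inv_s_comp refl_self minus)
qed

lemma s_s_comp: "i \<in> I \<Longrightarrow> s i \<circ> (s i \<circ> w) = w"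
  by (simp add: o_assoc s_s)

lemma inv_count_descent:
  assumes "w \<in> W" "i \<in> I" "inv w (\<alpha> i) \<in> negative_roots M"
  shows "inv_count w = Suc (inv_count (s i \<circ> w))"
proof -
  have "inv_count (s i \<circ> (s i \<circ> w)) = Suc (inv_count (s i \<circ> w))"
    using assms
    by (intro inv_count_ascent weyl_group_comp s_weyl_group) (simp_all add: inv_s_comp_simple negative_roots_iff)
  then show ?thesis
    using assms by (simp add: s_s_comp)
qed

lemma inv_simple_cases:
  assumes "w \<in> W" "i \<in> I"
  obtains "inv w (\<alpha> i) \<in> positive_roots M" | "inv w (\<alpha> i) \<in> negative_roots M"
  using weyl_group_root[OF weyl_group_inv[OF assms(1)] simple_root[OF assms(2)]]
    positive_or_negative by blast

lemma inv_count_s_comp_le: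
  assumes "w \<in> W" "i \<in> I"
  shows "inv_count (s i \<circ> w) \<le> Suc (inv_count w)"
  by (rule inv_simple_cases[OF assms]) (use inv_count_ascent[OF assms] inv_count_descent[OF assms] in auto)

lemma inv_count_word_elt_le: "set is \<subseteq> I \<Longrightarrow> inv_count (word_elt is) \<le> length is"
proof (induction "is")
  case Nil
  then show ?case
    using positive_not_negative by (auto simp: inv_count_def inversions_def)
next
  case (Cons i "is")
  then have "inv_count (s i \<circ> word_elt is) \<le> Suc (inv_count (word_elt is))"
    by (intro inv_count_s_comp_le word_elt_weyl_group) auto
  also have "\<dots> \<le> length (i # is)"
    using Cons by auto
  finally show ?case
    unfolding word_elt_Cons .
qed

text \<open>Descents are stripped until none is left; then all simple roots stay positive and the
  element is the identity.\<close>

lemma ex_word_inv_count: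
  assumes "w \<in> W"
  shows "\<exists>is. set is \<subseteq> I \<and> w = word_elt is \<and> length is = inv_count w"
  using assms
proof (induction "inv_count w" arbitrary: w rule: less_induct)
  case less
  show ?case
  proof (cases "\<exists>i\<in>I. inv w (\<alpha> i) \<in> negative_roots M")
    case True
    then obtain i where i: "i \<in> I" "inv w (\<alpha> i) \<in> negative_roots M" by blast
    then have *: "inv_count w = Suc (inv_count (s i \<circ> w))" "s i \<circ> w \<in> W"
      using less.prems by (simp_all add: inv_count_descent weyl_group_comp s_weyl_group)
    then obtain "is" where "set is \<subseteq> I" "s i \<circ> w = word_elt is" "length is = inv_count (s i \<circ> w)"
      using less.hyps by (metis lessI)
    then show ?thesis
      using i * by (intro exI[of _ "i # is"]) (simp add: word_elt_Cons s_s_comp flip: \<open>s i \<circ> w = word_elt is\<close>)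
  next
    case False
    then have "inv w = id"
      using less.prems by (intro weyl_group_eq_id weyl_group_inv) (auto elim: inv_simple_cases)
    then have "w = id"
      using inv_inv_eq[OF weyl_group_bij[OF less.prems]] by simp
    then show ?thesis
      using inv_count_word_elt_le[of "[]"] by (intro exI[of _ "[]"]) simp
  qed
qed

lemma weyl_length_eq:
  assumes "w \<in> W"
  shows "weyl_length M w = inv_count w"
  unfolding weyl_length_def
proof (rule Least_equality)
  show "\<exists>is. word_for M is w \<and> length is = inv_count w"
    using ex_word_inv_count[OF assms] by (auto simp: word_for_iff)
  show "inv_count w \<le> k" if "\<exists>is. word_for M is w \<and> length is = k" for k
    using that inv_count_word_elt_le by (auto simp: word_for_iff)
qed

lemma reduced_word_iff:
  "reduced_word M is w \<longleftrightarrow> set is \<subseteq> I \<and> w = word_elt is \<and> length is = inv_count w"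
  using weyl_length_eq word_elt_weyl_group by (auto simp: reduced_word_def word_for_iff)

lemma finite_weyl_group: "finite W"
proof (rule finite_subset)
  show "W \<subseteq> word_elt ` {is. set is \<subseteq> I \<and> length is \<le> card (positive_roots M)}"
  proof
    fix w assume "w \<in> W"
    then obtain "is" where "set is \<subseteq> I" "w = word_elt is" "length is = inv_count w"
      using ex_word_inv_count by blast
    moreover have "inv_count w \<le> card (positive_roots M)"
      unfolding inv_count_def by (intro card_mono) (auto simp: inversions_def)
    ultimately show "w \<in> word_elt ` {is. set is \<subseteq> I \<and> length is \<le> card (positive_roots M)}"
      by auto
  qed
qed (simp add: finite_lists_length_le)

lemma lincomb_sum: "(\<Sum>x\<in>A. lincomb (f x)) = lincomb (\<lambda>i. \<Sum>x\<in>A. f x i)"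
  by (induction A rule: infinite_finite_induct)
    (simp_all add: lincomb_add, simp_all add: lincomb_def)

lemma negative_of_simple_negative:
  assumes "w \<in> W" "\<forall>i\<in>I. w (\<alpha> i) \<in> negative_roots M" "\<beta> \<in> positive_roots M"
  shows "w \<beta> \<in> negative_roots M"
proof -
  interpret additive w using assms by (intro weyl_group_additive)
  obtain k where k: "\<beta> = lincomb k" "\<forall>i\<in>I. 0 \<le> k i" and \<beta>: "\<beta> \<in> roots M"
    using assms by (auto simp: positive_roots_iff)
  have "\<exists>l. w (\<alpha> i) = lincomb l \<and> (\<forall>j\<in>I. l j \<le> 0)" if "i \<in> I" for i
  proof -
    have neg: "w (\<alpha> i) \<in> negative_roots M" and root: "w (\<alpha> i) \<in> roots M"
      using assms(2) that by (auto simp: negative_roots_def)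
    obtain l where l: "w (\<alpha> i) = lincomb l"
      using root_lincomb[OF root] by blast
    then show ?thesis
      using negative_lincomb[of l] root neg by (intro exI[of _ l]) simp
  qed
  then obtain l where l: "\<And>i. i \<in> I \<Longrightarrow> w (\<alpha> i) = lincomb (l i)" "\<And>i j. i \<in> I \<Longrightarrow> j \<in> I \<Longrightarrow> l i j \<le> 0"
    by metis
  have "w \<beta> = (\<Sum>i\<in>I. frag_cmul (k i) (w (\<alpha> i)))"
    by (simp add: k lincomb_def sum additive_frag_cmul[OF weyl_group_additive[OF assms(1)]])
  also have "\<dots> = lincomb (\<lambda>j. \<Sum>i\<in>I. k i * l i j)"
    by (simp add: l lincomb_cmul lincomb_sum)
  finally have eq: "w \<beta> = lincomb (\<lambda>j. \<Sum>i\<in>I. k i * l i j)" .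
  have "lincomb (\<lambda>j. \<Sum>i\<in>I. k i * l i j) \<in> roots M"
    using weyl_group_root[OF assms(1) \<beta>] eq by simp
  then show ?thesis
    unfolding eq using k l by (subst negative_lincomb) (auto intro!: sum_nonpos mult_nonneg_nonpos)
qed

text \<open>At an ascent, left multiplication by \<open>s i\<close> would give a longer
  element.\<close>

lemma long_element_negative:
  assumes "long_element M w\<^sub>0" "i \<in> I"
  shows "inv w\<^sub>0 (\<alpha> i) \<in> negative_roots M"
proof -
  have w0: "w\<^sub>0 \<in> W" "\<And>w. w \<in> W \<Longrightarrow> inv_count w \<le> inv_count w\<^sub>0"
    using assms by (auto simp: long_element_def weyl_length_eq)
  have "inv_count (s i \<circ> w\<^sub>0) \<le> inv_count w\<^sub>0"
    using w0 assms by (simp add: weyl_group_comp s_weyl_group)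
  then have "inv w\<^sub>0 (\<alpha> i) \<notin> positive_roots M"
    using inv_count_ascent[OF w0(1) assms(2)] by auto
  then show ?thesis
    using inv_simple_cases[OF w0(1) assms(2)] by blast
qed

lemma inversions_long_element:
  assumes "long_element M w\<^sub>0"
  shows "inversions M (inv w\<^sub>0) = positive_roots M"
proof -
  have "inv w\<^sub>0 \<in> W"
    using assms by (simp add: long_element_def weyl_group_inv)
  then show ?thesis
    using negative_of_simple_negative long_element_negative[OF assms] by (auto simp: inversions_def)
qed

section \<open>Braid relations in the twisted group algebra\<close>

definition y :: "'d lattice \<Rightarrow> 'd ratfun" where
  "y \<beta> = xpow (frag_cmul (mroot M \<beta>) \<beta>)"

lemma bform_commute: "bform M x z = bform M z x"
  by (simp add: bform_def add.commute)

lemma bform_cmul: "bform M x (frag_cmul c z) = c * bform M x z"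
proof -
  interpret additive "bform M x" by (rule bform_additive)
  have nat: "bform M x (frag_cmul (int n) z) = int n * bform M x z" for n
    by (induction n) (simp_all add: zero add frag_cmul_distrib algebra_simps)
  obtain m n where c: "c = int m - int n"
    by (cases c rule: int_diff_cases)
  show ?thesis
    unfolding c frag_cmul_diff_distrib diff nat by (rule left_diff_distrib[symmetric])
qed

lemma mroot_pos: "mroot M \<beta> > 0"
  using cover_pos by (auto simp: mroot_def pos_imp_zdiv_pos_iff intro: zdvd_imp_le)

text \<open>\<open>mroot M \<beta>\<close> is the additive order of \<open>qform M \<beta>\<close>
  modulo \<open>cover M\<close>.\<close>

lemma mroot_dvd_iff: "mroot M \<beta> dvd t \<longleftrightarrow> int (cover M) dvd t * qform M \<beta>"
proof -
  define g where "g = gcd (int (cover M)) (qform M \<beta>)"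
  have "g \<noteq> 0"
    using cover_pos by (simp add: g_def)
  obtain n q where nq: "int (cover M) = n * g" "qform M \<beta> = q * g" "coprime n q"
    using gcd_coprime_exists[of "int (cover M)" "qform M \<beta>"] \<open>g \<noteq> 0\<close> unfolding g_def by blast
  have "mroot M \<beta> = n"
    unfolding mroot_def g_def[symmetric] using \<open>g \<noteq> 0\<close> nq by simp
  moreover have "n * g dvd t * (q * g) \<longleftrightarrow> n dvd t"
    using \<open>g \<noteq> 0\<close> nq(3) coprime_dvd_mult_left_iff[of n q t] by (simp flip: mult.assoc)
  ultimately show ?thesis
    using nq by simp
qed

lemma qform_weyl: "w \<in> W \<Longrightarrow> qform M (w l) = qform M l"
  by (induction rule: weyl_group.induct) (simp_all add: qform_invariant)

lemma mroot_weyl: "w \<in> W \<Longrightarrow> mroot M (w \<beta>) = mroot M \<beta>"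
  by (simp add: mroot_def qform_weyl)

lemma perm_act_y: "w \<in> W \<Longrightarrow> perm_act w (y \<beta>) = y (w \<beta>)"
  by (simp add: y_def perm_act_xpow weyl_group_additive bij_is_inj[OF weyl_group_bij] mroot_weyl
      additive_frag_cmul)

lemma y_uminus: "y (- \<beta>) = 1 / y \<beta>"
proof -
  have "qform M (- \<beta>) = qform M \<beta>"
    using qform_scale[of "-1" \<beta>] by simp
  then have "y (- \<beta>) = xpow (- frag_cmul (mroot M \<beta>) \<beta>)"
    using frag_cmul_cmul[of "mroot M \<beta>" "-1" \<beta>] by (simp add: y_def mroot_def)
  then show ?thesis
    unfolding xpow_minus by (simp add: y_def inverse_eq_divide)
qed

lemma y_nonzero [simp]: "y \<beta> \<noteq> 0"
  by (simp add: y_def)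

lemma y_neq_1: "\<beta> \<in> roots M \<Longrightarrow> y \<beta> \<noteq> 1"
  using mroot_pos[of \<beta>] root_nonzero by (simp add: y_def)

lemma field_endo_perm: "w \<in> W \<Longrightarrow> field_endo (perm_act w)"
  by (simp add: field_endo_perm_act weyl_group_additive bij_is_inj[OF weyl_group_bij])

lemma perm_act_perm_act: "w \<in> W \<Longrightarrow> w' \<in> W \<Longrightarrow> perm_act w (perm_act w' f) = perm_act (w \<circ> w') f"
  by (simp add: perm_act_comp weyl_group_additive bij_is_inj[OF weyl_group_bij])

text \<open>
  Functions from the Weyl group to the field, as coefficient vectors of operators
  \<open>\<Sum>\<^sub>w R(w) w\<close>: \<open>T i\<close> is multiplication by \<open>\<sigma>\<^sub>i\<close> from the left in the twisted group algebra of the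
  permutation action.
\<close>

definition fscale :: "'d ratfun \<Rightarrow> (('d lattice \<Rightarrow> 'd lattice) \<Rightarrow> 'd ratfun) \<Rightarrow>
    ('d lattice \<Rightarrow> 'd lattice) \<Rightarrow> 'd ratfun" where
  "fscale c R = (\<lambda>u. c * R u)"

definition T :: "nat \<Rightarrow> (('d lattice \<Rightarrow> 'd lattice) \<Rightarrow> 'd ratfun) \<Rightarrow>
    ('d lattice \<Rightarrow> 'd lattice) \<Rightarrow> 'd ratfun" where
  "T i R = (\<lambda>u. perm_act (s i) (R (s i \<circ> u)))"

lemma demazure_operator_T:
  assumes "i \<in> I"
  shows "demazure_operator (perm_act (s i)) fscale (T i) (y (\<alpha> i))"
proof -
  interpret field_endo "perm_act (s i)" by (intro field_endo_perm s_weyl_group assms)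
  show ?thesis
  proof
    show "perm_act (s i) (perm_act (s i) c) = c" for c
      using assms by (simp add: perm_act_perm_act s_weyl_group s_s)
    then show "T i (T i x) = x" for x
      using assms by (simp add: T_def s_s_comp)
    show "perm_act (s i) (y (\<alpha> i)) = 1 / y (\<alpha> i)"
      using assms by (simp add: perm_act_y s_weyl_group refl_self y_uminus)
    show "y (\<alpha> i) \<noteq> 1"
      using assms by (simp add: y_neq_1)
  qed (simp_all add: fscale_def T_def fun_eq_iff algebra_simps add mult)
qed

definition dem :: "nat \<Rightarrow> (('d lattice \<Rightarrow> 'd lattice) \<Rightarrow> 'd ratfun) \<Rightarrow>
    ('d lattice \<Rightarrow> 'd lattice) \<Rightarrow> 'd ratfun" where
  "dem i R = fscale (1 / (1 - y (\<alpha> i))) (R - fscale (y (\<alpha> i)) (T i R))"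

lemma demazure_operator_D:
  assumes "i \<in> I"
  shows "demazure_operator.D fscale (T i) (y (\<alpha> i)) = dem i"
proof -
  interpret demazure_operator "perm_act (s i)" fscale "T i" "y (\<alpha> i)"
    by (rule demazure_operator_T) fact
  show ?thesis
    by (simp add: fun_eq_iff D_def dem_def)
qed

definition T_word where "T_word is = foldr (\<lambda>i F. T i \<circ> F) is id"
definition dem_word where "dem_word is = foldr (\<lambda>i F. dem i \<circ> F) is id"

lemma dem_word_Nil [simp]: "dem_word [] = id"
  and dem_word_Cons: "dem_word (i # is) = dem i \<circ> dem_word is"
  and T_word_Nil [simp]: "T_word [] = id"
  and T_word_Cons: "T_word (i # is) = T i \<circ> T_word is"
  by (simp_all add: dem_word_def T_word_def)

lemma dem_word_append: "dem_word (is @ js) = dem_word is \<circ> dem_word js"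
  by (induction "is") (simp_all add: dem_word_Cons o_assoc)

lemma T_word_eq:
  assumes "set is \<subseteq> I"
  shows "T_word is R = (\<lambda>u. perm_act (word_elt is) (R (word_elt (rev is) \<circ> u)))"
  using assms
proof (induction "is")
  case (Cons i "is")
  then have I: "i \<in> I" "set is \<subseteq> I" by auto
  show ?case
  proof
    fix u
    have "T_word (i # is) R u = perm_act (s i) (perm_act (word_elt is) (R (word_elt (rev is) \<circ> (s i \<circ> u))))"
      by (simp only: T_word_Cons T_def Cons.IH[OF I(2)] comp_def)
    also have "\<dots> = perm_act (s i \<circ> word_elt is) (R (word_elt (rev is) \<circ> (s i \<circ> u)))"
      by (rule perm_act_perm_act[OF s_weyl_group[OF I(1)] word_elt_weyl_group[OF I(2)]])
    finally show "T_word (i # is) R u = perm_act (word_elt (i # is)) (R (word_elt (rev (i # is)) \<circ> u))"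
      by (simp only: word_elt_Cons rev.simps word_elt_append word_elt_Nil comp_id comp_assoc)
  qed
qed simp

lemma word_elt_rev_eq:
  assumes "set is \<subseteq> I"
  shows "word_elt (rev is) = inv (word_elt is)"
  using assms by (intro inv_unique_comp[symmetric] word_elt_rev word_elt_rev')

text \<open>The operators \<open>T i\<close> come from a group action, so relations between words
  pass to them. This supplies the braid hypotheses of the rank two formulas.\<close>

lemma T_word_cong:
  assumes "set is \<subseteq> I" "set js \<subseteq> I" "word_elt is = word_elt js"
  shows "T_word is = T_word js"
  using assms by (intro ext) (simp add: T_word_eq word_elt_rev_eq)

text \<open>The inversions contributed by the successive letters of a reduced word.\<close>

fun root_list :: "nat list \<Rightarrow> 'd lattice list" where
  "root_list [] = []"
| "root_list (i # is) = \<alpha> i # map (s i) (root_list is)"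

text \<open>Every letter is a descent when its turn comes: the first root of the list is
  \<open>\<alpha> i\<close>, and the others, moved back by \<open>s i\<close>, serve for the
  remaining letters.\<close>

lemma inv_count_strip:
  assumes "w \<in> W" "set ps \<subseteq> I" "\<forall>\<beta>\<in>set (root_list ps). inv w \<beta> \<in> negative_roots M"
  shows "inv_count w = length ps + inv_count (word_elt (rev ps) \<circ> w)"
  using assms
proof (induction ps arbitrary: w)
  case (Cons i ps)
  have i: "i \<in> I" and w: "s i \<circ> w \<in> W"
    using Cons.prems by (auto intro: weyl_group_comp s_weyl_group)
  have "inv_count (s i \<circ> w) = length ps + inv_count (word_elt (rev ps) \<circ> (s i \<circ> w))"
  proof (rule Cons.IH[OF w])
    show "\<forall>\<beta>\<in>set (root_list ps). inv (s i \<circ> w) \<beta> \<in> negative_roots M"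
      unfolding inv_s_comp[OF i Cons.prems(1)] using Cons.prems(3) by simp
  qed (use Cons.prems in auto)
  moreover have "inv_count w = Suc (inv_count (s i \<circ> w))"
    using Cons.prems by (intro inv_count_descent) auto
  ultimately show ?case
    by (simp only: word_elt_append rev.simps word_elt_Cons word_elt_Nil comp_id comp_assoc list.size)
qed simp

text \<open>Collects what the comparison of reduced words needs. The clause on
  \<open>root_list\<close> ensures that an element with descents at both \<open>i\<close> and
  \<open>j\<close> has reduced words beginning with \<open>ps\<close> and with
  \<open>qs\<close>.\<close>

definition braid_pair :: "nat \<Rightarrow> nat \<Rightarrow> nat list \<Rightarrow> nat list \<Rightarrow> bool" where
  "braid_pair i j ps qs \<longleftrightarrow> ps \<noteq> [] \<and> hd ps = i \<and> qs \<noteq> [] \<and> hd qs = j \<and>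
     set ps \<subseteq> {i, j} \<and> set qs \<subseteq> {i, j} \<and>
     length ps = length qs \<and> word_elt ps = word_elt qs \<and> dem_word ps = dem_word qs \<and>
     (\<forall>\<beta>\<in>set (root_list ps) \<union> set (root_list qs). \<exists>c\<ge>0. \<exists>d\<ge>0.
        \<beta> = frag_cmul c (\<alpha> i) + frag_cmul d (\<alpha> j))"

lemma braid_pair_swap: "braid_pair i j ps qs \<Longrightarrow> braid_pair j i qs ps"
  unfolding braid_pair_def by (auto simp: Un_commute insert_commute) (metis UnI1 UnI2 add.commute)+

lemma root_list_root: "set ps \<subseteq> I \<Longrightarrow> \<beta> \<in> set (root_list ps) \<Longrightarrow> \<beta> \<in> roots M"
  by (induction ps arbitrary: \<beta>) (auto simp: refl_root)

lemma inv_count_braid_pair: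
  assumes "braid_pair i j ps qs" "i \<in> I" "j \<in> I" "w \<in> W"
    and "inv w (\<alpha> i) \<in> negative_roots M" "inv w (\<alpha> j) \<in> negative_roots M"
  shows "inv_count w = length ps + inv_count (word_elt (rev ps) \<circ> w)"
proof (rule inv_count_strip)
  show ps: "set ps \<subseteq> I"
    using assms by (auto simp: braid_pair_def)
  show "\<forall>\<beta>\<in>set (root_list ps). inv w \<beta> \<in> negative_roots M"
  proof
    fix \<beta> assume \<beta>: "\<beta> \<in> set (root_list ps)"
    then obtain c d where cd: "c \<ge> 0" "d \<ge> 0" "\<beta> = frag_cmul c (\<alpha> i) + frag_cmul d (\<alpha> j)"
      using assms(1) unfolding braid_pair_def by blast
    have add: "additive (inv w)"
      using assms by (intro weyl_group_additive weyl_group_inv)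
    then have eq: "inv w \<beta> = frag_cmul c (inv w (\<alpha> i)) + frag_cmul d (inv w (\<alpha> j))"
      by (simp add: cd additive.add additive_frag_cmul)
    show "inv w \<beta> \<in> negative_roots M"
      using cd assms weyl_group_root[OF weyl_group_inv[OF assms(4)] root_list_root[OF ps \<beta>]]
      unfolding eq by (intro negative_combination)
  qed
qed fact

end

text \<open>Two simple roots; \<open>k\<close> and \<open>l\<close> are the negatives of the off-diagonal Cartan integers.\<close>

locale simple_root_pair = metaplectic_datum M
  for M :: "'d::{finite,linorder} metaplectic_data" +
  fixes i j :: nat and k l :: int
  assumes i [simp]: "i \<in> I" and j [simp]: "j \<in> I" and neq: "i \<noteq> j"
    and k: "coroot (\<alpha> i) (\<alpha> j) = - k" and l: "coroot (\<alpha> j) (\<alpha> i) = - l"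
begin

lemma swap: "simple_root_pair M j i l k"
  by unfold_locales (use neq k l in auto)

definition P :: "int \<Rightarrow> int \<Rightarrow> 'd lattice" where
  "P c d = frag_cmul c (\<alpha> i) + frag_cmul d (\<alpha> j)"

lemma simple_P: "\<alpha> i = P 1 0" "\<alpha> j = P 0 1"
  by (simp_all add: P_def)

lemma P_eq_iff: "P c d = P c' d' \<longleftrightarrow> c = c' \<and> d = d'"
  using simple_pair_eqD[OF i j neq] by (auto simp: P_def)

lemma s_simple:
  assumes "h \<in> I" "g \<in> I"
  shows "s h (\<alpha> g) = \<alpha> g + frag_cmul (- coroot (\<alpha> h) (\<alpha> g)) (\<alpha> h)"
  using assms refl_eq[of "\<alpha> h" "\<alpha> g"] by (simp flip: minus_frag_cmul)

lemma s_P: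
  shows "s i (P c d) = P (k * d - c) d" "s j (P c d) = P c (l * c - d)"
  using s_simple[of i j] s_simple[of j i] neq
  by (simp_all add: P_def additive.add[OF additive_refl] additive_frag_cmul[OF additive_refl]
      refl_self k l poly_mapping_eq_iff fun_eq_iff lookup_add algebra_simps)

text \<open>On any simple root the two reflections only add vectors of their plane, by an affine
  rule. This makes words in \<open>s i\<close>, \<open>s j\<close> computable there with the Cartan
  integers of \<open>\<alpha> h\<close> left symbolic.\<close>

lemma s_translate:
  assumes "h \<in> I"
  defines "p \<equiv> - coroot (\<alpha> i) (\<alpha> h)" and "q \<equiv> - coroot (\<alpha> j) (\<alpha> h)"
  shows "s i (\<alpha> h + P c d) = \<alpha> h + P (p + k * d - c) d"
    and "s j (\<alpha> h + P c d) = \<alpha> h + P c (q + l * c - d)"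
  using assms(1)
  by (simp_all add: additive.add[OF additive_refl] s_P s_simple p_def q_def)
    (simp_all add: P_def poly_mapping_eq_iff fun_eq_iff lookup_add algebra_simps)

lemma k_nonneg: "k \<ge> 0"
proof -
  have "s i (\<alpha> j) \<in> positive_roots M"
    using neq simple_inj[of i j] by (intro simple_refl_positive) auto
  then have "P k 1 \<in> positive_roots M"
    by (simp add: simple_P(2) s_P)
  then obtain f where "P k 1 = lincomb f" "\<forall>i\<in>I. 0 \<le> f i"
    by (auto simp: positive_roots_iff)
  then have eq: "lincomb (\<lambda>h. if h = i then k else if h = j then 1 else 0) = lincomb f"
    and "0 \<le> f i"
    using lincomb_pair[OF i j neq, of k 1] by (simp_all add: P_def)
  then show ?thesis
    using lincomb_eqD[OF eq i] by simp
qed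

lemma l_nonneg: "l \<ge> 0"
  by (rule simple_root_pair.k_nonneg[OF swap])

lemma k_eq_0_iff: "k = 0 \<longleftrightarrow> l = 0"
proof -
  have "2 * form (\<alpha> i) (\<alpha> j) = - k * form (\<alpha> i) (\<alpha> i)" "2 * form (\<alpha> i) (\<alpha> j) = - l * form (\<alpha> j) (\<alpha> j)"
    using form_coroot[of "\<alpha> j" "\<alpha> i"] form_coroot[of "\<alpha> i" "\<alpha> j"] form_commute[of "\<alpha> j" "\<alpha> i"]
    by (simp_all add: k l)
  then have "k * form (\<alpha> i) (\<alpha> i) = l * form (\<alpha> j) (\<alpha> j)"
    by linarith
  moreover have "form (\<alpha> i) (\<alpha> i) \<noteq> 0" "form (\<alpha> j) (\<alpha> j) \<noteq> 0"
    using form_pos[of "\<alpha> i"] form_pos[of "\<alpha> j"] i j simple_root less_irrefl by metis+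
  ultimately show ?thesis
    by (metis mult_eq_0_iff)
qed

text \<open>
  If \<open>k l \<ge> 4\<close>, then a root \<open>x \<alpha>\<^sub>i + y \<alpha>\<^sub>j\<close> of maximal height would be orthogonal to both simple roots.
\<close>

lemma kl_le_3: "k * l \<le> 3"
proof (rule ccontr)
  assume "\<not> k * l \<le> 3"
  then have kl: "k * l \<ge> 4" by simp
  define A where "A = {(c, d). c \<ge> 0 \<and> d \<ge> 0 \<and> P c d \<in> roots M}"
  have "finite A"
  proof (rule finite_imageD)
    show "finite ((\<lambda>(c, d). P c d) ` A)"
      by (rule finite_subset[OF _ finite_roots]) (auto simp: A_def)
    show "inj_on (\<lambda>(c, d). P c d) A"
      by (auto simp: inj_on_def P_eq_iff)
  qed
  moreover have "(1, 0) \<in> A"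
    by (simp add: A_def flip: simple_P)
  ultimately have "Max ((\<lambda>x. fst x + snd x) ` A) \<in> (\<lambda>x. fst x + snd x) ` A"
    by (intro Max_in) auto
  then obtain cd where "cd \<in> A" "Max ((\<lambda>x. fst x + snd x) ` A) = fst cd + snd cd"
    by blast
  then have cd: "cd \<in> A" "\<And>cd'. cd' \<in> A \<Longrightarrow> fst cd' + snd cd' \<le> fst cd + snd cd"
    using \<open>finite A\<close> by (auto intro: Max_ge simp flip: \<open>Max _ = _\<close>)
  obtain c d where cd_eq: "cd = (c, d)" by fastforce
  have P: "c \<ge> 0" "d \<ge> 0" "P c d \<in> roots M"
    and max: "\<And>c' d'. c' \<ge> 0 \<Longrightarrow> d' \<ge> 0 \<Longrightarrow> P c' d' \<in> roots M \<Longrightarrow> c' + d' \<le> c + d"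
    using cd unfolding cd_eq A_def by force+
  have root: "P (k * d - c) d \<in> roots M" "P c (l * c - d) \<in> roots M"
    using refl_root[OF _ P(3)] i j by (simp_all flip: s_P)
  \<comment> \<open>No reflection raises the height; where a reflected coefficient is negative, the
    bound is clear because \<open>c\<close> and \<open>d\<close> are nonnegative.\<close>
  have kd: "k * d \<le> 2 * c" and lc: "l * c \<le> 2 * d"
    using max[OF _ P(2) root(1)] max[OF P(1) _ root(2)] P by linarith+
  have 1: "l * (k * d) \<le> l * (2 * c)"
    using kd l_nonneg by (intro mult_left_mono)
  have 2: "4 * d \<le> k * l * d"
    using kl P by (intro mult_right_mono)
  \<comment> \<open>The bounds close the chain
    \<open>4 * d \<le> k * l * d \<le> 2 * l * c \<le> 4 * d\<close>, so equality holds
    throughout.\<close>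
  have eq: "l * c = 2 * d" "l * (k * d) = l * (2 * c)"
  proof -
    have "k * l * d = l * (k * d)" "l * (2 * c) = 2 * (l * c)"
      by simp_all
    then show "l * c = 2 * d" "l * (k * d) = l * (2 * c)"
      using 1 2 lc by linarith+
  qed
  have "l \<noteq> 0"
    using kl by auto
  then have "k * d = 2 * c"
    using eq by simp
  then have "s i (P c d) = P c d" "s j (P c d) = P c d"
    using eq by (simp_all add: s_P)
  then have "coroot (\<alpha> i) (P c d) = 0" "coroot (\<alpha> j) (P c d) = 0"
    by (auto intro!: coroot_eqI)
  then have "form (P c d) (\<alpha> i) = 0" "form (P c d) (\<alpha> j) = 0"
    using form_coroot[OF P(3), of "\<alpha> i"] form_coroot[OF P(3), of "\<alpha> j"] by simp_all
  moreover have "form (P c d) (P c d) = c * form (\<alpha> i) (P c d) + d * form (\<alpha> j) (P c d)"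
  proof -
    have "form (P c d) \<beta> = c * form (\<alpha> i) \<beta> + d * form (\<alpha> j) \<beta>" for \<beta>
    proof -
      have "form (P c d) \<beta> = (\<Sum>h\<in>I. (if h = i then c else if h = j then d else 0) * form (\<alpha> h) \<beta>)"
        unfolding P_def lincomb_pair[OF i j neq] form_lincomb ..
      also have "\<dots> = (\<Sum>h\<in>{i, j}. (if h = i then c else if h = j then d else 0) * form (\<alpha> h) \<beta>)"
        by (intro sum.mono_neutral_right) auto
      finally show ?thesis
        using neq by simp
    qed
    then show ?thesis .
  qed
  ultimately show False
    using form_pos[OF P(3)] by (simp add: form_commute)
qed

lemma braid_pairI:
  assumes "set ps \<subseteq> {i, j}" "set qs \<subseteq> {i, j}" "ps \<noteq> []" "qs \<noteq> []" "hd ps = i" "hd qs = j"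
    and "length ps = length qs" "word_elt ps = word_elt qs" "dem_word ps = dem_word qs"
    and "\<forall>\<beta>\<in>set (root_list ps) \<union> set (root_list qs). \<exists>c\<ge>0. \<exists>d\<ge>0. \<beta> = P c d"
  shows "braid_pair i j ps qs"
  using assms by (simp add: braid_pair_def P_def)

text \<open>\<open>P 0 0\<close> is the zero vector, written out so that \<open>s_translate\<close>
  rewrites from the innermost letter on.\<close>

lemma word_elt_eqI:
  assumes "set ps \<subseteq> I" "set qs \<subseteq> I"
    and "\<And>h. h \<in> I \<Longrightarrow> word_elt ps (\<alpha> h + P 0 0) = word_elt qs (\<alpha> h + P 0 0)"
  shows "word_elt ps = word_elt qs"
  using assms by (intro weyl_group_eqI word_elt_weyl_group) (auto simp: P_def)

lemma T_word_apply: "T_word [] R = R" "T_word (h # is) R = T h (T_word is R)"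
  by (simp_all add: T_word_Cons)

lemma dem_word_apply: "dem_word [] R = R" "dem_word (h # is) R = dem h (dem_word is R)"
  by (simp_all add: dem_word_Cons)

lemma word_elt_apply: "word_elt [] x = x" "word_elt (h # is) x = s h (word_elt is x)"
  by (simp_all add: word_elt_Cons)

lemma demazure_pair: "demazure_pair (perm_act (s i)) (perm_act (s j)) fscale (T i) (T j) (y (\<alpha> i)) (y (\<alpha> j))"
  by (intro demazure_pair.intro demazure_operator_T i j)

lemmas dem_eq = demazure_operator_D[OF i] demazure_operator_D[OF j]

text \<open>\<open>k'\<close> is the negated Cartan integer of the scaled roots
  \<open>frag_cmul (mroot M \<beta>) \<beta>\<close>; that it is an integer comes from
  \<open>integrality\<close>.\<close>

lemma scaled_cartan_half:
  "\<exists>k'. mroot M (\<alpha> j) * k = mroot M (\<alpha> i) * int k' \<and>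
    perm_act (s i) (y (\<alpha> j)) = y (\<alpha> i) ^ k' * y (\<alpha> j)"
proof -
  let ?mi = "mroot M (\<alpha> i)" and ?mj = "mroot M (\<alpha> j)"
  let ?Qi = "qform M (\<alpha> i)" and ?Qj = "qform M (\<alpha> j)" and ?b = "bform M (\<alpha> j) (\<alpha> i)"
  \<comment> \<open>Invariance under \<open>s i\<close>, expanded, expresses \<open>?b\<close>
    through \<open>k\<close> and \<open>?Qi\<close>, except for \<open>k = 0\<close>, where it says
    nothing.\<close>
  have "qform M (\<alpha> j + frag_cmul k (\<alpha> i)) = ?Qj"
    using qform_invariant[of "\<alpha> i" "\<alpha> j"] s_simple[of i j] by (simp add: k)
  moreover have "bform M (\<alpha> j) (frag_cmul k (\<alpha> i)) = k * ?b"
    by (rule bform_cmul)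
  ultimately have "k * (?b + k * ?Qi) = 0"
    by (simp add: bform_def[of M _ "frag_cmul k _"] qform_scale power2_eq_square algebra_simps)
  then have b: "k = 0 \<or> ?b = - (k * ?Qi)"
    by (simp add: eq_neg_iff_add_eq_0)
  have "?mi dvd ?mj * k"
  proof (cases "k = 0")
    case False
    \<comment> \<open>This compares the two scalings: \<open>cover M\<close> divides
      \<open>?mj * ?Qj\<close>, hence \<open>?mj * ?b\<close>, hence
      \<open>?mj * k * ?Qi\<close>.\<close>
    have "?Qj dvd ?b"
      using integrality[of j "\<alpha> i"] j unfolding bform_commute[of "\<alpha> j"] by (simp add: I_def)
    then have "?mj * ?Qj dvd ?mj * ?b"
      by (rule mult_dvd_mono[OF dvd_refl])
    moreover have "int (cover M) dvd ?mj * ?Qj"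
      by (simp flip: mroot_dvd_iff)
    ultimately have "int (cover M) dvd ?mj * ?b"
      by (metis dvd_trans)
    also have "?mj * ?b = - (?mj * k * ?Qi)"
      using b False by simp
    finally have "int (cover M) dvd ?mj * k * ?Qi"
      by simp
    then show ?thesis
      by (simp add: mroot_dvd_iff)
  qed simp
  then obtain c where c: "?mj * k = ?mi * c" by blast
  have "?mi * c \<ge> 0"
    using k_nonneg mroot_pos[of "\<alpha> j"] by (simp flip: c)
  then have "c \<ge> 0"
    using mroot_pos[of "\<alpha> i"] by (simp add: zero_le_mult_iff)
  then obtain n where n: "c = int n" using nonneg_int_cases by blast
  have "perm_act (s i) (y (\<alpha> j)) = y (s i (\<alpha> j))"
    by (simp add: perm_act_y s_weyl_group)
  also have "\<dots> = xpow (frag_cmul ?mj (\<alpha> j) + frag_cmul (int n) (frag_cmul ?mi (\<alpha> i)))"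
    using mroot_weyl[OF s_weyl_group[OF i], of "\<alpha> j"] s_simple[of i j] c n
    by (simp add: y_def k frag_cmul_distrib2 mult.commute)
  also have "\<dots> = y (\<alpha> i) ^ n * y (\<alpha> j)"
    by (simp only: xpow_add xpow_power y_def mult.commute)
  finally show ?thesis
    using c n by auto
qed

text \<open>Passing from \<open>\<alpha>\<close> to \<open>m(\<alpha>) \<alpha>\<close> may exchange the two Cartan integers.\<close>

lemma scaled_cartan:
  obtains k' l' :: nat
  where "int k' * int l' = k * l" "k' = 0 \<longleftrightarrow> k = 0" "l' = 0 \<longleftrightarrow> l = 0"
    "perm_act (s i) (y (\<alpha> j)) = y (\<alpha> i) ^ k' * y (\<alpha> j)"
    "perm_act (s j) (y (\<alpha> i)) = y (\<alpha> i) * y (\<alpha> j) ^ l'"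
proof -
  obtain k' where k': "mroot M (\<alpha> j) * k = mroot M (\<alpha> i) * int k'"
      "perm_act (s i) (y (\<alpha> j)) = y (\<alpha> i) ^ k' * y (\<alpha> j)"
    using scaled_cartan_half by blast
  obtain l' where l': "mroot M (\<alpha> i) * l = mroot M (\<alpha> j) * int l'"
      "perm_act (s j) (y (\<alpha> i)) = y (\<alpha> j) ^ l' * y (\<alpha> i)"
    using simple_root_pair.scaled_cartan_half[OF swap] by blast
  note pos = mroot_pos[of "\<alpha> i"] mroot_pos[of "\<alpha> j"]
  have "(mroot M (\<alpha> i) * mroot M (\<alpha> j)) * (int k' * int l') =
      (mroot M (\<alpha> i) * int k') * (mroot M (\<alpha> j) * int l')"
    by (simp add: algebra_simps)
  also have "\<dots> = (mroot M (\<alpha> i) * mroot M (\<alpha> j)) * (k * l)"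
    unfolding k'(1)[symmetric] l'(1)[symmetric] by (simp add: algebra_simps)
  finally have "int k' * int l' = k * l"
    using pos by simp
  moreover have "k' = 0 \<longleftrightarrow> k = 0" "l' = 0 \<longleftrightarrow> l = 0"
    using k'(1) l'(1) pos by auto
  ultimately show ?thesis
    using that[of k' l'] k'(2) l'(2) by (simp add: mult.commute)
qed

lemma y_monomial_neq_1:
  assumes "n > 0 \<or> m > 0"
  shows "y (\<alpha> i) ^ n * y (\<alpha> j) ^ m \<noteq> 1"
proof -
  have "y (\<alpha> i) ^ n * y (\<alpha> j) ^ m = xpow (P (int n * mroot M (\<alpha> i)) (int m * mroot M (\<alpha> j)))"
    unfolding y_def P_def by (simp flip: xpow_power xpow_add)
  moreover have "P (int n * mroot M (\<alpha> i)) (int m * mroot M (\<alpha> j)) \<noteq> P 0 0"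
    unfolding P_eq_iff using assms mroot_pos[of "\<alpha> i"] mroot_pos[of "\<alpha> j"] by auto
  ultimately show ?thesis
    by (simp add: P_def)
qed

end

lemma nat_mult_eq_2_3_cases:
  assumes "int a * int b = int p" "p = 2 \<or> p = 3"
  shows "(a = 1 \<and> b = p) \<or> (a = p \<and> b = 1)"
proof -
  have ab: "a * b = p"
    using assms(1) by (simp flip: of_nat_mult)
  then have "a dvd p"
    by auto
  then have "a \<le> 3"
    using assms(2) dvd_imp_le[of a p] by auto
  then consider "a = 0" | "a = 1" | "a = 2" | "a = 3"
    by linarith
  then show ?thesis
    using ab assms(2) by cases (auto, presburger+)
qed

context simple_root_pair
begin

text \<open>The existential is wrapped up so that \<open>nonneg_comb_P\<close> can settle the
  entries of \<open>root_list\<close> by rewriting.\<close>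

definition nonneg_comb :: "'d lattice \<Rightarrow> bool" where
  "nonneg_comb \<beta> \<longleftrightarrow> (\<exists>c\<ge>0. \<exists>d\<ge>0. \<beta> = P c d)"

lemma nonneg_comb_P: "0 \<le> c \<Longrightarrow> 0 \<le> d \<Longrightarrow> nonneg_comb (P c d)"
  by (auto simp: nonneg_comb_def)

lemma nonneg_comb_simple: "nonneg_comb (\<alpha> i)" "nonneg_comb (\<alpha> j)"
  unfolding nonneg_comb_def simple_P by (auto simp: P_eq_iff)

lemma s_simple_P: "s i (\<alpha> j) = P k 1" "s j (\<alpha> i) = P 1 l"
  using s_P[of 0 1] s_P[of 1 0] by (simp_all flip: simple_P)

lemma braid_pairI':
  assumes "set ps \<subseteq> {i, j}" "set qs \<subseteq> {i, j}" "ps \<noteq> []" "qs \<noteq> []" "hd ps = i" "hd qs = j"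
    and "length ps = length qs"
    and word_elt: "\<And>h. h \<in> I \<Longrightarrow> word_elt ps (\<alpha> h + P 0 0) = word_elt qs (\<alpha> h + P 0 0)"
    and dem: "(\<And>R. T_word ps R = T_word qs R) \<Longrightarrow> (\<And>R. dem_word ps R = dem_word qs R)"
    and "\<forall>\<beta>\<in>set (root_list ps) \<union> set (root_list qs). nonneg_comb \<beta>"
  shows "braid_pair i j ps qs"
proof -
  have I: "set ps \<subseteq> I" "set qs \<subseteq> I"
    using assms(1,2) i j by auto
  have eq: "word_elt ps = word_elt qs"
    using I word_elt by (rule word_elt_eqI)
  have "dem_word ps R = dem_word qs R" for R
    using T_word_cong[OF I eq] by (intro dem) simp
  then show ?thesis
    using assms eq by (intro braid_pairI) (auto simp: nonneg_comb_def)
qed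

lemmas word_simps = root_list.simps word_elt_apply s_simple_P s_P nonneg_comb_P nonneg_comb_simple

lemma braid_pair2:
  assumes "k = 0" "l = 0"
  shows "braid_pair i j [i, j] [j, i]"
proof (rule braid_pairI')
  show "word_elt [i, j] (\<alpha> h + P 0 0) = word_elt [j, i] (\<alpha> h + P 0 0)" if "h \<in> I" for h
    by (simp add: word_elt_apply s_translate[OF that] assms)
  assume "T_word [i, j] R = T_word [j, i] R" for R
  then have T: "T i (T j R) = T j (T i R)" for R
    by (simp add: T_word_apply)
  obtain k' l' where "k' = 0" "l' = 0"
    "perm_act (s i) (y (\<alpha> j)) = y (\<alpha> i) ^ k' * y (\<alpha> j)"
    "perm_act (s j) (y (\<alpha> i)) = y (\<alpha> i) * y (\<alpha> j) ^ l'"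
    using scaled_cartan assms by metis
  then show "dem_word [i, j] R = dem_word [j, i] R" for R
    using demazure_pair.braid2[OF demazure_pair, unfolded dem_eq] T by (simp add: dem_word_apply)
qed (use assms in \<open>simp_all add: word_simps\<close>)

lemma braid_pair3:
  assumes "k = 1" "l = 1"
  shows "braid_pair i j [i, j, i] [j, i, j]"
proof (rule braid_pairI')
  show "word_elt [i, j, i] (\<alpha> h + P 0 0) = word_elt [j, i, j] (\<alpha> h + P 0 0)" if "h \<in> I" for h
    by (simp add: word_elt_apply s_translate[OF that] assms)
  assume "T_word [i, j, i] R = T_word [j, i, j] R" for R
  then have T: "T i (T j (T i R)) = T j (T i (T j R))" for R
    by (simp add: T_word_apply)
  obtain k' l' where kl: "int k' * int l' = 1"
    "perm_act (s i) (y (\<alpha> j)) = y (\<alpha> i) ^ k' * y (\<alpha> j)"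
    "perm_act (s j) (y (\<alpha> i)) = y (\<alpha> i) * y (\<alpha> j) ^ l'"
    using scaled_cartan assms by (metis mult_1)
  have "k' = 1" "l' = 1"
    using kl(1) by (simp_all flip: of_nat_mult)
  then show "dem_word [i, j, i] R = dem_word [j, i, j] R" for R
    using demazure_pair.braid3[OF demazure_pair, unfolded dem_eq] kl T y_monomial_neq_1[of 1 1]
    by (simp add: dem_word_apply)
qed (use assms in \<open>simp_all add: word_simps\<close>)

text \<open>Type B2. Words are compared by means of \<open>k\<close>, \<open>l\<close>, Demazure
  operators by means of \<open>k'\<close>, \<open>l'\<close>. The latter may be the transposed pair,
  and then the rank two relation is used with \<open>i\<close> and \<open>j\<close>
  interchanged.\<close>

lemma braid_pair4:
  assumes "k = 1" "l = 2"
  shows "braid_pair i j [i, j, i, j] [j, i, j, i]"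
proof (rule braid_pairI')
  show "word_elt [i, j, i, j] (\<alpha> h + P 0 0) = word_elt [j, i, j, i] (\<alpha> h + P 0 0)" if "h \<in> I" for h
    by (simp add: word_elt_apply s_translate[OF that] assms)
  assume "T_word [i, j, i, j] R = T_word [j, i, j, i] R" for R
  then have T: "T i (T j (T i (T j R))) = T j (T i (T j (T i R)))" for R
    by (simp add: T_word_apply)
  obtain k' l' where kl: "int k' * int l' = int 2"
    "perm_act (s i) (y (\<alpha> j)) = y (\<alpha> i) ^ k' * y (\<alpha> j)"
    "perm_act (s j) (y (\<alpha> i)) = y (\<alpha> i) * y (\<alpha> j) ^ l'"
    using scaled_cartan assms by (metis mult_1 of_nat_numeral)
  have neq: "y (\<alpha> i) * y (\<alpha> j) \<noteq> 1" "y (\<alpha> i) * y (\<alpha> j) ^ 2 \<noteq> 1" "y (\<alpha> j) * y (\<alpha> i) ^ 2 \<noteq> 1"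
    using y_monomial_neq_1[of 1 1] y_monomial_neq_1[of 1 2] y_monomial_neq_1[of 2 1]
    by (simp_all add: mult.commute)
  from kl(1) have "(k' = 1 \<and> l' = 2) \<or> (k' = 2 \<and> l' = 1)"
    by (rule nat_mult_eq_2_3_cases) simp
  then show "dem_word [i, j, i, j] R = dem_word [j, i, j, i] R" for R
  proof (elim disjE conjE)
    assume "k' = 1" "l' = 2"
    then have "dem i (dem j (dem i (dem j R))) = dem j (dem i (dem j (dem i R)))"
      using kl neq by (intro demazure_pair.braid4[OF demazure_pair, unfolded dem_eq] T) simp_all
    then show ?thesis
      by (simp add: dem_word_apply)
  next
    assume "k' = 2" "l' = 1"
    then have "dem j (dem i (dem j (dem i R))) = dem i (dem j (dem i (dem j R)))"
      using kl neq
      by (intro demazure_pair.braid4[OF demazure_pair.swap[OF demazure_pair], unfolded dem_eq]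
          T[symmetric]) (simp_all add: mult.commute)
    then show ?thesis
      by (simp add: dem_word_apply)
  qed
qed (use assms in \<open>simp_all add: word_simps\<close>)

lemma braid_pair6:
  assumes "k = 1" "l = 3"
  shows "braid_pair i j [i, j, i, j, i, j] [j, i, j, i, j, i]"
proof (rule braid_pairI')
  show "word_elt [i, j, i, j, i, j] (\<alpha> h + P 0 0) = word_elt [j, i, j, i, j, i] (\<alpha> h + P 0 0)" if "h \<in> I" for h
    by (simp add: word_elt_apply s_translate[OF that] assms)
  assume "T_word [i, j, i, j, i, j] R = T_word [j, i, j, i, j, i] R" for R
  then have T: "T i (T j (T i (T j (T i (T j R))))) = T j (T i (T j (T i (T j (T i R)))))" for R
    by (simp add: T_word_apply)
  obtain k' l' where kl: "int k' * int l' = int 3"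
    "perm_act (s i) (y (\<alpha> j)) = y (\<alpha> i) ^ k' * y (\<alpha> j)"
    "perm_act (s j) (y (\<alpha> i)) = y (\<alpha> i) * y (\<alpha> j) ^ l'"
    using scaled_cartan assms by (metis mult_1 of_nat_numeral)
  have neq: "y (\<alpha> i) * y (\<alpha> j) \<noteq> 1" "y (\<alpha> i) * y (\<alpha> j) ^ 2 \<noteq> 1" "y (\<alpha> j) * y (\<alpha> i) ^ 2 \<noteq> 1"
    "y (\<alpha> i) * y (\<alpha> j) ^ 3 \<noteq> 1" "y (\<alpha> j) * y (\<alpha> i) ^ 3 \<noteq> 1"
    "y (\<alpha> i) ^ 2 * y (\<alpha> j) ^ 3 \<noteq> 1" "y (\<alpha> j) ^ 2 * y (\<alpha> i) ^ 3 \<noteq> 1"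
    using y_monomial_neq_1[of 1 1] y_monomial_neq_1[of 1 2] y_monomial_neq_1[of 2 1]
      y_monomial_neq_1[of 1 3] y_monomial_neq_1[of 3 1] y_monomial_neq_1[of 2 3]
      y_monomial_neq_1[of 3 2]
    by (simp_all add: mult.commute)
  from kl(1) have "(k' = 1 \<and> l' = 3) \<or> (k' = 3 \<and> l' = 1)"
    by (rule nat_mult_eq_2_3_cases) simp
  then show "dem_word [i, j, i, j, i, j] R = dem_word [j, i, j, i, j, i] R" for R
  proof (elim disjE conjE)
    assume "k' = 1" "l' = 3"
    then have "dem i (dem j (dem i (dem j (dem i (dem j R))))) =
        dem j (dem i (dem j (dem i (dem j (dem i R)))))"
      using kl neq by (intro demazure_pair.braid6[OF demazure_pair, unfolded dem_eq] T) simp_all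
    then show ?thesis
      by (simp add: dem_word_apply)
  next
    assume "k' = 3" "l' = 1"
    then have "dem j (dem i (dem j (dem i (dem j (dem i R))))) =
        dem i (dem j (dem i (dem j (dem i (dem j R)))))"
      using kl neq
      by (intro demazure_pair.braid6[OF demazure_pair.swap[OF demazure_pair], unfolded dem_eq]
          T[symmetric]) (simp_all add: mult.commute)
    then show ?thesis
      by (simp add: dem_word_apply)
  qed
qed (use assms in \<open>simp_all add: word_simps\<close>)

text \<open>\<open>k\<close> and \<open>l\<close> vanish together, and otherwise
  \<open>k * k \<le> k * l \<le> 3\<close>; this leaves the types A1 x A1, A2, B2 and G2.\<close>

lemma ex_braid_pair_le:
  assumes "k \<le> l"
  shows "\<exists>ps qs. braid_pair i j ps qs"
proof -
  consider "k = 0" "l = 0" | "k = 1" "l = 1" | "k = 1" "l = 2" | "k = 1" "l = 3"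
  proof (cases "k = 0")
    case False
    then have "k \<ge> 1"
      using k_nonneg by simp
    then have "k * k \<le> k * l"
      using assms by (intro mult_left_mono) auto
    then have "k * k \<le> 3"
      using kl_le_3 by simp
    have "k = 1"
    proof (rule ccontr)
      assume "k \<noteq> 1"
      then have "2 * 2 \<le> k * k"
        using \<open>k \<ge> 1\<close> by (intro mult_mono) auto
      then show False
        using \<open>k * k \<le> 3\<close> by simp
    qed
    then show ?thesis
      using kl_le_3 assms that by force
  qed (use that k_eq_0_iff in auto)
  then show ?thesis
    using braid_pair2 braid_pair3 braid_pair4 braid_pair6 by cases blast+
qed

end

context metaplectic_datum
begin

lemma ex_braid_pair:
  assumes "i \<in> I" "j \<in> I" "i \<noteq> j"
  shows "\<exists>ps qs. braid_pair i j ps qs"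
proof -
  interpret simple_root_pair M i j "- coroot (\<alpha> i) (\<alpha> j)" "- coroot (\<alpha> j) (\<alpha> i)"
    using assms by unfold_locales auto
  show ?thesis
  proof (cases "- coroot (\<alpha> i) (\<alpha> j) \<le> - coroot (\<alpha> j) (\<alpha> i)")
    case True
    then show ?thesis by (rule ex_braid_pair_le)
  next
    case False
    then show ?thesis
      using simple_root_pair.ex_braid_pair_le[OF swap] braid_pair_swap by (meson linear)
  qed
qed

text \<open>The form of \<open>reduced_word\<close> given by \<open>reduced_word_iff\<close>, free
  of the minimum in \<open>weyl_length\<close>.\<close>

definition reduced_for :: "nat list \<Rightarrow> ('d lattice \<Rightarrow> 'd lattice) \<Rightarrow> bool" where
  "reduced_for is w \<longleftrightarrow> set is \<subseteq> I \<and> w = word_elt is \<and> length is = inv_count w"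

lemma reduced_for_weyl_group: "reduced_for is w \<Longrightarrow> w \<in> W"
  by (auto simp: reduced_for_def word_elt_weyl_group)

lemma reduced_for_ConsD:
  assumes "reduced_for (i # is) w"
  shows "reduced_for is (s i \<circ> w)" "i \<in> I" "inv w (\<alpha> i) \<in> negative_roots M"
proof -
  have *: "set is \<subseteq> I" "i \<in> I" "w = s i \<circ> word_elt is" "inv_count w = Suc (length is)"
    using assms by (auto simp: reduced_for_def word_elt_Cons)
  have w: "w \<in> W"
    using assms by (rule reduced_for_weyl_group)
  have eq: "s i \<circ> w = word_elt is"
    unfolding *(3) by (rule s_s_comp) fact
  have le: "inv_count (s i \<circ> w) \<le> length is"
    unfolding eq using * by (intro inv_count_word_elt_le)
  show "i \<in> I" by fact
  show neg: "inv w (\<alpha> i) \<in> negative_roots M"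
    using inv_simple_cases[OF w \<open>i \<in> I\<close>] inv_count_ascent[OF w \<open>i \<in> I\<close>] le *(4) by fastforce
  have "inv_count (s i \<circ> w) = length is"
    using inv_count_descent[OF w \<open>i \<in> I\<close> neg] *(4) by simp
  then show "reduced_for is (s i \<circ> w)"
    unfolding reduced_for_def eq using * by simp
qed

lemma reduced_for_append:
  assumes "reduced_for us (word_elt (rev ps) \<circ> w)" "set ps \<subseteq> I" "inv_count w = length ps + inv_count (word_elt (rev ps) \<circ> w)"
  shows "reduced_for (ps @ us) w"
proof -
  have "word_elt ps \<circ> (word_elt (rev ps) \<circ> w) = w"
    using word_elt_rev[OF assms(2)] by (simp only: o_assoc id_comp)
  then show ?thesis
    using assms unfolding reduced_for_def word_elt_append by auto
qed

text \<open>
  Matsumoto's argument: two reduced words with different first letters \<open>i\<close>, \<open>j\<close> are compared through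
  reduced words that start with the two sides of the braid relation for \<open>i\<close>, \<open>j\<close>.
\<close>

lemma dem_word_reduced:
  assumes "reduced_for is w" "reduced_for js w"
  shows "dem_word is = dem_word js"
  using assms
proof (induction "length is" arbitrary: "is" js w rule: less_induct)
  case less
  have len: "length js = length is"
    using less.prems by (simp add: reduced_for_def)
  show ?case
  proof (cases "is")
    case Nil
    then show ?thesis
      using len by simp
  next
    case (Cons i is')
    then obtain j js' where js: "js = j # js'"
      using len by (cases js) auto
    note Cons_is = Cons
    have w: "w \<in> W"
      using less.prems(1) by (rule reduced_for_weyl_group)
    note Di = reduced_for_ConsD[OF less.prems(1)[unfolded Cons_is]]
    note Dj = reduced_for_ConsD[OF less.prems(2)[unfolded js]]
    have IHi: "dem_word is = dem_word (i # ks)" if "reduced_for ks (s i \<circ> w)" for ks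
      using less.hyps[OF _ Di(1) that] by (simp only: Cons_is dem_word_Cons) simp
    have IHj: "dem_word js = dem_word (j # ks)" if "reduced_for ks (s j \<circ> w)" for ks
      using less.hyps[OF _ Dj(1) that] len by (simp only: js dem_word_Cons) simp
    show ?thesis
    proof (cases "i = j")
      case True
      then show ?thesis
        using IHi Dj(1) js by blast
    next
      case False
      obtain ps qs where pq: "braid_pair i j ps qs"
        using ex_braid_pair[OF Di(2) Dj(2) False] by blast
      then have "set ps \<subseteq> {i, j}" "set qs \<subseteq> {i, j}" and word_elt: "word_elt ps = word_elt qs"
        and dem: "dem_word ps = dem_word qs"
        unfolding braid_pair_def by blast+
      then have I: "set ps \<subseteq> I" "set qs \<subseteq> I"
        using Di(2) Dj(2) by auto
      have count: "inv_count w = length ps + inv_count (word_elt (rev ps) \<circ> w)" "inv_count w = length qs + inv_count (word_elt (rev qs) \<circ> w)"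
        using inv_count_braid_pair[OF pq Di(2) Dj(2) w Di(3) Dj(3)]
          inv_count_braid_pair[OF braid_pair_swap[OF pq] Dj(2) Di(2) w Dj(3) Di(3)] .
      \<comment> \<open>One word \<open>us\<close> completes both sides of the braid relation to
        reduced words of \<open>w\<close>, because \<open>ps\<close> and \<open>qs\<close> represent
        the same element.\<close>
      have "word_elt (rev ps) \<circ> w \<in> W"
        using I w by (intro weyl_group_comp word_elt_weyl_group) auto
      then obtain us where us: "reduced_for us (word_elt (rev ps) \<circ> w)"
        using ex_word_inv_count unfolding reduced_for_def by metis
      then have us': "reduced_for us (word_elt (rev qs) \<circ> w)"
        using word_elt_rev_eq[OF I(1)] word_elt_rev_eq[OF I(2)] word_elt by simp
      have red: "reduced_for (ps @ us) w" "reduced_for (qs @ us) w"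
        using reduced_for_append[OF us I(1) count(1)] reduced_for_append[OF us' I(2) count(2)] .
      obtain ps' qs' where ps: "ps = i # ps'" and qs: "qs = j # qs'"
        using pq unfolding braid_pair_def by (metis list.exhaust_sel)
      have "dem_word is = dem_word (ps @ us)"
        using IHi[OF reduced_for_ConsD(1)] red(1) by (simp add: ps)
      also have "\<dots> = dem_word (qs @ us)"
        by (simp only: dem_word_append dem)
      also have "\<dots> = dem_word js"
        using IHj[OF reduced_for_ConsD(1)] red(2) by (simp add: qs)
      finally show ?thesis .
    qed
  qed
qed

section \<open>The character formula in the twisted group algebra\<close>

text \<open>The coefficient vector of the identity operator.\<close>

definition unit_fun :: "('d lattice \<Rightarrow> 'd lattice) \<Rightarrow> 'd ratfun" where
  "unit_fun u = (if u = id then 1 else 0)"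

lemma dem_apply: "dem i R u = (R u - y (\<alpha> i) * perm_act (s i) (R (s i \<circ> u))) / (1 - y (\<alpha> i))"
  by (simp add: dem_def fscale_def T_def)

lemma perm_act_0: "w \<in> W \<Longrightarrow> perm_act w 0 = 0"
  using field_endo.zero[OF field_endo_perm] .

lemma dem_word_support:
  assumes "set is \<subseteq> I" "dem_word is unit_fun u \<noteq> 0"
  shows "\<exists>js. set js \<subseteq> I \<and> length js \<le> length is \<and> u = word_elt js"
  using assms
proof (induction "is" arbitrary: u)
  case Nil
  then show ?case
    by (auto simp: unit_fun_def split: if_splits intro!: exI[of _ "[]"])
next
  case (Cons i "is")
  then have i: "i \<in> I" and is_I: "set is \<subseteq> I" by auto
  define R where "R = dem_word is unit_fun"
  have "dem i R u \<noteq> 0"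
    using Cons.prems(2) by (simp add: R_def dem_word_Cons)
  then have "R u \<noteq> 0 \<or> R (s i \<circ> u) \<noteq> 0"
    using perm_act_0[OF s_weyl_group[OF i]] unfolding dem_apply by auto
  then show ?case
  proof
    assume "R u \<noteq> 0"
    then show ?case
      using Cons.IH[OF is_I, of u] unfolding R_def by (meson le_SucI length_Cons dual_order.trans impossible_Cons nat_le_linear)
  next
    assume "R (s i \<circ> u) \<noteq> 0"
    then obtain js where js: "set js \<subseteq> I" "length js \<le> length is" "s i \<circ> u = word_elt js"
      using Cons.IH[OF is_I, of "s i \<circ> u"] unfolding R_def by blast
    then have "u = word_elt (i # js)"
      using s_s_comp[OF i, of u] by (simp only: word_elt_Cons)
    then show ?case
      using js i by (intro exI[of _ "i # js"]) auto
  qed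
qed

lemma prod_inversions_s_comp:
  assumes "w \<in> W" "i \<in> I" "inv w (\<alpha> i) \<in> positive_roots M"
  shows "(\<Prod>\<beta>\<in>inversions M (inv (s i \<circ> w)). f \<beta>) = f (\<alpha> i) * (\<Prod>\<beta>\<in>inversions M (inv w). f (s i \<beta>))"
  unfolding inversions_s_comp(1)[OF assms] using inversions_s_comp(2)[OF assms]
  by (simp add: prod.reindex inj_s assms)

lemma dem_word_leading:
  assumes "reduced_for is w"
  shows "dem_word is unit_fun w = (\<Prod>\<beta>\<in>inversions M (inv w). - y \<beta> / (1 - y \<beta>))"
  using assms
proof (induction "is" arbitrary: w)
  case Nil
  then have "w = id" "card (inversions M (inv w)) = 0"
    by (auto simp: reduced_for_def inv_count_def)
  then show ?case
    by (auto simp: unit_fun_def)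
next
  case (Cons i "is")
  note D = reduced_for_ConsD[OF Cons.prems]
  define u where "u = s i \<circ> w"
  have w: "w \<in> W"
    using Cons.prems by (rule reduced_for_weyl_group)
  have u: "u \<in> W" and w_eq: "w = s i \<circ> u" "s i \<circ> w = u"
    using w D(2) by (auto simp: u_def weyl_group_comp s_weyl_group s_s_comp)
  have pos: "inv u (\<alpha> i) \<in> positive_roots M"
    using D(3) inv_s_comp_simple[OF w D(2)] by (simp add: u_def negative_roots_iff)
  interpret field_endo "perm_act (s i)" by (intro field_endo_perm s_weyl_group D)
  have "length is < inv_count w" "set is \<subseteq> I"
    using Cons.prems by (auto simp: reduced_for_def)
  \<comment> \<open>The tail is too short to reach \<open>w\<close>, so the term of
    \<open>dem i\<close> without reflection vanishes and a single product survives.\<close>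
  then have "dem_word is unit_fun w = 0"
    using dem_word_support[of "is" w] inv_count_word_elt_le by fastforce
  then have "dem_word (i # is) unit_fun w =
      - y (\<alpha> i) / (1 - y (\<alpha> i)) * perm_act (s i) (dem_word is unit_fun u)"
    by (simp add: dem_word_Cons dem_apply w_eq(2))
  also have "dem_word is unit_fun u = (\<Prod>\<beta>\<in>inversions M (inv u). - y \<beta> / (1 - y \<beta>))"
    using Cons.IH[OF D(1)] by (simp only: u_def)
  also have "perm_act (s i) \<dots> = (\<Prod>\<beta>\<in>inversions M (inv u). - y (s i \<beta>) / (1 - y (s i \<beta>)))"
    by (simp add: prod divide minus diff perm_act_y s_weyl_group D)
  also have "- y (\<alpha> i) / (1 - y (\<alpha> i)) * \<dots> = (\<Prod>\<beta>\<in>inversions M (inv w). - y \<beta> / (1 - y \<beta>))"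
    unfolding w_eq(1) by (rule prod_inversions_s_comp[OF u D(2) pos, symmetric])
  finally show ?case .
qed

lemma reduced_for_long_element_Cons:
  assumes "long_element M w\<^sub>0" "i \<in> I"
  shows "\<exists>is. reduced_for (i # is) w\<^sub>0"
proof -
  have w0: "w\<^sub>0 \<in> W"
    using assms by (simp add: long_element_def)
  then have "s i \<circ> w\<^sub>0 \<in> W"
    using assms by (intro weyl_group_comp s_weyl_group)
  then obtain "is" where "is": "set is \<subseteq> I" "s i \<circ> w\<^sub>0 = word_elt is" "length is = inv_count (s i \<circ> w\<^sub>0)"
    using ex_word_inv_count by blast
  moreover have "w\<^sub>0 = word_elt (i # is)"
    using s_s_comp[OF assms(2), of w\<^sub>0] "is"(2) by (simp only: word_elt_Cons)
  moreover have "inv_count w\<^sub>0 = Suc (inv_count (s i \<circ> w\<^sub>0))"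
    by (rule inv_count_descent[OF w0 assms(2) long_element_negative[OF assms]])
  ultimately show ?thesis
    using assms(2) unfolding reduced_for_def by (intro exI[of _ "is"]) simp
qed

text \<open>Some reduced word of the long element begins with \<open>i\<close>. By independence of
  the word, the operator may be taken to begin with \<open>dem i\<close>, whose values are fixed by
  \<open>T i\<close>.\<close>

lemma dem_word_long_element_invariant:
  assumes "long_element M w\<^sub>0" "reduced_for ws w\<^sub>0" "i \<in> I"
  shows "dem_word ws R (s i \<circ> u) = perm_act (s i) (dem_word ws R u)"
proof -
  obtain "is" where "is": "reduced_for (i # is) w\<^sub>0"
    using reduced_for_long_element_Cons[OF assms(1,3)] by blast
  interpret demazure_operator "perm_act (s i)" fscale "T i" "y (\<alpha> i)"
    by (rule demazure_operator_T) fact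
  have eq: "dem_word ws R = dem i (dem_word is R)"
    using dem_word_reduced[OF assms(2) "is"] by (simp add: dem_word_Cons)
  have "T i (dem_word ws R) = dem_word ws R"
    using S_D demazure_operator_D[OF assms(3)] by (simp add: eq)
  then have "dem_word ws R (s i \<circ> u) = T i (dem_word ws R) (s i \<circ> u)"
    by simp
  also have "\<dots> = perm_act (s i) (dem_word ws R u)"
    unfolding T_def s_s_comp[OF assms(3)] ..
  finally show ?thesis .
qed

lemma weyl_denominator_eq: "weyl_denominator M = (\<Prod>\<beta>\<in>positive_roots M. 1 - y \<beta>)"
  by (simp add: weyl_denominator_def y_def)

lemma weyl_denominator_nonzero: "weyl_denominator M \<noteq> 0"
  using y_neq_1 positive_root by (fastforce simp: weyl_denominator_eq)

lemma perm_act_weyl_denominator: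
  assumes "i \<in> I"
  shows "perm_act (s i) (weyl_denominator M) = - weyl_denominator M / y (\<alpha> i)"
proof -
  interpret field_endo "perm_act (s i)" by (intro field_endo_perm s_weyl_group assms)
  let ?P = "positive_roots M - {\<alpha> i}"
  have "s i \<beta> \<noteq> \<alpha> i" if "\<beta> \<in> positive_roots M" for \<beta>
  proof
    assume "s i \<beta> = \<alpha> i"
    then have "\<beta> = - \<alpha> i"
      using assms by (metis refl_refl refl_self simple_root)
    then show False
      using that positive_not_negative[OF simple_positive[OF assms]] by (simp add: negative_roots_iff)
  qed
  then have "bij_betw (s i) ?P ?P"
    using assms
    by (intro bij_betw_byWitness[where f' = "s i"]) (auto intro: simple_refl_positive simp: positive_root)
  then have P: "(\<Prod>\<beta>\<in>?P. 1 - y (s i \<beta>)) = (\<Prod>\<beta>\<in>?P. 1 - y \<beta>)"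
    by (rule prod.reindex_bij_betw)
  have split: "(\<Prod>\<beta>\<in>positive_roots M. f \<beta>) = f (\<alpha> i) * (\<Prod>\<beta>\<in>?P. f \<beta>)"
    for f :: "'d lattice \<Rightarrow> 'd ratfun"
    using assms by (intro prod.remove) auto
  have "perm_act (s i) (weyl_denominator M) = (\<Prod>\<beta>\<in>positive_roots M. 1 - y (s i \<beta>))"
    by (simp add: weyl_denominator_eq prod diff perm_act_y s_weyl_group assms)
  also have "\<dots> = (1 - 1 / y (\<alpha> i)) * (\<Prod>\<beta>\<in>?P. 1 - y \<beta>)"
    using assms by (simp add: split P refl_self y_uminus)
  also have "\<dots> = - ((1 - y (\<alpha> i)) * (\<Prod>\<beta>\<in>?P. 1 - y \<beta>)) / y (\<alpha> i)"
    by (simp add: field_simps)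
  finally show ?thesis
    by (simp add: weyl_denominator_eq split)
qed

definition weyl_coeff :: "(('d lattice \<Rightarrow> 'd lattice) \<Rightarrow> int) \<Rightarrow> ('d lattice \<Rightarrow> 'd lattice) \<Rightarrow> 'd ratfun" where
  "weyl_coeff \<epsilon> w = of_int (\<epsilon> w) * (\<Prod>\<beta>\<in>inversions M (inv w). y \<beta>) / weyl_denominator M"

lemma sign_s_comp:
  assumes "sign_character M \<epsilon>" "i \<in> I" "w \<in> W"
  shows "\<epsilon> (s i \<circ> w) = - \<epsilon> w"
  using assms s_weyl_group[OF assms(2)] by (simp add: sign_character_def I_def)

text \<open>Needed for the sign of the identity: \<open>sign_character\<close> does not prescribe
  it, and with no simple root the zero function would qualify.\<close>

lemma I_nonempty: "I \<noteq> {}"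
proof
  assume "I = {}"
  then have "lincomb k = 0" for k
    by (simp add: lincomb_def)
  then show False
    using roots_nonempty root_lincomb root_nonzero by (metis ex_in_conv)
qed

lemma sign_id:
  assumes "sign_character M \<epsilon>"
  shows "\<epsilon> id = 1"
proof -
  obtain i where i: "i \<in> I"
    using I_nonempty by blast
  have "\<epsilon> (s i) = -1"
    using assms i by (simp add: sign_character_def I_def)
  then show ?thesis
    using sign_s_comp[OF assms i weyl_group.id] by simp
qed

lemma sign_word_elt:
  assumes "sign_character M \<epsilon>" "set is \<subseteq> I"
  shows "\<epsilon> (word_elt is) = (-1) ^ length is"
  using assms(2)
proof (induction "is")
  case (Cons i "is")
  then have "\<epsilon> (s i \<circ> word_elt is) = - \<epsilon> (word_elt is)"
    by (intro sign_s_comp assms word_elt_weyl_group) auto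
  then show ?case
    using Cons by (simp only: word_elt_Cons) simp
qed (simp add: sign_id assms)

text \<open>Three changes compensate: the sign flips, \<open>y (\<alpha> i)\<close> enters the
  product, and \<open>s i\<close> multiplies the inverse denominator by
  \<open>- y (\<alpha> i)\<close>.\<close>

lemma weyl_coeff_s_comp_ascent:
  assumes "sign_character M \<epsilon>" "i \<in> I" "w \<in> W" "inv w (\<alpha> i) \<in> positive_roots M"
  shows "weyl_coeff \<epsilon> (s i \<circ> w) = perm_act (s i) (weyl_coeff \<epsilon> w)"
proof -
  interpret field_endo "perm_act (s i)" by (intro field_endo_perm s_weyl_group assms)
  show ?thesis
    unfolding weyl_coeff_def prod_inversions_s_comp[OF assms(3,2,4)] sign_s_comp[OF assms(1-3)]
    using assms(2) weyl_denominator_nonzero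
    by (simp add: mult divide of_int prod perm_act_y s_weyl_group perm_act_weyl_denominator)
qed

text \<open>A descent at \<open>w\<close> is an ascent at \<open>s i \<circ> w\<close> read
  backwards, \<open>s i\<close> being an involution.\<close>

lemma weyl_coeff_s_comp:
  assumes "sign_character M \<epsilon>" "i \<in> I" "w \<in> W"
  shows "weyl_coeff \<epsilon> (s i \<circ> w) = perm_act (s i) (weyl_coeff \<epsilon> w)"
proof (rule inv_simple_cases[OF assms(3,2)])
  assume "inv w (\<alpha> i) \<in> negative_roots M"
  then have "inv (s i \<circ> w) (\<alpha> i) \<in> positive_roots M"
    using inv_s_comp_simple[OF assms(3,2)] by (simp add: negative_roots_iff)
  then have "weyl_coeff \<epsilon> (s i \<circ> (s i \<circ> w)) = perm_act (s i) (weyl_coeff \<epsilon> (s i \<circ> w))"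
    using assms by (intro weyl_coeff_s_comp_ascent weyl_group_comp s_weyl_group)
  then have "perm_act (s i) (weyl_coeff \<epsilon> w) = perm_act (s i) (perm_act (s i) (weyl_coeff \<epsilon> (s i \<circ> w)))"
    unfolding s_s_comp[OF assms(2)] by simp
  also have "\<dots> = weyl_coeff \<epsilon> (s i \<circ> w)"
    unfolding perm_act_perm_act[OF s_weyl_group[OF assms(2)] s_weyl_group[OF assms(2)]]
      s_s[OF assms(2)] by simp
  finally show ?thesis ..
qed (rule weyl_coeff_s_comp_ascent[OF assms])

lemma dem_word_long_element:
  assumes "sign_character M \<epsilon>" "long_element M w\<^sub>0" "reduced_for ws w\<^sub>0" "w \<in> W"
  shows "dem_word ws unit_fun w = weyl_coeff \<epsilon> w"
proof -
  have w0: "w\<^sub>0 \<in> W"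
    using assms by (simp add: long_element_def)
  have base: "dem_word ws unit_fun w\<^sub>0 = weyl_coeff \<epsilon> w\<^sub>0"
  proof -
    have "(-1) ^ length ws = (-1 :: 'd ratfun) ^ card (positive_roots M)"
      using assms(3) unfolding reduced_for_def inv_count_def inversions_long_element[OF assms(2)] by simp
    moreover have "\<epsilon> w\<^sub>0 = (-1) ^ length ws"
      using sign_word_elt[OF assms(1)] assms(3) unfolding reduced_for_def by metis
    ultimately have "of_int (\<epsilon> w\<^sub>0) = (-1 :: 'd ratfun) ^ card (positive_roots M)"
      by simp
    then show ?thesis
      unfolding dem_word_leading[OF assms(3)] weyl_coeff_def inversions_long_element[OF assms(2)]
        weyl_denominator_eq prod_dividef prod_uminus
      by simp
  qed
  \<comment> \<open>Both sides obey the same rule under left multiplication by simple reflections,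
    so the value at the long element spreads over the whole group.\<close>
  have step: "dem_word ws unit_fun (word_elt is \<circ> w\<^sub>0) = weyl_coeff \<epsilon> (word_elt is \<circ> w\<^sub>0)" if "set is \<subseteq> I" for "is"
    using that
  proof (induction "is")
    case (Cons i "is")
    then have i: "i \<in> I" and is_I: "set is \<subseteq> I" by auto
    have W: "word_elt is \<circ> w\<^sub>0 \<in> W"
      using is_I w0 by (intro weyl_group_comp word_elt_weyl_group)
    show ?case
      unfolding word_elt_Cons comp_assoc dem_word_long_element_invariant[OF assms(2,3) i]
        weyl_coeff_s_comp[OF assms(1) i W] Cons.IH[OF is_I] ..
  qed (simp add: base)
  have "w \<circ> inv w\<^sub>0 \<in> W"
    using w0 assms by (intro weyl_group_comp weyl_group_inv)
  then obtain "is" where "is": "set is \<subseteq> I" "w \<circ> inv w\<^sub>0 = word_elt is"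
    using weyl_group_word by blast
  have "inv w\<^sub>0 \<circ> w\<^sub>0 = id"
    using weyl_group_bij[OF w0] by (auto simp: fun_eq_iff bij_is_inj)
  then have "w = word_elt is \<circ> w\<^sub>0"
    unfolding "is"(2)[symmetric] by (simp only: comp_assoc comp_id)
  then show ?thesis
    using step[OF "is"(1)] by simp
qed

section \<open>The metaplectic reflections\<close>

abbreviation \<Lambda>\<^sub>0 :: "'d lattice set" where "\<Lambda>\<^sub>0 \<equiv> sublattice0 M"

lemma bform_diff_right: "bform M l (x - z) = bform M l x - bform M l z"
  by (rule additive.diff[OF bform_additive])

lemma sublattice0_iff: "l \<in> \<Lambda>\<^sub>0 \<longleftrightarrow> (\<forall>j\<in>I. int (cover M) dvd bform M (\<alpha> j) l)"
  by (simp add: sublattice0_def I_def dvd_eq_mod_eq_0)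

lemma sublattice0_0: "0 \<in> \<Lambda>\<^sub>0"
  using bform_cmul[of _ 0 0] by (simp add: sublattice0_iff)

lemma sublattice0_diff: "l \<in> \<Lambda>\<^sub>0 \<Longrightarrow> l' \<in> \<Lambda>\<^sub>0 \<Longrightarrow> l - l' \<in> \<Lambda>\<^sub>0"
  by (simp add: sublattice0_iff bform_diff_right)

lemma sublattice0_sym: "l - l' \<in> \<Lambda>\<^sub>0 \<Longrightarrow> l' - l \<in> \<Lambda>\<^sub>0"
  using sublattice0_diff[OF sublattice0_0, of "l - l'"] by simp

lemma sublattice0_trans: "l - l' \<in> \<Lambda>\<^sub>0 \<Longrightarrow> l' - l'' \<in> \<Lambda>\<^sub>0 \<Longrightarrow> l - l'' \<in> \<Lambda>\<^sub>0"
  using sublattice0_diff[of "l - l'" "l'' - l'"] sublattice0_sym[of l' l''] by simp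

text \<open>Roots are integral combinations of simple roots. The extension to all roots makes the
  sublattice stable under the Weyl group.\<close>

lemma sublattice0_root:
  assumes "l \<in> \<Lambda>\<^sub>0" "\<beta> \<in> roots M"
  shows "int (cover M) dvd bform M \<beta> l"
proof -
  obtain k where "\<beta> = lincomb k"
    using root_lincomb[OF assms(2)] by blast
  moreover have "bform M l (lincomb k) = (\<Sum>i\<in>I. k i * bform M l (\<alpha> i))"
    by (simp add: lincomb_def additive.sum[OF bform_additive] bform_cmul)
  ultimately have "bform M \<beta> l = (\<Sum>i\<in>I. k i * bform M (\<alpha> i) l)"
    by (simp add: bform_commute[of _ l])
  then show ?thesis
    using assms(1) by (auto simp: sublattice0_iff intro!: dvd_sum dvd_mult)
qed

lemma bform_refl:
  assumes "\<beta> \<in> roots M"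
  shows "bform M (refl M \<beta> l) (refl M \<beta> l') = bform M l l'"
  using additive.add[OF additive_refl[OF assms], of l l'] assms
  by (simp add: bform_def qform_invariant flip: additive.add[OF additive_refl[OF assms]])

lemma sublattice0_weyl: "w \<in> W \<Longrightarrow> l \<in> \<Lambda>\<^sub>0 \<Longrightarrow> w l \<in> \<Lambda>\<^sub>0"
proof (induction rule: weyl_group.induct)
  case (refl \<beta> w)
  have "bform M (\<alpha> j) (refl M \<beta> (w l)) = bform M (refl M \<beta> (\<alpha> j)) (w l)" for j
    using bform_refl[OF refl(1), of "refl M \<beta> (\<alpha> j)" "w l"] refl(1) by simp
  then show ?case
    using refl sublattice0_root by (auto simp: sublattice0_iff[of "refl M \<beta> (w l)"] refl_root)
qed simp

lemma mroot_simple_sublattice0: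
  assumes "i \<in> I"
  shows "frag_cmul (mroot M (\<alpha> i)) (\<alpha> i) \<in> \<Lambda>\<^sub>0"
proof -
  have "int (cover M) dvd mroot M (\<alpha> i) * qform M (\<alpha> i)"
    by (simp flip: mroot_dvd_iff)
  moreover have "qform M (\<alpha> i) dvd bform M (\<alpha> j) (\<alpha> i)" for j
    using integrality assms by (simp add: I_def)
  ultimately show ?thesis
    unfolding sublattice0_iff bform_cmul by (meson dvd_refl dvd_trans mult_dvd_mono)
qed

section \<open>Characters of the quotient lattice and the decomposition into components\<close>

abbreviation \<Xi> :: "('d lattice \<Rightarrow> complex) set" where "\<Xi> \<equiv> characters M"

lemma
  assumes "\<xi> \<in> \<Xi>"
  shows character_nonzero: "\<xi> l \<noteq> 0" and character_add: "\<xi> (l + l') = \<xi> l * \<xi> l'"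
    and character_trivial: "l \<in> \<Lambda>\<^sub>0 \<Longrightarrow> \<xi> l = 1"
  using assms by (auto simp: characters_def)

lemma character_diff: "\<xi> \<in> \<Xi> \<Longrightarrow> \<xi> (l - l') = \<xi> l / \<xi> l'"
  using character_add[of \<xi> "l - l'" l'] character_nonzero[of \<xi> l'] by (simp add: field_simps)

lemma character_one: "(\<lambda>_. 1) \<in> \<Xi>"
  by (simp add: characters_def)

lemma character_mult: "\<xi> \<in> \<Xi> \<Longrightarrow> \<eta> \<in> \<Xi> \<Longrightarrow> (\<lambda>l. \<xi> l * \<eta> l) \<in> \<Xi>"
  by (simp add: characters_def)

lemma character_inverse: "\<xi> \<in> \<Xi> \<Longrightarrow> (\<lambda>l. inverse (\<xi> l)) \<in> \<Xi>"
  by (simp add: characters_def)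

text \<open>For a simple root \<open>\<alpha> j\<close> at which the congruence fails, the character
  \<open>cis (2 * pi * bform M (\<alpha> j) x / cover M)\<close> separates.\<close>

lemma character_separates:
  assumes "l \<notin> \<Lambda>\<^sub>0"
  shows "\<exists>\<xi>\<in>\<Xi>. \<xi> l \<noteq> 1"
proof -
  obtain j where j: "j \<in> I" "\<not> int (cover M) dvd bform M (\<alpha> j) l"
    using assms by (auto simp: sublattice0_iff)
  define \<theta> where "\<theta> x = 2 * pi * real_of_int (bform M (\<alpha> j) x) / real (cover M)" for x
  have trivial: "cis (\<theta> x) = 1 \<longleftrightarrow> int (cover M) dvd bform M (\<alpha> j) x" for x
  proof -
    have "cis (\<theta> x) = 1 \<longleftrightarrow> cos (\<theta> x) = 1"
      using cos_one_sin_zero by (auto simp: complex_eq_iff)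
    also have "\<dots> \<longleftrightarrow> (\<exists>k::int. \<theta> x = real_of_int k * 2 * pi)"
      by (rule cos_one_2pi_int)
    also have "\<dots> \<longleftrightarrow> (\<exists>k::int. bform M (\<alpha> j) x = int (cover M) * k)"
    proof -
      have "\<theta> x = real_of_int k * 2 * pi \<longleftrightarrow> bform M (\<alpha> j) x = int (cover M) * k" for k
      proof -
        have "\<theta> x = real_of_int k * 2 * pi \<longleftrightarrow>
            real_of_int (bform M (\<alpha> j) x) = real_of_int (int (cover M) * k)"
          using cover_pos by (auto simp: \<theta>_def field_simps)
        then show ?thesis
          by (simp only: of_int_eq_iff)
      qed
      then show ?thesis by simp
    qed
    finally show ?thesis
      by (simp add: dvd_def)
  qed
  have "\<theta> (x + z) = \<theta> x + \<theta> z" for x z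
    by (simp add: \<theta>_def additive.add[OF bform_additive] add_divide_distrib ring_distribs)
  then have "(\<lambda>x. cis (\<theta> x)) \<in> \<Xi>"
    unfolding characters_def using j(1)
    by (auto simp: trivial sublattice0_iff cis_mult)
  then show ?thesis
    using trivial[of l] j(2) by (intro bexI[of _ "\<lambda>x. cis (\<theta> x)"]) auto
qed

text \<open>The sublattice contains \<open>cover M\<close> times the lattice, so a character is
  given by roots of unity of that order on the free generators.\<close>

lemma finite_characters: "finite \<Xi>"
proof (rule finite_imageD)
  let ?r = "\<lambda>\<xi> d. \<xi> (frag_of d) :: complex"
  let ?U = "{z :: complex. z ^ cover M = 1}"
  have fin: "finite ?U"
    using cover_pos by (intro finite_roots_unity) simp
  show "finite (?r ` \<Xi>)"
  proof (rule finite_subset)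
    show "?r ` \<Xi> \<subseteq> (UNIV :: 'd set) \<rightarrow>\<^sub>E ?U"
    proof (clarsimp simp: PiE_UNIV_domain)
      fix \<xi> d assume \<xi>: "\<xi> \<in> \<Xi>"
      have "\<xi> (frag_cmul (int n) l) = \<xi> l ^ n" for n l
        using character_trivial[OF \<xi> sublattice0_0]
        by (induction n) (simp_all add: frag_cmul_distrib character_add[OF \<xi>])
      moreover have "frag_cmul (int (cover M)) l \<in> \<Lambda>\<^sub>0" for l
        by (simp add: sublattice0_iff bform_cmul)
      ultimately show "\<xi> (frag_of d) ^ cover M = 1"
        using character_trivial[OF \<xi>] by metis
    qed
  qed (use fin in \<open>simp add: finite_PiE\<close>)
  show "inj_on ?r \<Xi>"
  proof (rule inj_onI)
    fix \<xi> \<eta> assume *: "\<xi> \<in> \<Xi>" "\<eta> \<in> \<Xi>" "?r \<xi> = ?r \<eta>"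
    have "\<xi> l = \<eta> l" for l
      using subset_UNIV[of "Poly_Mapping.keys l"]
    proof (induction l rule: frag_induction)
      case zero
      then show ?case
        using character_trivial[OF _ sublattice0_0] * by metis
    next
      case (one d)
      then show ?case
        using fun_cong[OF *(3), of d] by simp
    next
      case (diff a b)
      then show ?case
        using * by (simp add: character_diff)
    qed
    then show "\<xi> = \<eta>" ..
  qed
qed

text \<open>Orthogonality: translation by a character \<open>\<eta>\<close> permutes the summands
  but multiplies the sum by \<open>\<eta> l\<close>, which can be chosen different from 1 outside
  the sublattice.\<close>

lemma sum_characters:
  "(\<Sum>\<xi>\<in>\<Xi>. \<xi> l) = (if l \<in> \<Lambda>\<^sub>0 then of_nat (card \<Xi>) else 0)"
proof (cases "l \<in> \<Lambda>\<^sub>0")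
  case False
  then obtain \<eta> where \<eta>: "\<eta> \<in> \<Xi>" "\<eta> l \<noteq> 1"
    using character_separates by blast
  have "bij_betw (\<lambda>\<xi> l. \<eta> l * \<xi> l) \<Xi> \<Xi>"
    using \<eta>(1) character_inverse[OF \<eta>(1)] character_nonzero[OF \<eta>(1)]
    by (intro bij_betw_byWitness[where f' = "\<lambda>\<xi> l. inverse (\<eta> l) * \<xi> l"])
      (auto simp: character_mult fun_eq_iff)
  then have "(\<Sum>\<xi>\<in>\<Xi>. \<xi> l) = (\<Sum>\<xi>\<in>\<Xi>. \<eta> l * \<xi> l)"
    using sum.reindex_bij_betw[of "\<lambda>\<xi> l. \<eta> l * \<xi> l" \<Xi> \<Xi> "\<lambda>\<xi>. \<xi> l"] by simp
  then have "(\<Sum>\<xi>\<in>\<Xi>. \<xi> l) = \<eta> l * (\<Sum>\<xi>\<in>\<Xi>. \<xi> l)"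
    unfolding sum_distrib_left .
  then have "(1 - \<eta> l) * (\<Sum>\<xi>\<in>\<Xi>. \<xi> l) = 0"
    unfolding left_diff_distrib by simp
  then show ?thesis
    using \<eta>(2) False by simp
qed (simp add: character_trivial)

lemma field_endo_character: "\<xi> \<in> \<Xi> \<Longrightarrow> field_endo (char_act \<xi>)"
  by (intro field_endo_char_act) (auto simp: character_nonzero character_add)

lemma char_act_character_const: "\<xi> \<in> \<Xi> \<Longrightarrow> char_act \<xi> (const c) = const c"
  by (intro char_act_const) (auto simp: character_nonzero character_add)

lemma char_act_character_xpow: "\<xi> \<in> \<Xi> \<Longrightarrow> char_act \<xi> (xpow l) = const (\<xi> l) * xpow l"
  by (intro char_act_xpow) (auto simp: character_nonzero character_add)

lemma char_act_comp:
  assumes "\<xi> \<in> \<Xi>" "\<eta> \<in> \<Xi>"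
  shows "char_act \<xi> (char_act \<eta> f) = char_act (\<lambda>l. \<xi> l * \<eta> l) f"
proof -
  interpret h: field_endo "char_act \<xi>" by (rule field_endo_character) fact
  interpret h': field_endo "char_act \<eta>" by (rule field_endo_character) fact
  have "field_endo (\<lambda>f. char_act \<xi> (char_act \<eta> f))"
    by unfold_locales (simp_all add: h.add h'.add h.mult h'.mult)
  from ratfun_endo_eqI[OF this field_endo_character[OF character_mult[OF assms]]] show ?thesis
    using assms
    by (simp add: char_act_character_const char_act_character_xpow character_mult h.mult const_mult)
qed

lemma component_iff: "f \<in> component M l \<longleftrightarrow> (\<forall>\<xi>\<in>\<Xi>. char_act \<xi> f = const (\<xi> l) * f)"
  by (simp add: component_def)

definition char_norm :: "'d ratfun \<Rightarrow> 'd ratfun" where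
  "char_norm f = (\<Prod>\<xi>\<in>\<Xi>. char_act \<xi> f)"

lemma char_act_char_norm:
  assumes "\<eta> \<in> \<Xi>"
  shows "char_act \<eta> (char_norm f) = char_norm f"
proof -
  interpret field_endo "char_act \<eta>" by (rule field_endo_character) fact
  have bij: "bij_betw (\<lambda>\<xi> l. \<eta> l * \<xi> l) \<Xi> \<Xi>"
    using assms character_inverse[OF assms] character_nonzero[OF assms]
    by (intro bij_betw_byWitness[where f' = "\<lambda>\<xi> l. inverse (\<eta> l) * \<xi> l"])
      (auto simp: character_mult fun_eq_iff)
  have "char_act \<eta> (char_norm f) = (\<Prod>\<xi>\<in>\<Xi>. char_act (\<lambda>l. \<eta> l * \<xi> l) f)"
    unfolding char_norm_def prod using assms by (intro prod.cong) (simp_all add: char_act_comp)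
  also have "\<dots> = char_norm f"
    unfolding char_norm_def by (rule prod.reindex_bij_betw[OF bij])
  finally show ?thesis .
qed

text \<open>
  Expanding a fraction by the other conjugates of its denominator makes the denominator invariant
  under all characters; the terms of the numerator then give the components.
\<close>

lemma component_decomposition:
  "\<exists>A g. finite A \<and> f = (\<Sum>l\<in>A. g l) \<and> (\<forall>l\<in>A. g l \<in> component M l)"
proof -
  obtain p q where f: "f = Fract p q" "q \<noteq> 0"
    by (cases f) auto
  have laurent: "\<exists>r. (\<Prod>\<xi>\<in>A. char_act \<xi> (Fract q 1)) = Fract r 1" if "A \<subseteq> \<Xi>" for A
    using finite_subset[OF that finite_characters] that
  proof (induction A rule: finite_induct)
    case (insert \<xi> A)
    then obtain r r' where "(\<Prod>\<xi>\<in>A. char_act \<xi> (Fract q 1)) = Fract r 1" "char_act \<xi> (Fract q 1) = Fract r' 1"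
      using char_act_Laurent[of \<xi> q] f(2) by (auto simp: character_nonzero character_add)
    then show ?case
      using insert by auto
  qed (auto simp: One_fract_def)
  define N where "N = char_norm (Fract q 1)"
  have "char_act \<xi> (Fract q 1) \<noteq> 0" if "\<xi> \<in> \<Xi>" for \<xi>
    using field_endo.eq_0_iff[OF field_endo_character[OF that]] f(2)
    by (simp add: Zero_fract_def eq_fract)
  then have N: "N \<noteq> 0"
    unfolding N_def char_norm_def using finite_characters by simp
  have "char_act (\<lambda>_. 1) (Fract q 1) = Fract q 1"
  proof -
    have "field_endo (\<lambda>f :: 'd ratfun. f)"
      by unfold_locales auto
    from ratfun_endo_eqI[OF field_endo_character[OF character_one] this] show ?thesis
      using character_one by (simp add: char_act_character_const char_act_character_xpow)
  qed
  then have "N = Fract q 1 * (\<Prod>\<xi>\<in>\<Xi> - {\<lambda>_. 1}. char_act \<xi> (Fract q 1))"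
    unfolding N_def char_norm_def using prod.remove[OF finite_characters character_one] by metis
  moreover obtain r where "(\<Prod>\<xi>\<in>\<Xi> - {\<lambda>_. 1}. char_act \<xi> (Fract q 1)) = Fract r 1"
    using laurent[of "\<Xi> - {\<lambda>_. 1}"] by blast
  ultimately have N_eq: "N = Fract q 1 * Fract r 1"
    by simp
  have "f = Fract p 1 / Fract q 1"
    by (simp add: f)
  also have "\<dots> = Fract p 1 * Fract r 1 / N"
  proof -
    have "Fract r 1 \<noteq> 0"
      using N N_eq by (metis mult_zero_right)
    then show ?thesis
      unfolding N_eq by (rule nonzero_mult_divide_mult_cancel_right[symmetric])
  qed
  also have "\<dots> = Fract (p * r) 1 / N"
    by simp
  also have "\<dots> = (\<Sum>l\<in>Poly_Mapping.keys (p * r). const (Poly_Mapping.lookup (p * r) l) * xpow l / N)"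
    by (simp only: Fract_eq_sum sum_divide_distrib)
  finally have "f = (\<Sum>l\<in>Poly_Mapping.keys (p * r). const (Poly_Mapping.lookup (p * r) l) * xpow l / N)" .
  moreover have "const c * xpow l / N \<in> component M l" for c l
    unfolding component_iff
  proof
    fix \<xi> assume \<xi>: "\<xi> \<in> \<Xi>"
    interpret field_endo "char_act \<xi>" by (rule field_endo_character) fact
    show "char_act \<xi> (const c * xpow l / N) = const (\<xi> l) * (const c * xpow l / N)"
      using \<xi> by (simp add: mult divide char_act_character_const char_act_character_xpow N_def char_act_char_norm)
  qed
  ultimately show ?thesis
    using finite_keys by blast
qed

text \<open>The averaging projection of a finite abelian group onto an isotypic component.\<close>

definition component_proj :: "'d lattice \<Rightarrow> 'd ratfun \<Rightarrow> 'd ratfun" where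
  "component_proj l f = const (1 / of_nat (card \<Xi>)) * (\<Sum>\<xi>\<in>\<Xi>. const (inverse (\<xi> l)) * char_act \<xi> f)"

lemma component_proj_add: "component_proj l (f + g) = component_proj l f + component_proj l g"
  by (simp add: component_proj_def field_endo.add[OF field_endo_character] ring_distribs sum.distrib)

lemma component_proj_component:
  assumes "f \<in> component M l'"
  shows "component_proj l f = (if l' - l \<in> \<Lambda>\<^sub>0 then f else 0)"
proof -
  have "(\<Sum>\<xi>\<in>\<Xi>. const (inverse (\<xi> l)) * char_act \<xi> f) = (\<Sum>\<xi>\<in>\<Xi>. const (\<xi> (l' - l)) * f)"
    using assms
    by (intro sum.cong) (auto simp: component_iff character_diff divide_inverse const_mult)
  also have "\<dots> = const (\<Sum>\<xi>\<in>\<Xi>. \<xi> (l' - l)) * f"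
    by (simp add: const_sum sum_distrib_right)
  finally have "component_proj l f =
      const (1 / of_nat (card \<Xi>) * (if l' - l \<in> \<Lambda>\<^sub>0 then of_nat (card \<Xi>) else 0)) * f"
    by (simp only: component_proj_def sum_characters const_mult mult.assoc)
  moreover have "card \<Xi> \<noteq> 0"
    using finite_characters character_one by auto
  ultimately show ?thesis
    by simp
qed

text \<open>A representative that depends only on the class, so that \<open>range class_rep\<close>
  meets every class exactly once.\<close>

definition class_rep :: "'d lattice \<Rightarrow> 'd lattice" where
  "class_rep l = (SOME l'. l' - l \<in> \<Lambda>\<^sub>0)"

lemma class_rep: "class_rep l - l \<in> \<Lambda>\<^sub>0"
  unfolding class_rep_def by (rule someI[of _ l]) (simp add: sublattice0_0)

lemma class_rep_eqI:
  assumes "l - l' \<in> \<Lambda>\<^sub>0"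
  shows "class_rep l = class_rep l'"
proof -
  have "l'' - l \<in> \<Lambda>\<^sub>0 \<longleftrightarrow> l'' - l' \<in> \<Lambda>\<^sub>0" for l''
    using assms sublattice0_trans sublattice0_sym by blast
  then show ?thesis
    by (simp add: class_rep_def)
qed

lemma finite_class_reps: "finite (range class_rep)"
proof -
  define \<kappa> where "\<kappa> l = (\<lambda>j\<in>I. bform M (\<alpha> j) l mod int (cover M))" for l
  have "range \<kappa> \<subseteq> I \<rightarrow>\<^sub>E {0..<int (cover M)}"
    using cover_pos by (auto simp: \<kappa>_def)
  then have "finite (range \<kappa>)"
    by (rule finite_subset) (intro finite_PiE; simp)
  moreover have "class_rep l = class_rep (SOME l'. \<kappa> l' = \<kappa> l)" for l
  proof (rule class_rep_eqI)
    define l' where "l' = (SOME l'. \<kappa> l' = \<kappa> l)"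
    have \<kappa>: "\<kappa> l' = \<kappa> l"
      unfolding l'_def by (rule someI[of _ l]) simp
    have "int (cover M) dvd bform M (\<alpha> j) l - bform M (\<alpha> j) l'" if "j \<in> I" for j
      using fun_cong[OF \<kappa>, of j] that by (simp add: \<kappa>_def flip: mod_eq_dvd_iff)
    then show "l - (SOME l'. \<kappa> l' = \<kappa> l) \<in> \<Lambda>\<^sub>0"
      unfolding l'_def[symmetric] sublattice0_iff bform_diff_right by blast
  qed
  then have "range class_rep \<subseteq> (\<lambda>x. class_rep (SOME l'. \<kappa> l' = x)) ` range \<kappa>"
    by blast
  ultimately show ?thesis
    using finite_surj by blast
qed

text \<open>Congruence of the bilinear values modulo \<open>cover M\<close> gives congruence of
  their quotients by \<open>?Q\<close> modulo \<open>mroot M (\<alpha> i)\<close>; the formula sees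
  nothing else of \<open>l\<close>.\<close>

lemma refl_formula_cong:
  assumes "i \<in> I" "l - l' \<in> \<Lambda>\<^sub>0"
  shows "refl_formula M i l f = refl_formula M i l' f"
proof -
  let ?Q = "qform M (\<alpha> i)" and ?b = "bform M l (\<alpha> i)" and ?b' = "bform M l' (\<alpha> i)"
  have n: "int (cover M) dvd ?b - ?b'"
    using assms by (simp add: sublattice0_iff bform_diff_right bform_commute[of _ "\<alpha> i"])
  have Q: "?Q dvd ?b" "?Q dvd ?b'"
    using integrality assms(1) by (auto simp: I_def)
  then have eq: "(?b div ?Q - ?b' div ?Q) * ?Q = ?b - ?b'"
    by (simp add: algebra_simps)
  then have "mroot M (\<alpha> i) dvd ?b div ?Q - ?b' div ?Q"
    using n by (simp add: mroot_dvd_iff)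
  then have "(- (?b div ?Q)) mod mroot M (\<alpha> i) = (- (?b' div ?Q)) mod mroot M (\<alpha> i)"
    by (subst mod_eq_dvd_iff) (simp add: dvd_diff_commute)
  moreover have "gauss M (?Q - ?b) = gauss M (?Q - ?b')"
  proof -
    have "(?Q - ?b) mod int (cover M) = (?Q - ?b') mod int (cover M)"
      using n by (subst mod_eq_dvd_iff) (simp add: dvd_diff_commute)
    then show ?thesis
      by (simp add: gauss_def)
  qed
  ultimately show ?thesis
    by (simp add: refl_formula_def Let_def)
qed

lemma refl_formula_add:
  assumes "i \<in> I"
  shows "refl_formula M i l (f + g) = refl_formula M i l f + refl_formula M i l g"
  using field_endo.add[OF field_endo_perm[OF s_weyl_group[OF assms]]]
  by (simp add: refl_formula_def Let_def add_divide_distrib ring_distribs)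

lemma refl_formula_mult:
  assumes "i \<in> I"
  shows "refl_formula M i l (h * f) = perm_act (s i) h * refl_formula M i l f"
  using field_endo.mult[OF field_endo_perm[OF s_weyl_group[OF assms]]]
  by (simp add: refl_formula_def Let_def)

lemma additive_eqI_components:
  assumes "additive F" "additive G" "\<And>l f. f \<in> component M l \<Longrightarrow> F f = G f"
  shows "F f = G f"
proof -
  obtain A g where "f = (\<Sum>l\<in>A. g l)" "\<forall>l\<in>A. g l \<in> component M l"
    using component_decomposition by blast
  then show ?thesis
    using assms(3) by (auto simp: additive.sum[OF assms(1)] additive.sum[OF assms(2)] intro: sum.cong)
qed

lemma ex1_meta_refl:
  assumes i: "i \<in> I"
  shows "\<exists>!F. additive F \<and> (\<forall>l. \<forall>f\<in>component M l. F f = refl_formula M i l f)"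
proof (rule ex_ex1I)
  \<comment> \<open>Existence: the formula is applied to each projection. On
    \<open>component M l\<close> only the projection for the class of \<open>l\<close> can be
    nonzero.\<close>
  define F where "F f = (\<Sum>l\<in>range class_rep. refl_formula M i l (component_proj l f))" for f
  have "additive F"
    by (simp add: additive_def F_def component_proj_add refl_formula_add i sum.distrib)
  moreover have "F f = refl_formula M i l f" if "f \<in> component M l" for l f
  proof -
    have "refl_formula M i l' (component_proj l' f) =
        (if l' = class_rep l then refl_formula M i l f else 0)" if mem: "l' \<in> range class_rep" for l'
    proof (cases "l' = class_rep l")
      case True
      then show ?thesis
        using component_proj_component[OF \<open>f \<in> component M l\<close>, of l'] class_rep[of l]
          sublattice0_sym refl_formula_cong[OF i class_rep, of l f] by simp
    next
      case False
      obtain l'' where l'': "l' = class_rep l''"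
        using mem by blast
      have "l - l' \<notin> \<Lambda>\<^sub>0"
      proof
        assume "l - l' \<in> \<Lambda>\<^sub>0"
        then have "l - l'' \<in> \<Lambda>\<^sub>0"
          using class_rep[of l''] unfolding l'' by (rule sublattice0_trans)
        then show False
          using False class_rep_eqI[of l l''] l'' by simp
      qed
      moreover have "refl_formula M i l' 0 = 0"
        using refl_formula_add[OF i, of l' 0 0] by (metis add_0 add_cancel_right_right)
      ultimately show ?thesis
        using component_proj_component[OF \<open>f \<in> component M l\<close>, of l'] False by simp
    qed
    then have "F f = (\<Sum>l'\<in>range class_rep. if l' = class_rep l then refl_formula M i l f else 0)"
      unfolding F_def by (intro sum.cong) auto
    then show ?thesis
      using finite_class_reps by simp
  qed
  ultimately show "\<exists>F. additive F \<and> (\<forall>l. \<forall>f\<in>component M l. F f = refl_formula M i l f)"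
    by blast
next
  fix F G assume "additive F \<and> (\<forall>l. \<forall>f\<in>component M l. F f = refl_formula M i l f)"
    "additive G \<and> (\<forall>l. \<forall>f\<in>component M l. G f = refl_formula M i l f)"
  then show "F = G"
    using additive_eqI_components[of F G] by auto
qed

lemma
  assumes "i \<in> I"
  shows additive_meta_refl: "additive (meta_refl M i)"
    and meta_refl_component: "f \<in> component M l \<Longrightarrow> meta_refl M i f = refl_formula M i l f"
  using theI'[OF ex1_meta_refl[OF assms]] unfolding meta_refl_def by blast+

text \<open>Characters are trivial on the exponent, so multiplication by the monomial preserves
  every component, and there the formula is semilinear for the permutation action.\<close>

lemma meta_refl_xpow_mult:
  assumes i: "i \<in> I" and l: "l \<in> \<Lambda>\<^sub>0"
  shows "meta_refl M i (xpow l * f) = xpow (s i l) * meta_refl M i f"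
proof (rule additive_eqI_components[of "\<lambda>f. meta_refl M i (xpow l * f)" "\<lambda>f. xpow (s i l) * meta_refl M i f"])
  interpret additive "meta_refl M i" by (rule additive_meta_refl) fact
  show "additive (\<lambda>f. meta_refl M i (xpow l * f))" "additive (\<lambda>f. xpow (s i l) * meta_refl M i f)"
    by (simp_all add: additive_def add ring_distribs)
  fix l' f assume f: "f \<in> component M l'"
  have "xpow l * f \<in> component M l'"
    unfolding component_iff
  proof
    fix \<xi> assume \<xi>: "\<xi> \<in> \<Xi>"
    then show "char_act \<xi> (xpow l * f) = const (\<xi> l') * (xpow l * f)"
      using f l by (simp add: field_endo.mult[OF field_endo_character] char_act_character_xpow
          character_trivial component_iff)
  qed
  moreover have "perm_act (s i) (xpow l) = xpow (s i l)"
    using i by (simp add: perm_act_xpow additive_refl inj_s)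
  ultimately show "meta_refl M i (xpow l * f) = xpow (s i l) * meta_refl M i f"
    using f i by (simp add: meta_refl_component refl_formula_mult)
qed

text \<open>Quantifying over \<open>w\<close> makes this subfield stable under the permutation action.\<close>

definition semilinear_mults :: "'d ratfun set" where
  "semilinear_mults = {h. \<forall>w\<in>W. \<forall>i\<in>I. \<forall>f.
     meta_refl M i (perm_act w h * f) = perm_act (s i) (perm_act w h) * meta_refl M i f}"

lemma semilinear_multsD:
  assumes "h \<in> semilinear_mults" "i \<in> I"
  shows "meta_refl M i (h * f) = perm_act (s i) h * meta_refl M i f"
proof -
  have "id \<in> W"
    by (rule weyl_group.id)
  then have "meta_refl M i (perm_act id h * f) = perm_act (s i) (perm_act id h) * meta_refl M i f"
    using assms unfolding semilinear_mults_def by blast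
  then show ?thesis
    by simp
qed

lemma semilinear_mults_xpow:
  assumes "l \<in> \<Lambda>\<^sub>0"
  shows "xpow l \<in> semilinear_mults"
  using assms sublattice0_weyl
  by (auto simp: semilinear_mults_def perm_act_xpow weyl_group_additive bij_is_inj[OF weyl_group_bij]
      meta_refl_xpow_mult additive_refl inj_s)

lemma semilinear_mults_0: "0 \<in> semilinear_mults"
  using additive.zero[OF additive_meta_refl] s_weyl_group by (auto simp: semilinear_mults_def perm_act_0)

lemma semilinear_mults_1: "1 \<in> semilinear_mults"
  using semilinear_mults_xpow[OF sublattice0_0] by simp

lemma semilinear_mults_diff:
  assumes "h \<in> semilinear_mults" "h' \<in> semilinear_mults"
  shows "h - h' \<in> semilinear_mults"
  using assms unfolding semilinear_mults_def
  by (simp add: field_endo.diff[OF field_endo_perm] s_weyl_group left_diff_distrib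
      additive.diff[OF additive_meta_refl])

lemma semilinear_mults_mult:
  assumes "h \<in> semilinear_mults" "h' \<in> semilinear_mults"
  shows "h * h' \<in> semilinear_mults"
  using assms unfolding semilinear_mults_def
  by (simp add: field_endo.mult[OF field_endo_perm] s_weyl_group mult.assoc)

lemma semilinear_mults_inverse:
  assumes "h \<in> semilinear_mults"
  shows "inverse h \<in> semilinear_mults"
proof (cases "h = 0")
  case False
  show ?thesis
    unfolding semilinear_mults_def
  proof (intro CollectI ballI allI)
    fix w i f assume w: "w \<in> W" and i: "i \<in> I"
    interpret w: field_endo "perm_act w" by (rule field_endo_perm) fact
    interpret s: field_endo "perm_act (s i)" by (intro field_endo_perm s_weyl_group i)
    let ?h = "perm_act w h"
    have nz: "?h \<noteq> 0" "perm_act (s i) ?h \<noteq> 0"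
      using False by simp_all
    have "meta_refl M i (?h * (inverse ?h * f)) = perm_act (s i) ?h * meta_refl M i (inverse ?h * f)"
      using assms w i unfolding semilinear_mults_def by blast
    moreover have "?h * (inverse ?h * f) = f"
      using nz by simp
    ultimately show "meta_refl M i (perm_act w (inverse h) * f) =
        perm_act (s i) (perm_act w (inverse h)) * meta_refl M i f"
      unfolding w.inverse s.inverse using nz by (simp add: nonzero_eq_divide_eq)
  qed
qed (simp add: semilinear_mults_0)

lemma semilinear_mults_perm:
  assumes "h \<in> semilinear_mults" "w \<in> W"
  shows "perm_act w h \<in> semilinear_mults"
  unfolding semilinear_mults_def
proof (intro CollectI ballI allI)
  fix w' i f assume "w' \<in> W" "i \<in> I"
  then show "meta_refl M i (perm_act w' (perm_act w h) * f) =
      perm_act (s i) (perm_act w' (perm_act w h)) * meta_refl M i f"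
    using assms weyl_group_comp[of w' w] unfolding semilinear_mults_def
    by (simp add: perm_act_perm_act)
qed

lemma semilinear_mults_y: "i \<in> I \<Longrightarrow> y (\<alpha> i) \<in> semilinear_mults"
  unfolding y_def by (intro semilinear_mults_xpow mroot_simple_sublattice0)

lemma semilinear_mults_dem_word:
  assumes "set is \<subseteq> I"
  shows "dem_word is unit_fun u \<in> semilinear_mults"
  using assms
proof (induction "is" arbitrary: u)
  case Nil
  then show ?case
    by (simp add: unit_fun_def semilinear_mults_0 semilinear_mults_1)
next
  case (Cons i "is")
  then have i: "i \<in> I" and IH: "dem_word is unit_fun u \<in> semilinear_mults" for u
    by auto
  have "dem i (dem_word is unit_fun) u \<in> semilinear_mults"
    unfolding dem_apply divide_inverse
    by (intro semilinear_mults_mult semilinear_mults_diff semilinear_mults_inverse semilinear_mults_perm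
        semilinear_mults_1 semilinear_mults_y s_weyl_group i IH)
  then show ?case
    by (simp add: dem_word_Cons)
qed

lemma demazure_eq: "demazure M i f = (f - y (\<alpha> i) * meta_refl M i f) / (1 - y (\<alpha> i))"
  by (simp add: demazure_def y_def)

lemma bij_betw_s_comp:
  assumes "i \<in> I"
  shows "bij_betw (\<lambda>w. s i \<circ> w) W W"
  using weyl_group_comp[OF s_weyl_group[OF assms]] s_s_comp[OF assms]
  by (intro bij_betw_byWitness[where f' = "\<lambda>w. s i \<circ> w"]) auto

definition operator_of ::
    "(('d lattice \<Rightarrow> 'd lattice) \<Rightarrow> 'd ratfun \<Rightarrow> 'd ratfun) \<Rightarrow>
     (('d lattice \<Rightarrow> 'd lattice) \<Rightarrow> 'd ratfun) \<Rightarrow> 'd ratfun \<Rightarrow> 'd ratfun" where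
  "operator_of act R f = (\<Sum>w\<in>W. R w * act w f)"

text \<open>Semilinearity moves \<open>meta_refl M i\<close> past a coefficient, which becomes its
  permuted image; reindexing the sum by \<open>s i\<close> then produces the operator
  \<open>T i\<close> on coefficients.\<close>

lemma demazure_operator_of:
  assumes act: "metaplectic_action M act" and i: "i \<in> I"
    and R: "\<And>w. w \<in> W \<Longrightarrow> R w \<in> semilinear_mults"
  shows "demazure M i (operator_of act R f) = operator_of act (dem i R) f"
proof -
  interpret additive "meta_refl M i" by (rule additive_meta_refl) fact
  have act_s: "meta_refl M i (act w f) = act (s i \<circ> w) f" if "w \<in> W" for w
    using act s_weyl_group[OF i] that i unfolding metaplectic_action_def I_def by (metis comp_apply)
  have "meta_refl M i (operator_of act R f) = (\<Sum>w\<in>W. perm_act (s i) (R w) * act (s i \<circ> w) f)"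
    unfolding operator_of_def sum
    by (intro sum.cong) (simp_all add: semilinear_multsD R i act_s)
  also have "\<dots> = (\<Sum>w\<in>W. perm_act (s i) (R (s i \<circ> w)) * act w f)"
    by (subst sum.reindex_bij_betw[OF bij_betw_s_comp[OF i], symmetric]) (simp only: s_s_comp[OF i])
  finally have "demazure M i (operator_of act R f) =
      ((\<Sum>w\<in>W. R w * act w f) - y (\<alpha> i) * (\<Sum>w\<in>W. perm_act (s i) (R (s i \<circ> w)) * act w f))
        / (1 - y (\<alpha> i))"
    by (simp add: demazure_eq operator_of_def)
  also have "\<dots> = (\<Sum>w\<in>W. (R w * act w f - y (\<alpha> i) * (perm_act (s i) (R (s i \<circ> w)) * act w f))
        / (1 - y (\<alpha> i)))"
    by (simp only: sum_distrib_left sum_subtractf[symmetric] sum_divide_distrib)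
  also have "\<dots> = operator_of act (dem i R) f"
    unfolding operator_of_def dem_apply by (intro sum.cong) (simp_all add: algebra_simps)
  finally show ?thesis .
qed

lemma demazure_word_eq_operator_of:
  assumes act: "metaplectic_action M act" and "set is \<subseteq> I"
  shows "demazure_word M is f = operator_of act (dem_word is unit_fun) f"
  using assms(2)
proof (induction "is")
  case Nil
  have "operator_of act unit_fun f = (\<Sum>w\<in>W. if w = id then f else 0)"
    unfolding operator_of_def using act
    by (intro sum.cong) (auto simp: unit_fun_def metaplectic_action_def)
  then show ?case
    using finite_weyl_group weyl_group.id[of M] by (simp add: demazure_word_def)
next
  case (Cons i "is")
  then show ?case
    using demazure_operator_of[OF act, of i "dem_word is unit_fun" f] semilinear_mults_dem_word[of "is"]
    by (simp add: demazure_word_def dem_word_Cons)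
qed

end

theorem theorem3:
  fixes M :: "'d::{finite,linorder} metaplectic_data"
    and act :: "('d lattice \<Rightarrow> 'd lattice) \<Rightarrow> 'd ratfun \<Rightarrow> 'd ratfun"
    and \<epsilon> :: "('d lattice \<Rightarrow> 'd lattice) \<Rightarrow> int"
    and w\<^sub>0 :: "'d lattice \<Rightarrow> 'd lattice"
    and ws :: "nat list"
  assumes "metaplectic_datum M"
    and "metaplectic_action M act"
    and "sign_character M \<epsilon>"
    and "long_element M w\<^sub>0"
    and "reduced_word M ws w\<^sub>0"
  shows "demazure_word M ws =
    (\<lambda>f. 1 / weyl_denominator M *
       (\<Sum>w\<in>weyl_group M. of_int (\<epsilon> w) *
          (\<Prod>\<alpha>\<in>inversions M (inv w). xpow (frag_cmul (mroot M \<alpha>) \<alpha>)) * act w f))"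
proof
  fix f
  interpret metaplectic_datum M by fact
  have ws: "reduced_for ws w\<^sub>0"
    using assms(5) by (simp add: reduced_word_iff reduced_for_def)
  then have "demazure_word M ws f = operator_of act (dem_word ws unit_fun) f"
    using assms(2) by (intro demazure_word_eq_operator_of) (auto simp: reduced_for_def)
  also have "\<dots> = (\<Sum>w\<in>weyl_group M. weyl_coeff \<epsilon> w * act w f)"
    unfolding operator_of_def using assms(3,4) ws
    by (intro sum.cong) (simp_all add: dem_word_long_element)
  also have "\<dots> = 1 / weyl_denominator M *
       (\<Sum>w\<in>weyl_group M. of_int (\<epsilon> w) *
          (\<Prod>\<alpha>\<in>inversions M (inv w). xpow (frag_cmul (mroot M \<alpha>) \<alpha>)) * act w f)"
    by (simp add: weyl_coeff_def y_def sum_distrib_left)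
  finally show "demazure_word M ws f = 1 / weyl_denominator M *
       (\<Sum>w\<in>weyl_group M. of_int (\<epsilon> w) *
          (\<Prod>\<alpha>\<in>inversions M (inv w). xpow (frag_cmul (mroot M \<alpha>) \<alpha>)) * act w f)" .
qed

end
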